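(* $D(A)$ as well as $D(\mathcal{A})$ are dense subsets of $(L^{1}(\Omega;L^{1}(S)),\|\cdot\|_{L^{1}(\Omega;L^{1}(S))})$.
   Context: Setting. $n\in\mathbb{N}$, $n\ge 2$; $p\in(1,\infty)\setminus\{2\}$; $S\subseteq\mathbb{R}^{n}$ is a nonempty open, bounded, connected set of class $C^{1}$; $\lambda$ is Lebesgue measure; $0<g_{1}\le g_{2}<\infty$ are constants. $(\Omega,\mathcal{F},\mathbb{P})$ is a complete probability space. For a Banach space $X$, $L^{1}(\Omega;X)$ is the space of $\mathcal{F}$-$\mathfrak{B}(X)$-measurable $f:\Omega\to X$ with $\int_{\Omega}\|f\|_{X}\,d\mathbb{P}<\infty$ (with its usual norm). $L^{1}_{g_{1},g_{2}}(S):=\{\gamma\in L^{1}(S): g_{1}\le\gamma\le g_{2}\text{ a.e. on }S\}$, and $g\in L^{1}(\Omega;L^{1}(S))$ is fixed with $\mathbb{P}(g\in L^{1}_{g_{1},g_{2}}(S))=1$. Convention: $|x|^{p-2}x:=0$ if $x=0$. Operators. $A$ is the operator on $L^{1}(\Omega;L^{1}(S))$ with $(f,\hat f)\in A$ if and only if $f,\hat f\in L^{1}(\Omega;L^{1}(S))$, $\mathbb{P}(f\in W^{1,p}(S)\cap L^{\infty}(S))=1$, and with probability one $\int_{S}g|\nabla f|^{p-2}\nabla f\cdot\nabla\varphi\,d\lambda=\int_{S}\hat f\varphi\,d\lambda$ for all $\varphi\in W^{1,p}(S)\cap L^{\infty}(S)$. $\mathcal{A}$ is the closure of $A$ in $L^{1}(\Omega;L^{1}(S))^{2}$.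 $D(B)$ denotes the domain of an operator $B$, i.e. the set of $f$ for which there is $\hat f$ with $(f,\hat f)\in B$. *)

theory Defs
  imports "HOL-Probability.Probability"
begin

section \<open>The space of (classes of) Lebesgue integrable functions\<close>

text \<open>
  Elements of the following type are almost-everywhere classes of integrable real functions on the
  whole space.  Representatives are taken Borel measurable; as every Lebesgue measurable function
  agrees almost everywhere with a Borel measurable one, the classes are the usual ones.
\<close>

definition L1_rel :: "('a::euclidean_space \<Rightarrow> real) \<Rightarrow> ('a \<Rightarrow> real) \<Rightarrow> bool" where
  "L1_rel u v \<longleftrightarrow> integrable lborel u \<and> integrable lborel v \<and> (AE x in lborel. u x = v x)"

quotient_type (overloaded) 'a L1 = "'a::euclidean_space \<Rightarrow> real" / partial: L1_rel
proof (rule part_equivpI)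
  show "\<exists>u::'a \<Rightarrow> real. L1_rel u u"
    by (rule exI[of _ "\<lambda>_. 0"]) (simp add: L1_rel_def)
  show "symp (L1_rel :: ('a \<Rightarrow> real) \<Rightarrow> _)"
    by (rule sympI) (auto simp: L1_rel_def elim!: eventually_mono)
  show "transp (L1_rel :: ('a \<Rightarrow> real) \<Rightarrow> _)"
    by (rule transpI) (auto simp: L1_rel_def)
qed

instantiation L1 :: (euclidean_space) real_normed_vector
begin

lift_definition zero_L1 :: "'a L1" is "\<lambda>_. 0"
  by (simp add: L1_rel_def)

lift_definition plus_L1 :: "'a L1 \<Rightarrow> 'a L1 \<Rightarrow> 'a L1" is "\<lambda>u v x. u x + v x"
  by (auto simp: L1_rel_def)

lift_definition minus_L1 :: "'a L1 \<Rightarrow> 'a L1 \<Rightarrow> 'a L1" is "\<lambda>u v x. u x - v x"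
  by (auto simp: L1_rel_def)

lift_definition uminus_L1 :: "'a L1 \<Rightarrow> 'a L1" is "\<lambda>u x. - u x"
  by (auto simp: L1_rel_def)

lift_definition scaleR_L1 :: "real \<Rightarrow> 'a L1 \<Rightarrow> 'a L1" is "\<lambda>c u x. c * u x"
  by (auto simp: L1_rel_def)

lift_definition norm_L1 :: "'a L1 \<Rightarrow> real" is "\<lambda>u. LINT x|lborel. \<bar>u x\<bar>"
  by (auto simp: L1_rel_def intro!: integral_cong_AE)

definition dist_L1 :: "'a L1 \<Rightarrow> 'a L1 \<Rightarrow> real" where
  "dist_L1 u v = norm (u - v)"

definition sgn_L1 :: "'a L1 \<Rightarrow> 'a L1" where
  "sgn_L1 u = inverse (norm u) *\<^sub>R u"

definition uniformity_L1 :: "('a L1 \<times> 'a L1) filter" where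
  "uniformity_L1 = (INF e\<in>{0<..}. principal {(u, v). dist u v < e})"

definition open_L1 :: "'a L1 set \<Rightarrow> bool" where
  "open_L1 U \<longleftrightarrow> (\<forall>u\<in>U. eventually (\<lambda>(u', v). u' = u \<longrightarrow> v \<in> U) uniformity)"

instance
proof
  fix u v w :: "'a L1" and a b :: real
  show "u + v + w = u + (v + w)" by transfer (auto simp: L1_rel_def algebra_simps)
  show "u + v = v + u" by transfer (auto simp: L1_rel_def algebra_simps)
  show "0 + u = u" by transfer (auto simp: L1_rel_def)
  show "- u + u = 0" by transfer (auto simp: L1_rel_def)
  show "u - v = u + - v" by transfer (auto simp: L1_rel_def)
  show "a *\<^sub>R (u + v) = a *\<^sub>R u + a *\<^sub>R v" by transfer (auto simp: L1_rel_def algebra_simps)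
  show "(a + b) *\<^sub>R u = a *\<^sub>R u + b *\<^sub>R u" by transfer (auto simp: L1_rel_def algebra_simps)
  show "a *\<^sub>R b *\<^sub>R u = (a * b) *\<^sub>R u" by transfer (auto simp: L1_rel_def algebra_simps)
  show "1 *\<^sub>R u = u" by transfer (auto simp: L1_rel_def)
  show "dist u v = norm (u - v)" by (rule dist_L1_def)
  show "sgn u = inverse (norm u) *\<^sub>R u" by (rule sgn_L1_def)
  show "uniformity = (INF e\<in>{0<..}. principal {(u::'a L1, v). dist u v < e})"
    by (rule uniformity_L1_def)
  show "open U \<longleftrightarrow> (\<forall>u\<in>U. eventually (\<lambda>(u', v). u' = u \<longrightarrow> v \<in> U) uniformity)"
    for U :: "'a L1 set" by (rule open_L1_def)
  show "norm u = 0 \<longleftrightarrow> u = 0"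
    by transfer (auto simp: L1_rel_def integral_nonneg_eq_0_iff_AE)
  show "norm (u + v) \<le> norm u + norm v"
  proof transfer
    fix u v :: "'a \<Rightarrow> real"
    assume "L1_rel u u" "L1_rel v v"
    then have *: "integrable lborel u" "integrable lborel v" by (auto simp: L1_rel_def)
    have "(LINT x|lborel. \<bar>u x + v x\<bar>) \<le> (LINT x|lborel. \<bar>u x\<bar> + \<bar>v x\<bar>)"
      using * by (intro integral_mono) auto
    then show "(LINT x|lborel. \<bar>u x + v x\<bar>) \<le> (LINT x|lborel. \<bar>u x\<bar>) + (LINT x|lborel. \<bar>v x\<bar>)"
      using * by simp
  qed
  show "norm (a *\<^sub>R u) = \<bar>a\<bar> * norm u"
    by transfer (auto simp: L1_rel_def abs_mult)
qed

end

lemma integrable_rep_L1: "integrable lborel (rep_L1 u)"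
  using Quotient_rep_reflp[OF Quotient_L1, of u] by (auto simp: L1_rel_def)

lemma norm_L1_rep: "norm u = (LINT x|lborel. \<bar>rep_L1 u x\<bar>)"
proof -
  have "L1_rel (rep_L1 u) (rep_L1 u)"
    by (simp add: L1_rel_def integrable_rep_L1)
  from norm_L1.abs_eq[OF this] show ?thesis
    by (simp add: Quotient_abs_rep[OF Quotient_L1])
qed

text \<open>
  \<open>L\<^sup>1(S)\<close> is realised as the closed subspace of classes vanishing outside \<open>S\<close>, that is, its
  elements are extended by zero; this identification is isometric.
\<close>

definition L1_on :: "'a::euclidean_space set \<Rightarrow> 'a L1 set" where
  "L1_on S = {u. AE x in lborel. x \<notin> S \<longrightarrow> rep_L1 u x = 0}"

definition L1_between :: "real \<Rightarrow> real \<Rightarrow> 'a::euclidean_space set \<Rightarrow> 'a L1 set" where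
  "L1_between g1 g2 S =
     {u \<in> L1_on S. AE x in lborel. x \<in> S \<longrightarrow> g1 \<le> rep_L1 u x \<and> rep_L1 u x \<le> g2}"

definition Linf_on :: "'a::euclidean_space set \<Rightarrow> 'a L1 set" where
  "Linf_on S = {u \<in> L1_on S. \<exists>C. AE x in lborel. x \<in> S \<longrightarrow> \<bar>rep_L1 u x\<bar> \<le> C}"


section \<open>Domains of class \<open>C\<^sup>1\<close> and Sobolev spaces\<close>

primrec C_k :: "nat \<Rightarrow> ('a::euclidean_space \<Rightarrow> real) \<Rightarrow> bool" where
  "C_k 0 f \<longleftrightarrow> continuous_on UNIV f"
| "C_k (Suc k) f \<longleftrightarrow> (\<forall>x. f differentiable (at x)) \<and>
     (\<forall>i\<in>Basis. C_k k (\<lambda>x. frechet_derivative f (at x) i))"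

text \<open>
  Near each boundary point, after permuting coordinates and possibly reflecting one of them, the
  set is the strict epigraph of a \<open>C\<^sup>1\<close> function of the other \<open>n - 1\<close> coordinates.  Such a function
  is encoded as a \<open>C\<^sup>1\<close> function on the whole space that does not depend on the \<open>i\<close>-th coordinate.
\<close>

definition C1_domain :: "'a::euclidean_space set \<Rightarrow> bool" where
  "C1_domain S \<longleftrightarrow>
     (\<forall>x0\<in>frontier S. \<exists>r>0. \<exists>i\<in>Basis. \<exists>\<sigma>\<in>{-1, 1::real}. \<exists>\<gamma>.
        C_k 1 \<gamma> \<and> (\<forall>x t. \<gamma> (x + t *\<^sub>R i) = \<gamma> x) \<and>
        S \<inter> ball x0 r = {x \<in> ball x0 r. \<gamma> x < \<sigma> * (x \<bullet> i)})"

definition test_functions :: "'a::euclidean_space set \<Rightarrow> ('a \<Rightarrow> real) set" where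
  "test_functions S =
     {\<phi>. (\<forall>k. C_k k \<phi>) \<and> (\<exists>K. compact K \<and> K \<subseteq> S \<and> (\<forall>x. x \<notin> K \<longrightarrow> \<phi> x = 0))}"

definition has_weak_gradient ::
    "'a::euclidean_space set \<Rightarrow> ('a \<Rightarrow> real) \<Rightarrow> ('a \<Rightarrow> 'a) \<Rightarrow> bool" where
  "has_weak_gradient S u G \<longleftrightarrow>
     (\<forall>K. compact K \<and> K \<subseteq> S \<longrightarrow> set_integrable lborel K u \<and> set_integrable lborel K G) \<and>
     (\<forall>\<phi>\<in>test_functions S. \<forall>i\<in>Basis.
        (LINT x:S|lborel. u x * frechet_derivative \<phi> (at x) i)
          = - (LINT x:S|lborel. (G x \<bullet> i) * \<phi> x))"

text \<open>The weak gradient is unique almost everywhere on \<open>S\<close>, so any choice will do.\<close>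

definition weak_grad :: "'a::euclidean_space set \<Rightarrow> 'a L1 \<Rightarrow> 'a \<Rightarrow> 'a" where
  "weak_grad S u = (SOME G. has_weak_gradient S (rep_L1 u) G)"

text \<open>
  Membership in \<open>L1_on S\<close> is no restriction when \<open>S\<close> is bounded, since then \<open>L\<^sup>p(S) \<subseteq> L\<^sup>1(S)\<close>.
\<close>

definition W1p :: "real \<Rightarrow> 'a::euclidean_space set \<Rightarrow> 'a L1 set" where
  "W1p p S =
     {u \<in> L1_on S. set_integrable lborel S (\<lambda>x. \<bar>rep_L1 u x\<bar> powr p) \<and>
        (\<exists>G. has_weak_gradient S (rep_L1 u) G \<and>
             set_integrable lborel S (\<lambda>x. norm (G x) powr p))}"


section \<open>Random elements of \<open>L\<^sup>1(S)\<close>\<close>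

text \<open>
  As \<open>L1_on S\<close> carries the trace of the Borel sets of the surrounding space, measurability
  into the latter is measurability into \<open>L\<^sup>1(S)\<close>.  Random elements are kept as functions; the
  seminorm \<open>rv_norm\<close> does not see modifications on null sets.
\<close>

definition rv_L1 :: "'w measure \<Rightarrow> 'a::euclidean_space set \<Rightarrow> ('w \<Rightarrow> 'a L1) set" where
  "rv_L1 M S = {f \<in> borel_measurable M. (\<forall>\<omega>\<in>space M. f \<omega> \<in> L1_on S) \<and>
                  integrable M (\<lambda>\<omega>. norm (f \<omega>))}"

text \<open>
  For differences of elements of \<open>rv_L1 M S\<close> the integrand is measurable, because \<open>L\<^sup>1(S)\<close> is
  separable.
\<close>

definition rv_norm :: "'w measure \<Rightarrow> ('w \<Rightarrow> 'a::euclidean_space L1) \<Rightarrow> real" where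
  "rv_norm M f = (LINT \<omega>|M. norm (f \<omega>))"

definition rv_dense :: "'w measure \<Rightarrow> 'a::euclidean_space set \<Rightarrow> ('w \<Rightarrow> 'a L1) set \<Rightarrow> bool" where
  "rv_dense M S D \<longleftrightarrow> D \<subseteq> rv_L1 M S \<and>
     (\<forall>f\<in>rv_L1 M S. \<forall>\<epsilon>>0. \<exists>u\<in>D. rv_norm M (\<lambda>\<omega>. f \<omega> - u \<omega>) < \<epsilon>)"

definition rv_closure ::
    "'w measure \<Rightarrow> 'a::euclidean_space set \<Rightarrow> (('w \<Rightarrow> 'a L1) \<times> ('w \<Rightarrow> 'a L1)) set
      \<Rightarrow> (('w \<Rightarrow> 'a L1) \<times> ('w \<Rightarrow> 'a L1)) set" where
  "rv_closure M S B = {(f, f'). f \<in> rv_L1 M S \<and> f' \<in> rv_L1 M S \<and>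
     (\<forall>\<epsilon>>0. \<exists>(u, u')\<in>B. rv_norm M (\<lambda>\<omega>. f \<omega> - u \<omega>) < \<epsilon> \<and>
                         rv_norm M (\<lambda>\<omega>. f' \<omega> - u' \<omega>) < \<epsilon>)}"


section \<open>The weighted \<open>p\<close>-Laplace operator with random weight\<close>

text \<open>
  At points where the gradient vanishes, \<open>norm v powr (p - 2) *\<^sub>R v\<close> is zero, as required by
  the usual convention.
\<close>

definition plap_op :: "'w measure \<Rightarrow> real \<Rightarrow> 'a::euclidean_space set \<Rightarrow> ('w \<Rightarrow> 'a L1)
      \<Rightarrow> (('w \<Rightarrow> 'a L1) \<times> ('w \<Rightarrow> 'a L1)) set" where
  "plap_op M p S g = {(f, f'). f \<in> rv_L1 M S \<and> f' \<in> rv_L1 M S \<and>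
     (AE \<omega> in M. f \<omega> \<in> W1p p S \<inter> Linf_on S) \<and>
     (AE \<omega> in M. \<forall>\<phi> \<in> W1p p S \<inter> Linf_on S.
        (LINT x:S|lborel. rep_L1 (g \<omega>) x *
            ((norm (weak_grad S (f \<omega>) x) powr (p - 2) *\<^sub>R weak_grad S (f \<omega>) x)
               \<bullet> weak_grad S \<phi> x))
          = (LINT x:S|lborel. rep_L1 (f' \<omega>) x * rep_L1 \<phi> x))}"

definition plap_op_closure :: "'w measure \<Rightarrow> real \<Rightarrow> 'a::euclidean_space set \<Rightarrow> ('w \<Rightarrow> 'a L1)
      \<Rightarrow> (('w \<Rightarrow> 'a L1) \<times> ('w \<Rightarrow> 'a L1)) set" where
  "plap_op_closure M p S g = rv_closure M S (plap_op M p S g)"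

end

theory Submission
  imports Defs
begin

text \<open>
  For a merely measurable weight \<open>g\<close> even a smooth function \<open>f\<close> need not belong to the domain, since
  \<open>div (g |\<nabla>f|\<^sup>p\<^sup>-\<^sup>2 \<nabla>f)\<close> need not be a function.  Members of the domain therefore have to
  come from a minimisation.  For one value of the weight, a polynomial \<open>q\<close> and a small \<open>\<mu> > 0\<close>, let
  \<open>u\<close> minimise \<open>\<integral>\<^sub>S g |\<nabla>u|\<^sup>p / p + (u - q)\<^sup>2 / (2 \<mu>)\<close>.  The Euler-Lagrange equation says that \<open>u\<close> is mapped to
  \<open>(q - u) / \<mu>\<close>, and comparison with \<open>q\<close> gives \<open>\<integral>\<^sub>S (u - q)\<^sup>2 \<le> \<mu> g2 / p \<integral>\<^sub>S |\<nabla>q|\<^sup>p\<close>, a bound that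
  holds for all weights between \<open>g1\<close> and \<open>g2\<close> at once.  As the polynomials with rational coefficients
  are countable and dense in \<open>L\<^sup>1(S)\<close>, a random \<open>f\<close> is approximated in mean by one that takes finitely
  many such values, and on each of the finitely many events \<open>q\<close> is replaced by the solution for \<open>q\<close>
  and the random weight.

  Four points carry this.

  \<^item> Existence (\<open>minimiser_exists\<close>): the convexity of \<open>|\<cdot>|\<^sup>p\<close> is uniform enough
    (\<open>norm_diff_le_convexity_gap\<close>) to make a minimising sequence Cauchy in mean, together with its
    gradients.  Completeness of \<open>L\<^sup>1\<close> and Fatou's lemma then give a minimiser; weak topologies do not
    enter.

  \<^item> Measurability (\<open>euler_lagrange_continuous_in_weight\<close>): by monotonicity of the flux the solution
    depends continuously on the weight, both in \<open>L\<^sup>1\<close>.  Hence it is a random element when the weight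
    is one.

  \<^item> Boundedness (\<open>euler_lagrange_bounded\<close>): the equation is tested with \<open>F(u)\<close>, where \<open>F\<close> is
    nondecreasing and vanishes exactly on \<open>[- sup |q|, sup |q|]\<close>.  This needs the chain rule
    \<open>has_weak_gradient_chain\<close> for weak gradients.  It is proved with difference quotients, which converge
    in mean locally because translations are continuous in mean.

  \<^item> Weak gradients are unique almost everywhere (\<open>has_weak_gradient_unique\<close>), so that the equation does
    not depend on the version of the gradient.  This, and the passage from difference quotients tested
    with smooth functions to their mean, rests on \<open>L1_norm_le_of_test_functions\<close>.

  The closure of the operator has a larger domain, which is therefore dense as well.
\<close>

section \<open>Convexity of the p-th power of the norm\<close>

text \<open>The gradient of \<open>norm v powr p / p\<close>.\<close>

definition pflux :: "real \<Rightarrow> 'b::real_inner \<Rightarrow> 'b" where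
  "pflux p v = norm v powr (p - 2) *\<^sub>R v"

lemma norm_pflux:
  assumes "1 < p"
  shows "norm (pflux p v) = norm v powr (p - 1)"
proof (cases "v = 0")
  case False
  then have "norm v powr (p - 2) * norm v = norm v powr (p - 2) * norm v powr 1"
    by simp
  also have "\<dots> = norm v powr (p - 1)"
    by (subst powr_add[symmetric]) simp
  finally show ?thesis by (simp add: pflux_def)
qed (use assms in \<open>simp add: pflux_def\<close>)

lemma pflux_inner_self: "pflux p v \<bullet> v = norm v powr p"
proof (cases "v = 0")
  case False
  then have "norm v powr (p - 2) * (v \<bullet> v) = norm v powr (p - 2) * norm v powr 2"
    by (simp add: power2_norm_eq_inner[symmetric])
  also have "\<dots> = norm v powr p"
    by (subst powr_add[symmetric]) simp
  finally show ?thesis by (simp add: pflux_def)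
qed (simp add: pflux_def)

lemma pflux_zero [simp]: "pflux p 0 = 0"
  by (simp add: pflux_def)

lemma continuous_pflux:
  assumes "1 < p"
  shows "isCont (pflux p) v"
proof (cases "v = 0")
  case True
  have "((\<lambda>w::'a. norm w powr (p - 1)) \<longlongrightarrow> norm (0::'a) powr (p - 1)) (at 0)"
    using assms by (intro tendsto_powr' tendsto_intros) auto
  then have "((\<lambda>w::'a. norm (pflux p w)) \<longlongrightarrow> 0) (at 0)"
    using assms by (simp add: norm_pflux)
  then show ?thesis
    using True by (simp add: isCont_def tendsto_norm_zero_iff)
next
  case False
  then show ?thesis
    unfolding pflux_def by (intro continuous_intros) auto
qed

lemma pflux_borel_measurable [measurable]:
  assumes "1 < p"
  shows "(pflux p :: 'b::euclidean_space \<Rightarrow> 'b) \<in> borel_measurable borel"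
  by (intro borel_measurable_continuous_onI)
     (intro continuous_at_imp_continuous_on ballI continuous_pflux assms)

text \<open>Strictness is what makes the convexity gap below positive; the tangent inequality for vectors
  follows from this one by the Cauchy-Schwarz inequality.\<close>

lemma powr_above_tangent:
  fixes x y p :: real
  assumes "1 < p" "0 \<le> x" "0 \<le> y" "x \<noteq> y"
  shows "x powr p + p * x powr (p - 1) * (y - x) < y powr p"
proof -
  have cont: "continuous_on {a..b} (\<lambda>t::real. t powr p)" if "0 \<le> a" for a b
    using that assms by (intro continuous_on_powr' continuous_intros) auto
  have der: "((\<lambda>t::real. t powr p) has_real_derivative p * t powr (p - 1)) (at t)" if "0 < t" for t
    using that assms by (intro has_real_derivative_powr) auto
  have mv: "\<exists>z. a < z \<and> z < b \<and> b powr p - a powr p = (b - a) * (p * z powr (p - 1))"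
    if ab: "0 \<le> a" "a < b" for a b
  proof -
    obtain l z where z: "a < z" "z < b" "((\<lambda>t. t powr p) has_real_derivative l) (at z)"
        "b powr p - a powr p = (b - a) * l"
      using MVT[OF ab(2) cont[OF ab(1)]] der ab(1)
      by (meson order.strict_trans1 real_differentiable_def)
    have "l = p * z powr (p - 1)"
      using DERIV_unique[OF z(3) der] z(1) ab(1) by simp
    with z show ?thesis by blast
  qed
  show ?thesis
  proof (cases "x < y")
    case True
    obtain z where z: "x < z" "z < y" "y powr p - x powr p = (y - x) * (p * z powr (p - 1))"
      using mv[OF assms(2) True] by blast
    have "x powr (p - 1) < z powr (p - 1)"
      using z assms by (intro powr_less_mono2) auto
    then have "(y - x) * (p * x powr (p - 1)) < (y - x) * (p * z powr (p - 1))"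
      using True assms by simp
    then show ?thesis using z by (simp add: algebra_simps)
  next
    case False
    then have yx: "y < x" using assms by simp
    obtain z where z: "y < z" "z < x" "x powr p - y powr p = (x - y) * (p * z powr (p - 1))"
      using mv[OF assms(3) yx] by blast
    have "z powr (p - 1) < x powr (p - 1)"
      using z assms by (intro powr_less_mono2) auto
    then have "(x - y) * (p * z powr (p - 1)) < (x - y) * (p * x powr (p - 1))"
      using yx assms by simp
    then show ?thesis using z by (simp add: algebra_simps)
  qed
qed

lemma norm_powr_ge_scalar_tangent:
  fixes a b :: "'b::real_inner"
  assumes "1 < p"
  shows "norm a powr p + p * (pflux p a \<bullet> (b - a)) \<le>
         norm a powr p + p * norm a powr (p - 1) * (norm b - norm a)"
proof -
  have "pflux p a \<bullet> b \<le> norm (pflux p a) * norm b"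
    by (rule norm_cauchy_schwarz)
  moreover have "norm a powr (p - 1) * norm a = norm a powr p"
    using assms by (cases "a = 0") (auto simp: mult.commute powr_mult_base)
  ultimately have "pflux p a \<bullet> (b - a) \<le> norm a powr (p - 1) * (norm b - norm a)"
    by (simp add: inner_diff_right pflux_inner_self norm_pflux[OF assms] right_diff_distrib)
  then have "p * (pflux p a \<bullet> (b - a)) \<le> p * (norm a powr (p - 1) * (norm b - norm a))"
    using assms by (intro mult_left_mono) auto
  then show ?thesis by (simp only: mult.assoc add_left_mono)
qed

lemma pflux_tangent:
  fixes a b :: "'b::real_inner"
  assumes "1 < p"
  shows "norm a powr p + p * (pflux p a \<bullet> (b - a)) \<le> norm b powr p"
proof (cases "norm a = norm b")
  case True
  then show ?thesis
    using norm_powr_ge_scalar_tangent[OF assms, of a b] by (simp only:) simp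
next
  case False
  with powr_above_tangent[of p "norm a" "norm b"] assms
    norm_powr_ge_scalar_tangent[OF assms, of a b]
  show ?thesis by (meson le_less_trans less_imp_le norm_ge_zero)
qed

lemma pflux_tangent_strict:
  fixes a b :: "'b::real_inner"
  assumes "1 < p" "norm a \<noteq> norm b"
  shows "norm a powr p + p * (pflux p a \<bullet> (b - a)) < norm b powr p"
  using norm_powr_ge_scalar_tangent[OF assms(1), of a b]
    powr_above_tangent[of p "norm a" "norm b"] assms
  by (meson le_less_trans norm_ge_zero)

lemma pflux_monotone:
  fixes a b :: "'b::real_inner"
  assumes "1 < p"
  shows "0 \<le> (pflux p a - pflux p b) \<bullet> (a - b)"
proof -
  have "p * (pflux p a \<bullet> (b - a)) + p * (pflux p b \<bullet> (a - b)) \<le> 0"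
    using pflux_tangent[OF assms, of a b] pflux_tangent[OF assms, of b a] by simp
  then have "p * ((pflux p a - pflux p b) \<bullet> (a - b)) \<ge> 0"
    by (simp add: algebra_simps inner_diff_left inner_diff_right)
  then show ?thesis
    using assms by (simp add: zero_le_mult_iff)
qed

definition convexity_gap :: "real \<Rightarrow> 'b::real_inner \<Rightarrow> 'b \<Rightarrow> real" where
  "convexity_gap p a b =
     (norm a powr p + norm b powr p) / 2 - norm ((1/2) *\<^sub>R (a + b)) powr p"

lemma convexity_gap_nonneg:
  fixes a b :: "'b::real_inner"
  assumes "1 < p"
  shows "0 \<le> convexity_gap p a b"
proof -
  define m where "m = (1/2) *\<^sub>R (a + b)"
  have "(a - m) + (b - m) = 0"
    by (simp add: m_def algebra_simps flip: scaleR_add_left)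
  then have "pflux p m \<bullet> (a - m) + pflux p m \<bullet> (b - m) = 0"
    by (metis inner_add_right inner_zero_right)
  then have "p * (pflux p m \<bullet> (a - m)) + p * (pflux p m \<bullet> (b - m)) = 0"
    by (simp flip: distrib_left)
  then have "2 * norm m powr p \<le> norm a powr p + norm b powr p"
    using add_mono[OF pflux_tangent[OF assms, of m a] pflux_tangent[OF assms, of m b]] by argo
  then show ?thesis
    unfolding convexity_gap_def m_def[symmetric] by simp
qed

lemma convexity_gap_pos:
  fixes a b :: "'b::real_inner"
  assumes p: "1 < p" and ne: "a \<noteq> b"
  shows "0 < convexity_gap p a b"
proof -
  define m where "m = (1/2) *\<^sub>R (a + b)"
  have "(a - m) + (b - m) = 0"
    by (simp add: m_def algebra_simps flip: scaleR_add_left)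
  then have "pflux p m \<bullet> (a - m) + pflux p m \<bullet> (b - m) = 0"
    by (metis inner_add_right inner_zero_right)
  then have z: "p * (pflux p m \<bullet> (a - m)) + p * (pflux p m \<bullet> (b - m)) = 0"
    by (simp flip: distrib_left)
  have "\<not> (norm a = norm m \<and> norm b = norm m)"
  proof
    assume *: "norm a = norm m \<and> norm b = norm m"
    have "(norm (a - b))\<^sup>2 + (2 * norm m)\<^sup>2 = 2 * (norm a)\<^sup>2 + 2 * (norm b)\<^sup>2"
      by (simp add: m_def power2_norm_eq_inner inner_add_left inner_add_right inner_diff_left
          inner_diff_right power_mult_distrib inner_commute power_divide)
    with * have "norm (a - b) = 0" by (simp add: power_mult_distrib)
    with ne show False by simp
  qed
  then consider "norm m \<noteq> norm a" | "norm m \<noteq> norm b" by fastforce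
  then have "2 * norm m powr p < norm a powr p + norm b powr p"
  proof cases
    case 1
    from add_less_le_mono[OF pflux_tangent_strict[OF p this] pflux_tangent[OF p, of m b]] z
    show ?thesis by argo
  next
    case 2
    from add_le_less_mono[OF pflux_tangent[OF p, of m a] pflux_tangent_strict[OF p 2]] z
    show ?thesis by argo
  qed
  then show ?thesis
    unfolding convexity_gap_def m_def[symmetric] by simp
qed

lemma convexity_gap_scale:
  assumes "0 \<le> t"
  shows "convexity_gap p (t *\<^sub>R a) (t *\<^sub>R b) = t powr p * convexity_gap p a b"
proof -
  have "norm ((1/2) *\<^sub>R (t *\<^sub>R a + t *\<^sub>R b)) = t * norm ((1/2) *\<^sub>R (a + b))"
    using assms by (simp flip: scaleR_add_right)
  moreover have "norm (t *\<^sub>R c) powr p = t powr p * norm c powr p" for c :: 'a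
    using assms by (simp add: powr_mult)
  moreover have "(t * norm c) powr p = t powr p * norm c powr p" for c :: 'a
    using assms by (simp add: powr_mult)
  ultimately show ?thesis
    unfolding convexity_gap_def by (simp add: algebra_simps)
qed

text \<open>
  Uniform convexity in a form that integrates to convergence in mean.  By homogeneity and
  compactness the gap is at least a multiple of \<open>max (norm a) (norm b) powr p\<close> unless \<open>a\<close> and \<open>b\<close>
  are relatively close, and in the remaining cases the first summand takes over.
\<close>

lemma norm_diff_le_convexity_gap:
  fixes p \<epsilon> :: real
  assumes p: "1 < p" and e: "0 < \<epsilon>"
  shows "\<exists>C\<ge>0. \<forall>a b :: 'b::euclidean_space.
    norm (a - b) \<le> \<epsilon> * (1 + norm a powr p + norm b powr p) + C * convexity_gap p a b"
proof -
  define d where "d = \<epsilon> / 2"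
  have d: "0 < d" using e by (simp add: d_def)
  \<comment> \<open>the normalised pairs that are not relatively close\<close>
  define K where "K = {(a::'b, b::'b). max (norm a) (norm b) = 1 \<and> d \<le> norm (a - b)}"
  have "compact K"
  proof (rule compact_eq_bounded_closed[THEN iffD2], rule conjI)
    show "bounded K"
      by (rule bounded_subset[OF bounded_Times[OF bounded_cball bounded_cball], of _ 0 1 0 1])
         (auto simp: K_def)
    have "closed {z::'b\<times>'b. max (norm (fst z)) (norm (snd z)) = 1}"
      by (intro closed_Collect_eq continuous_intros)
    moreover have "closed {z::'b\<times>'b. d \<le> norm (fst z - snd z)}"
      by (intro closed_Collect_le continuous_intros)
    moreover have "K = {z. max (norm (fst z)) (norm (snd z)) = 1} \<inter> {z. d \<le> norm (fst z - snd z)}"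
      by (auto simp: K_def)
    ultimately show "closed K" by (simp add: closed_Int)
  qed
  have cont: "continuous_on K (\<lambda>z. convexity_gap p (fst z) (snd z))"
    unfolding convexity_gap_def using p
    by (intro continuous_intros continuous_on_powr') auto
  have "\<exists>c>0. \<forall>z\<in>K. c \<le> convexity_gap p (fst z) (snd z)"
  proof (cases "K = {}")
    case False
    from continuous_attains_inf[OF \<open>compact K\<close> False cont] obtain z where
      z: "z \<in> K" "\<And>y. y \<in> K \<Longrightarrow> convexity_gap p (fst z) (snd z) \<le> convexity_gap p (fst y) (snd y)"
      by auto
    have "fst z \<noteq> snd z" using z(1) d by (auto simp: K_def)
    with convexity_gap_pos[OF p] z(2) show ?thesis by blast
  qed (auto intro: exI[of _ 1])
  then obtain c where c: "0 < c" "\<And>z. z \<in> K \<Longrightarrow> c \<le> convexity_gap p (fst z) (snd z)" by auto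
  define C where "C = 2 * d powr (1 - p) / c"
  have C0: "0 \<le> C" using c by (simp add: C_def)
  have "norm (a - b) \<le> \<epsilon> * (1 + norm a powr p + norm b powr p) + C * convexity_gap p a b"
    for a b :: 'b
  proof -
    define s where "s = max (norm a) (norm b)"
    have s0: "0 \<le> s" by (simp add: s_def le_max_iff_disj)
    have ns: "norm (a - b) \<le> 2 * s"
      unfolding s_def using norm_triangle_ineq4[of a b] by linarith
    have sp: "s powr p \<le> norm a powr p + norm b powr p"
      by (auto simp: s_def max_def)
    have gap0: "0 \<le> C * convexity_gap p a b"
      by (intro mult_nonneg_nonneg C0 convexity_gap_nonneg p)
    have sbound: "s \<le> 1 + s powr p"
    proof (cases "s \<le> 1")
      case False
      then have "s powr 1 \<le> s powr p" using p by (intro powr_mono) auto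
      then show ?thesis using False by simp
    qed (simp add: add_increasing2)
    have base0: "0 \<le> norm a powr p" "0 \<le> norm b powr p" by auto
    consider "s < d" | "norm (a - b) < d * s" | "d \<le> s" "d * s \<le> norm (a - b)" by linarith
    then show ?thesis
    proof cases
      case 1
      then have "norm (a - b) \<le> \<epsilon> * 1" using ns by (simp add: d_def)
      also have "\<dots> \<le> \<epsilon> * (1 + norm a powr p + norm b powr p)"
        using e by (intro mult_left_mono) auto
      finally show ?thesis using gap0 by linarith
    next
      case 2
      have "d * s \<le> \<epsilon> * (1 + norm a powr p + norm b powr p)"
        using sbound sp s0 e by (intro mult_mono) (auto simp: d_def)
      then show ?thesis using gap0 2 by linarith
    next
      case 3
      then have spos: "0 < s" using d by linarith
      have "((1/s) *\<^sub>R a, (1/s) *\<^sub>R b) \<in> K"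
      proof -
        have "max (norm a / s) (norm b / s) = 1"
          using spos by (auto simp: s_def max_def field_simps)
        moreover have "d \<le> norm (a - b) / s"
          using 3 spos by (simp add: field_simps)
        ultimately show ?thesis
          using spos by (simp add: K_def flip: scaleR_diff_right)
      qed
      from c(2)[OF this] have "c \<le> convexity_gap p ((1/s) *\<^sub>R a) ((1/s) *\<^sub>R b)" by simp
      then have "s powr p * c \<le> s powr p * convexity_gap p ((1/s) *\<^sub>R a) ((1/s) *\<^sub>R b)"
        by (intro mult_left_mono) auto
      also have "\<dots> = convexity_gap p a b"
        using convexity_gap_scale[of s p "(1/s) *\<^sub>R a" "(1/s) *\<^sub>R b"] spos by simp
      finally have g: "s powr p * c \<le> convexity_gap p a b" .
      have "s = s powr p * s powr (1 - p)"
        using spos by (simp flip: powr_add)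
      also have "\<dots> \<le> s powr p * d powr (1 - p)"
        using 3 d p by (intro mult_left_mono powr_mono2') auto
      finally have "2 * s \<le> 2 * (s powr p * d powr (1 - p))" by simp
      also have "\<dots> = C * (s powr p * c)"
        using c by (simp add: C_def)
      also have "\<dots> \<le> C * convexity_gap p a b"
        using g C0 by (intro mult_left_mono) auto
      finally have "norm (a - b) \<le> C * convexity_gap p a b" using ns by linarith
      moreover have "0 \<le> \<epsilon> * (1 + norm a powr p + norm b powr p)" using e by simp
      ultimately show ?thesis by linarith
    qed
  qed
  with C0 show ?thesis by blast
qed

lemma norm_powr_add_le:
  assumes "0 < p"
  shows "norm (a + b) powr p \<le> 2 powr p * (norm a powr p + norm b powr p)"
proof -
  have "norm (a + b) powr p \<le> (2 * max (norm a) (norm b)) powr p"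
    using assms norm_triangle_ineq[of a b] by (intro powr_mono2) auto
  also have "\<dots> = 2 powr p * (max (norm a) (norm b)) powr p"
    by (simp add: powr_mult le_max_iff_disj)
  also have "\<dots> \<le> 2 powr p * (norm a powr p + norm b powr p)"
    by (intro mult_left_mono) (auto simp: max_def)
  finally show ?thesis .
qed

lemma norm_le_one_plus_powr:
  assumes "1 < p"
  shows "norm v \<le> 1 + norm v powr p"
proof (cases "norm v \<le> 1")
  case False
  then have "norm v powr 1 \<le> norm v powr p" using assms by (intro powr_mono) auto
  then show ?thesis using False by simp
qed (simp add: add_increasing2)

lemma powr_mult_le_powr_add:
  fixes x y :: real
  assumes "1 < p" "0 \<le> x" "0 \<le> y"
  shows "x powr (p - 1) * y \<le> x powr p + y powr p"
proof (cases "x \<le> y")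
  case True
  then have "x powr (p - 1) * y \<le> y powr (p - 1) * y"
    using assms by (intro mult_right_mono powr_mono2) auto
  also have "\<dots> = y powr p"
    using assms by (cases "y = 0") (auto simp: mult.commute powr_mult_base)
  finally show ?thesis by (simp add: add_increasing)
next
  case False
  then have "x powr (p - 1) * y \<le> x powr (p - 1) * x"
    using assms by (intro mult_left_mono) auto
  also have "\<dots> = x powr p"
    using assms by (cases "x = 0") (auto simp: mult.commute powr_mult_base)
  finally show ?thesis by (simp add: add_increasing2)
qed

text \<open>
  Young's inequality, applied to \<open>c * x powr (p - 1)\<close> and \<open>y\<close>, produces a power of \<open>c\<close>; as \<open>c\<close> is
  bounded, \<open>c\<close> itself will do.  This turns smallness of \<open>c\<close> in mean into smallness of the last summand.
\<close>

lemma weighted_Young: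
  fixes \<epsilon> b :: real
  assumes p: "1 < p" and e: "0 < \<epsilon>" and b: "0 \<le> b"
  shows "\<exists>C\<ge>0. \<forall>c x y. 0 \<le> c \<longrightarrow> c \<le> b \<longrightarrow> 0 \<le> x \<longrightarrow> 0 \<le> y \<longrightarrow>
    c * (x powr (p - 1) * y) \<le> \<epsilon> * y powr p + C * (c * x powr p)"
proof -
  \<comment> \<open>for \<open>y \<le> k * x\<close> the term with \<open>x\<close> dominates, for larger \<open>y\<close> the other one\<close>
  define r where "r = (b + 1) / \<epsilon>"
  have r: "0 < r" using b e by (simp add: r_def add_nonneg_pos)
  define k where "k = r powr (1 / (p - 1))"
  have k: "0 < k" using r by (simp add: k_def)
  have kp: "k powr (p - 1) = r" using p r by (simp add: k_def powr_powr)
  have main: "c * (x powr (p - 1) * y) \<le> \<epsilon> * y powr p + k * (c * x powr p)"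
    if "0 \<le> c" "c \<le> b" "0 \<le> x" "0 \<le> y" for c x y
  proof (cases "y \<le> k * x")
    case True
    then have "c * (x powr (p - 1) * y) \<le> c * (x powr (p - 1) * (k * x))"
      using that by (intro mult_left_mono) auto
    also have "\<dots> = k * (c * x powr p)"
      using that by (cases "x = 0") (auto simp: powr_mult_base powr_diff)
    finally show ?thesis using e by (simp add: add_increasing)
  next
    case False
    then have kx: "k * x \<le> y" and y: "0 < y"
      using that k by (auto simp: not_le intro: le_less_trans[rotated])
    have "r * x powr (p - 1) = (k * x) powr (p - 1)"
      using that k by (simp add: powr_mult kp)
    also have "\<dots> \<le> y powr (p - 1)"
      using kx that k p by (intro powr_mono2) auto
    finally have "r * x powr (p - 1) \<le> y powr (p - 1)" .
    then have "x powr (p - 1) \<le> y powr (p - 1) / r"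
      using r by (simp add: field_simps)
    then have "c * (x powr (p - 1) * y) \<le> (b + 1) * (y powr (p - 1) / r * y)"
      using that by (intro mult_mono mult_right_mono) (use r in auto)
    also have "\<dots> = \<epsilon> * (y powr (p - 1) * y)"
      using b e by (simp add: r_def field_simps)
    also have "y powr (p - 1) * y = y powr p"
      using y by (simp add: powr_mult_base mult.commute)
    finally show ?thesis using that k by (simp add: add_increasing2)
  qed
  show ?thesis
    by (rule exI[of _ k]) (use main k in auto)
qed


section \<open>Limits of integrals\<close>

text \<open>Fatou's lemma for real integrals.\<close>

lemma integral_le_of_AE_limit:
  fixes f :: "nat \<Rightarrow> 'x \<Rightarrow> real"
  assumes int: "\<And>n. integrable M (f n)" and nonneg: "\<And>n. AE x in M. 0 \<le> f n x"
    and lim: "AE x in M. (\<lambda>n. f n x) \<longlonglongrightarrow> w x" and w [measurable]: "w \<in> borel_measurable M"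
    and le: "\<forall>\<^sub>F n in sequentially. integral\<^sup>L M (f n) \<le> c"
  shows "integrable M w" "integral\<^sup>L M w \<le> c"
proof -
  have [measurable]: "f n \<in> borel_measurable M" for n using int by auto
  have "AE x in M. \<forall>n. 0 \<le> f n x"
    using nonneg by (simp add: AE_all_countable)
  with lim have w0: "AE x in M. 0 \<le> w x"
  proof eventually_elim
    case (elim x)
    then show ?case by (intro LIMSEQ_le_const[of _ "w x" 0]) auto
  qed
  have c: "0 \<le> c"
  proof -
    obtain n where "integral\<^sup>L M (f n) \<le> c"
      using eventually_happens'[OF sequentially_bot le] by auto
    then show ?thesis using integral_nonneg_AE[OF nonneg[of n]] by linarith
  qed
  have "(\<integral>\<^sup>+x. ennreal (w x) \<partial>M) = (\<integral>\<^sup>+x. liminf (\<lambda>n. ennreal (f n x)) \<partial>M)"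
  proof (rule nn_integral_cong_AE)
    show "AE x in M. ennreal (w x) = liminf (\<lambda>n. ennreal (f n x))"
      using lim
    proof eventually_elim
      case (elim x)
      then have "(\<lambda>n. ennreal (f n x)) \<longlonglongrightarrow> ennreal (w x)" by (rule tendsto_ennrealI)
      then show ?case by (simp add: lim_imp_Liminf)
    qed
  qed
  also have "\<dots> \<le> liminf (\<lambda>n. \<integral>\<^sup>+x. ennreal (f n x) \<partial>M)"
    by (rule nn_integral_liminf) auto
  also have "\<dots> \<le> ennreal c"
  proof -
    have "\<forall>\<^sub>F n in sequentially. (\<integral>\<^sup>+x. ennreal (f n x) \<partial>M) \<le> ennreal c"
      using le
    proof eventually_elim
      case (elim n)
      then show ?case
        by (subst nn_integral_eq_integral[OF int nonneg]) (simp add: ennreal_leI)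
    qed
    then have "liminf (\<lambda>n. \<integral>\<^sup>+x. ennreal (f n x) \<partial>M) \<le> liminf (\<lambda>n::nat. ennreal c)"
      by (rule Liminf_mono)
    then show ?thesis by (simp add: Liminf_const)
  qed
  finally have *: "(\<integral>\<^sup>+x. ennreal (w x) \<partial>M) \<le> ennreal c" .
  show "integrable M w"
  proof (rule integrableI_nonneg[OF w w0])
    show "(\<integral>\<^sup>+ x. ennreal (w x) \<partial>M) < \<infinity>" using * le_less_trans by fastforce
  qed
  then show "integral\<^sup>L M w \<le> c"
    using * c w0 by (simp add: nn_integral_eq_integral)
qed

lemma L1_complete:
  fixes s :: "nat \<Rightarrow> 'x \<Rightarrow> 'b::{banach, second_countable_topology}"
  assumes int: "\<And>n. integrable M (s n)"
    and cauchy: "\<And>e. e > 0 \<Longrightarrow> \<exists>N. \<forall>i\<ge>N. \<forall>j\<ge>N. (LINT x|M. norm (s i x - s j x)) < e"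
  obtains w where "integrable M w" "(\<lambda>n. LINT x|M. norm (s n x - w x)) \<longlonglongrightarrow> 0"
proof -
  note [measurable] = borel_measurable_integrable[OF int]
  obtain r :: "nat \<Rightarrow> nat" where r: "strict_mono r" "AE x in M. Cauchy (\<lambda>i. s (r i) x)"
    using cauchy_L1_AE_cauchy_subseq[of M s] int cauchy by blast
  define w where "w x = lim (\<lambda>i. s (r i) x)" for x
  have [measurable]: "w \<in> borel_measurable M"
    unfolding w_def by measurable
  have lim: "AE x in M. (\<lambda>i. s (r i) x) \<longlonglongrightarrow> w x"
    using r(2) by eventually_elim (simp add: w_def Cauchy_convergent_iff convergent_LIMSEQ_iff)
  have key: "integrable M (\<lambda>x. norm (s n x - w x)) \<and> (LINT x|M. norm (s n x - w x)) \<le> e"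
    if N: "\<forall>i\<ge>N. \<forall>j\<ge>N. (LINT x|M. norm (s i x - s j x)) < e" and n: "n \<ge> N" for N n e
  proof -
    have "AE x in M. (\<lambda>i. norm (s n x - s (r i) x)) \<longlonglongrightarrow> norm (s n x - w x)"
      using lim by eventually_elim (intro tendsto_intros)
    moreover have "\<forall>\<^sub>F i in sequentially. (LINT x|M. norm (s n x - s (r i) x)) \<le> e"
      using eventually_ge_at_top[of N]
      by eventually_elim (metis N n le_trans less_imp_le r(1) seq_suble)
    ultimately show ?thesis
      using integral_le_of_AE_limit[of M "\<lambda>i x. norm (s n x - s (r i) x)" "\<lambda>x. norm (s n x - w x)" e] int
      by auto
  qed
  have "integrable M w"
  proof -
    obtain N where N: "\<forall>i\<ge>N. \<forall>j\<ge>N. (LINT x|M. norm (s i x - s j x)) < 1"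
      using cauchy[of 1] by auto
    have "integrable M (\<lambda>x. s N x - w x)"
      using key[OF N order_refl] by (subst integrable_norm_cancel) auto
    from Bochner_Integration.integrable_diff[OF int[of N] this] show ?thesis by simp
  qed
  moreover have "(\<lambda>n. LINT x|M. norm (s n x - w x)) \<longlonglongrightarrow> 0"
  proof (rule LIMSEQ_I)
    fix e :: real assume "0 < e"
    then obtain N where N: "\<forall>i\<ge>N. \<forall>j\<ge>N. (LINT x|M. norm (s i x - s j x)) < e / 2"
      using cauchy[of "e/2"] by auto
    show "\<exists>N. \<forall>n\<ge>N. norm ((LINT x|M. norm (s n x - w x)) - 0) < e"
      using key[OF N] \<open>0 < e\<close> by (intro exI[of _ N]) fastforce
  qed
  ultimately show ?thesis by (rule that)
qed

lemma L1_tendsto_AE_subseq: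
  fixes s :: "nat \<Rightarrow> 'x \<Rightarrow> 'b::{banach, second_countable_topology}"
  assumes "\<And>n. integrable M (s n)" "integrable M w"
    and "(\<lambda>n. LINT x|M. norm (s n x - w x)) \<longlonglongrightarrow> 0"
  obtains r :: "nat \<Rightarrow> nat" where "strict_mono r" "AE x in M. (\<lambda>n. s (r n) x) \<longlonglongrightarrow> w x"
proof -
  have "\<exists>r::nat\<Rightarrow>nat. strict_mono r \<and> (AE x in M. (\<lambda>n. s (r n) x - w x) \<longlonglongrightarrow> 0)"
    using assms by (intro tendsto_L1_AE_subseq[of M "\<lambda>n x. s n x - w x"]) auto
  then show ?thesis using that by (auto simp: LIM_zero_iff)
qed

lemma integral_tail_tendsto_zero:
  fixes f :: "'x \<Rightarrow> real"
  assumes f: "integrable M f" and A: "\<And>n. A n \<in> sets M"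
    and out: "AE x in M. \<forall>\<^sub>F n in sequentially. x \<notin> A n"
  shows "(\<lambda>n. LINT x|M. indicator (A n) x * f x) \<longlonglongrightarrow> 0"
proof -
  have "(\<lambda>n. LINT x|M. indicator (A n) x * f x) \<longlonglongrightarrow> (LINT x|M. (0::real))"
  proof (rule integral_dominated_convergence[where w = "\<lambda>x. norm (f x)"])
    show "AE x in M. (\<lambda>n. indicator (A n) x * f x) \<longlonglongrightarrow> 0"
      using out
    proof eventually_elim
      case (elim x)
      then show ?case by (intro tendsto_eventually) (auto elim!: eventually_mono)
    qed
    show "AE x in M. norm (indicator (A n) x * f x) \<le> norm (f x)" for n
      by (auto simp: indicator_def)
  qed (use f A in auto)
  then show ?thesis by simp
qed


section \<open>Minimisation of the weighted p-energy\<close>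

text \<open>
  The variational problem needs nothing of Sobolev spaces but a linear space of pairs, each a
  function together with its gradient, that is closed under convergence in mean within the pairs
  of finite energy.
\<close>

locale gradient_pairs = finite_measure N
  for N :: "'x measure" +
  fixes p :: real and V :: "(('x \<Rightarrow> real) \<times> ('x \<Rightarrow> 'b::euclidean_space)) set"
  assumes p_gt_1: "1 < p"
    and V_nonempty: "V \<noteq> {}"
    and V_fun: "(u, G) \<in> V \<Longrightarrow> u \<in> borel_measurable N" "(u, G) \<in> V \<Longrightarrow> integrable N (\<lambda>x. (u x)\<^sup>2)"
    and V_grad: "(u, G) \<in> V \<Longrightarrow> G \<in> borel_measurable N"
      "(u, G) \<in> V \<Longrightarrow> integrable N (\<lambda>x. norm (G x) powr p)"
    and V_lin: "(u, G) \<in> V \<Longrightarrow> (v, H) \<in> V \<Longrightarrow>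
      (\<lambda>x. a * u x + b * v x, \<lambda>x. a *\<^sub>R G x + b *\<^sub>R H x) \<in> V"
    and V_closed: "(\<And>n. (us n, Gs n) \<in> V) \<Longrightarrow>
      u \<in> borel_measurable N \<Longrightarrow> integrable N (\<lambda>x. (u x)\<^sup>2) \<Longrightarrow>
      G \<in> borel_measurable N \<Longrightarrow> integrable N (\<lambda>x. norm (G x) powr p) \<Longrightarrow>
      (\<lambda>n. LINT x|N. \<bar>us n x - u x\<bar>) \<longlonglongrightarrow> 0 \<Longrightarrow>
      (\<lambda>n. LINT x|N. norm (Gs n x - G x)) \<longlonglongrightarrow> 0 \<Longrightarrow> (u, G) \<in> V"
begin

lemma integrable_of_square:
  fixes u :: "'x \<Rightarrow> real"
  assumes "u \<in> borel_measurable N" "integrable N (\<lambda>x. (u x)\<^sup>2)"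
  shows "integrable N u"
proof (rule Bochner_Integration.integrable_bound)
  show "integrable N (\<lambda>x. 1 + (u x)\<^sup>2)" using assms by auto
  have "\<bar>t\<bar> \<le> 1 + t\<^sup>2" for t :: real
    using norm_le_one_plus_powr[of 2 t] by simp
  then show "AE x in N. norm (u x) \<le> norm (1 + (u x)\<^sup>2)"
    by (simp add: add_nonneg_nonneg)
qed (use assms in auto)

lemma integrable_product_of_squares:
  fixes u v :: "'x \<Rightarrow> real"
  assumes "u \<in> borel_measurable N" "integrable N (\<lambda>x. (u x)\<^sup>2)"
    and "v \<in> borel_measurable N" "integrable N (\<lambda>x. (v x)\<^sup>2)"
  shows "integrable N (\<lambda>x. u x * v x)"
proof (rule Bochner_Integration.integrable_bound)
  show "integrable N (\<lambda>x. (u x)\<^sup>2 + (v x)\<^sup>2)" using assms by auto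
  have "\<bar>s * t\<bar> \<le> s\<^sup>2 + t\<^sup>2" for s t :: real
  proof -
    have "2 * (\<bar>s\<bar> * \<bar>t\<bar>) \<le> s\<^sup>2 + t\<^sup>2" "0 \<le> \<bar>s\<bar> * \<bar>t\<bar>"
      using sum_squares_bound[of "\<bar>s\<bar>" "\<bar>t\<bar>"] by auto
    then show ?thesis unfolding abs_mult by linarith
  qed
  then show "AE x in N. norm (u x * v x) \<le> norm ((u x)\<^sup>2 + (v x)\<^sup>2)"
    by (simp add: add_nonneg_nonneg)
qed (use assms in auto)

lemma integrable_square_diff:
  fixes u v :: "'x \<Rightarrow> real"
  assumes "u \<in> borel_measurable N" "integrable N (\<lambda>x. (u x)\<^sup>2)"
    and "v \<in> borel_measurable N" "integrable N (\<lambda>x. (v x)\<^sup>2)"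
  shows "integrable N (\<lambda>x. (u x - v x)\<^sup>2)"
proof -
  have "integrable N (\<lambda>x. (u x)\<^sup>2 + (v x)\<^sup>2 - 2 * (u x * v x))"
    using integrable_product_of_squares[OF assms] assms by auto
  then show ?thesis by (simp add: power2_diff mult.assoc)
qed

lemma integrable_of_powr:
  fixes G :: "'x \<Rightarrow> 'b"
  assumes "G \<in> borel_measurable N" "integrable N (\<lambda>x. norm (G x) powr p)"
  shows "integrable N G"
proof (rule Bochner_Integration.integrable_bound)
  show "integrable N (\<lambda>x. 1 + norm (G x) powr p)" using assms by auto
  show "AE x in N. norm (G x) \<le> norm (1 + norm (G x) powr p)"
    using norm_le_one_plus_powr[OF p_gt_1] by auto
qed (use assms in auto)

lemma integrable_weighted_powr:
  fixes G :: "'x \<Rightarrow> 'b"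
  assumes [measurable]: "g \<in> borel_measurable N" "G \<in> borel_measurable N"
    and "AE x in N. \<bar>g x\<bar> \<le> b" "integrable N (\<lambda>x. norm (G x) powr p)"
  shows "integrable N (\<lambda>x. g x * norm (G x) powr p)"
proof (rule Bochner_Integration.integrable_bound)
  show "integrable N (\<lambda>x. b * norm (G x) powr p)" using assms by auto
  show "AE x in N. norm (g x * norm (G x) powr p) \<le> norm (b * norm (G x) powr p)"
    using assms(3) by eventually_elim (auto simp: abs_mult intro!: mult_right_mono)
qed measurable

lemma integrable_weighted_cross:
  fixes G H :: "'x \<Rightarrow> 'b"
  assumes [measurable]: "g \<in> borel_measurable N" "G \<in> borel_measurable N" "H \<in> borel_measurable N"
    and "AE x in N. \<bar>g x\<bar> \<le> b"
    and "integrable N (\<lambda>x. norm (G x) powr p)" "integrable N (\<lambda>x. norm (H x) powr p)"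
  shows "integrable N (\<lambda>x. g x * (norm (G x) powr (p - 1) * norm (H x)))"
proof (rule Bochner_Integration.integrable_bound)
  show "integrable N (\<lambda>x. b * (norm (G x) powr p + norm (H x) powr p))" using assms by auto
  show "AE x in N. norm (g x * (norm (G x) powr (p - 1) * norm (H x)))
      \<le> norm (b * (norm (G x) powr p + norm (H x) powr p))"
    using assms(4)
  proof eventually_elim
    case (elim x)
    have "\<bar>g x\<bar> * (norm (G x) powr (p - 1) * norm (H x)) \<le> b * (norm (G x) powr p + norm (H x) powr p)"
      using elim powr_mult_le_powr_add[OF p_gt_1, of "norm (G x)" "norm (H x)"]
      by (intro mult_mono) auto
    then show ?case using elim by (simp add: abs_mult add_nonneg_nonneg)
  qed
qed measurable

lemma abs_pflux_inner_le: "\<bar>pflux p v \<bullet> w\<bar> \<le> norm v powr (p - 1) * norm w"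
  using Cauchy_Schwarz_ineq2[of "pflux p v" w] by (simp add: norm_pflux[OF p_gt_1])

lemma integrable_flux:
  fixes G H :: "'x \<Rightarrow> 'b"
  assumes [measurable]: "g \<in> borel_measurable N" "G \<in> borel_measurable N" "H \<in> borel_measurable N"
    and b: "AE x in N. \<bar>g x\<bar> \<le> b"
    and "integrable N (\<lambda>x. norm (G x) powr p)" "integrable N (\<lambda>x. norm (H x) powr p)"
  shows "integrable N (\<lambda>x. g x * (pflux p (G x) \<bullet> H x))"
proof (rule Bochner_Integration.integrable_bound[OF integrable_weighted_cross[OF assms]])
  note [measurable] = pflux_borel_measurable[OF p_gt_1]
  show "(\<lambda>x. g x * (pflux p (G x) \<bullet> H x)) \<in> borel_measurable N" by measurable
  show "AE x in N. norm (g x * (pflux p (G x) \<bullet> H x))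
      \<le> norm (g x * (norm (G x) powr (p - 1) * norm (H x)))"
    by (intro AE_I2) (simp add: abs_mult mult_left_mono abs_pflux_inner_le)
qed

text \<open>The Euler-Lagrange equation of
  \<open>\<integral> g * norm G powr p / p + (u - h)\<^sup>2 / (2 * \<mu>)\<close> over \<open>V\<close>.\<close>

definition euler_lagrange ::
    "real \<Rightarrow> ('x \<Rightarrow> real) \<Rightarrow> ('x \<Rightarrow> real) \<Rightarrow> ('x \<Rightarrow> real) \<Rightarrow> ('x \<Rightarrow> 'b) \<Rightarrow> bool" where
  "euler_lagrange \<mu> h g u G \<longleftrightarrow> (u, G) \<in> V \<and>
     (\<forall>(\<phi>, H) \<in> V. (LINT x|N. g x * (pflux p (G x) \<bullet> H x)) = (LINT x|N. (h x - u x) / \<mu> * \<phi> x))"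

text \<open>
  Convexity of the energy replaces differentiation under the integral sign: the difference
  quotient in the direction \<open>(\<phi>, H)\<close> is at most the flux at \<open>G + t H\<close> tested with \<open>H\<close>, and this
  tends to the flux at \<open>G\<close> by dominated convergence.
\<close>

lemma minimiser_imp_euler_lagrange:
  fixes g h u :: "'x \<Rightarrow> real" and G :: "'x \<Rightarrow> 'b"
  assumes [measurable]: "g \<in> borel_measurable N" "h \<in> borel_measurable N"
    and h2: "integrable N (\<lambda>x. (h x)\<^sup>2)"
    and mu: "0 < \<mu>"
    and g: "AE x in N. 0 \<le> g x \<and> g x \<le> g2"
    and uG: "(u, G) \<in> V"
    and min: "\<And>v H. (v, H) \<in> V \<Longrightarrow>
      (LINT x|N. g x * norm (G x) powr p / p + (u x - h x)\<^sup>2 / (2 * \<mu>))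
      \<le> (LINT x|N. g x * norm (H x) powr p / p + (v x - h x)\<^sup>2 / (2 * \<mu>))"
  shows "euler_lagrange \<mu> h g u G"
proof -
  note [measurable] = pflux_borel_measurable[OF p_gt_1]
  note [measurable] = V_fun(1)[OF uG] V_grad(1)[OF uG]
  have p0: "0 < p" using p_gt_1 by simp
  have gb: "AE x in N. \<bar>g x\<bar> \<le> g2" using g by eventually_elim auto
  have int_sq: "integrable N (\<lambda>x. (v x - h x)\<^sup>2)" if "(v, H) \<in> V" for v H
    using integrable_square_diff[OF V_fun[OF that] _ h2] by simp
  have int_pow: "integrable N (\<lambda>x. g x * norm (H x) powr p)" if "(v, H) \<in> V" for v H
    using integrable_weighted_powr[OF _ V_grad(1)[OF that] gb V_grad(2)[OF that]] by simp
  have half: "0 \<le> (LINT x|N. g x * (pflux p (G x) \<bullet> H x)) - (LINT x|N. (h x - u x) / \<mu> * \<phi> x)"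
    if V: "(\<phi>, H) \<in> V" for \<phi> H
  proof -
    note [measurable] = V_fun(1)[OF V] V_grad(1)[OF V]
    define t where "t n = 1 / real (Suc n)" for n
    have t: "0 < t n" "t n \<le> 1" for n by (auto simp: t_def)
    have t0: "t \<longlonglongrightarrow> 0" unfolding t_def by (rule LIMSEQ_inverse_real_of_nat[unfolded inverse_eq_divide])
    have Vt: "(\<lambda>x. u x + t n * \<phi> x, \<lambda>x. G x + t n *\<^sub>R H x) \<in> V" for n
      using V_lin[OF uG V, of 1 "t n"] by simp
    have prod: "integrable N (\<lambda>x. (u x - h x) * \<phi> x)"
      using integrable_product_of_squares[OF _ int_sq[OF uG] _ V_fun(2)[OF V]] by simp
    have intflux: "integrable N (\<lambda>x. g x * (pflux p (G x + t n *\<^sub>R H x) \<bullet> H x))" for n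
      by (rule integrable_flux[OF _ _ _ gb V_grad(2)[OF Vt] V_grad(2)[OF V]]) measurable
    have "0 \<le> (LINT x|N. g x * (pflux p (G x + t n *\<^sub>R H x) \<bullet> H x))
        + (LINT x|N. (u x - h x) * \<phi> x) / \<mu> + t n * (LINT x|N. (\<phi> x)\<^sup>2) / (2 * \<mu>)" for n
    proof -
      let ?F = "\<lambda>x. g x * (pflux p (G x + t n *\<^sub>R H x) \<bullet> H x)"
      let ?R = "\<lambda>x. t n * ?F x + t n * ((u x - h x) * \<phi> x) / \<mu> + (t n)\<^sup>2 * (\<phi> x)\<^sup>2 / (2 * \<mu>)"
      let ?e = "\<lambda>x. g x * norm (G x) powr p / p + (u x - h x)\<^sup>2 / (2 * \<mu>)"
      let ?et = "\<lambda>x. g x * norm (G x + t n *\<^sub>R H x) powr p / p + (u x + t n * \<phi> x - h x)\<^sup>2 / (2 * \<mu>)"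
      have intR: "integrable N ?R"
        by (intro Bochner_Integration.integrable_add integrable_divide integrable_mult_right
            intflux prod V_fun(2)[OF V])
      have inte: "integrable N ?e"
        by (intro Bochner_Integration.integrable_add integrable_divide_zero impI int_sq[OF uG] int_pow[OF uG])
      have "(LINT x|N. ?e x) \<le> (LINT x|N. ?et x)"
        by (rule min[OF Vt])
      also have "\<dots> \<le> (LINT x|N. ?e x + ?R x)"
      proof (rule integral_mono_AE)
        show "integrable N ?et"
          by (intro Bochner_Integration.integrable_add integrable_divide_zero impI int_sq[OF Vt] int_pow[OF Vt])
        show "integrable N (\<lambda>x. ?e x + ?R x)"
          by (intro Bochner_Integration.integrable_add[OF inte intR])
        show "AE x in N. ?et x \<le> ?e x + ?R x"
          using g
        proof eventually_elim
          case (elim x)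
          have "norm (G x + t n *\<^sub>R H x) powr p \<le> norm (G x) powr p + p * (t n * (pflux p (G x + t n *\<^sub>R H x) \<bullet> H x))"
            using pflux_tangent[OF p_gt_1, of "G x + t n *\<^sub>R H x" "G x"] by simp
          then have "g x * norm (G x + t n *\<^sub>R H x) powr p
              \<le> g x * (norm (G x) powr p + p * (t n * (pflux p (G x + t n *\<^sub>R H x) \<bullet> H x)))"
            using elim by (intro mult_left_mono) auto
          then have "g x * norm (G x + t n *\<^sub>R H x) powr p / p
              \<le> g x * (norm (G x) powr p + p * (t n * (pflux p (G x + t n *\<^sub>R H x) \<bullet> H x))) / p"
            using p0 by (intro divide_right_mono) auto
          also have "\<dots> = g x * norm (G x) powr p / p + t n * ?F x"
            using p0 by (simp add: field_simps)
          finally have 1: "g x * norm (G x + t n *\<^sub>R H x) powr p / p \<le> g x * norm (G x) powr p / p + t n * ?F x" .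
          have 2: "(u x + t n * \<phi> x - h x)\<^sup>2 / (2 * \<mu>) = (u x - h x)\<^sup>2 / (2 * \<mu>)
              + t n * ((u x - h x) * \<phi> x) / \<mu> + (t n)\<^sup>2 * (\<phi> x)\<^sup>2 / (2 * \<mu>)"
            using mu by (simp add: power2_eq_square field_simps)
          show ?case using 1 2 by linarith
        qed
      qed
      also have "\<dots> = (LINT x|N. ?e x) + (LINT x|N. ?R x)"
        by (rule Bochner_Integration.integral_add[OF inte intR])
      finally have "0 \<le> (LINT x|N. ?R x)" by simp
      also have "(LINT x|N. ?R x) = t n * (LINT x|N. ?F x) + t n * (LINT x|N. (u x - h x) * \<phi> x) / \<mu>
           + (t n)\<^sup>2 * (LINT x|N. (\<phi> x)\<^sup>2) / (2 * \<mu>)"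
        using intflux[of n] prod V_fun(2)[OF V] by simp
      also have "\<dots> = t n * ((LINT x|N. ?F x)
        + (LINT x|N. (u x - h x) * \<phi> x) / \<mu> + t n * (LINT x|N. (\<phi> x)\<^sup>2) / (2 * \<mu>))"
        by (simp add: power2_eq_square algebra_simps)
      finally show ?thesis using t[of n] by (simp add: zero_le_mult_iff)
    qed
    moreover have "(\<lambda>n. (LINT x|N. g x * (pflux p (G x + t n *\<^sub>R H x) \<bullet> H x))
        + (LINT x|N. (u x - h x) * \<phi> x) / \<mu> + t n * (LINT x|N. (\<phi> x)\<^sup>2) / (2 * \<mu>))
        \<longlonglongrightarrow> (LINT x|N. g x * (pflux p (G x) \<bullet> H x)) + (LINT x|N. (u x - h x) * \<phi> x) / \<mu>
            + 0 * (LINT x|N. (\<phi> x)\<^sup>2) / (2 * \<mu>)"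
    proof (intro tendsto_intros t0 order_less_imp_not_eq2)
      let ?w = "\<lambda>x. g2 * (2 powr p * (norm (G x) powr p + norm (H x) powr p) + norm (H x) powr p)"
      show "(\<lambda>n. LINT x|N. g x * (pflux p (G x + t n *\<^sub>R H x) \<bullet> H x))
          \<longlonglongrightarrow> (LINT x|N. g x * (pflux p (G x) \<bullet> H x))"
      proof (rule integral_dominated_convergence[where w = ?w])
        show "integrable N ?w" using V_grad(2)[OF uG] V_grad(2)[OF V] by auto
        show "AE x in N. (\<lambda>n. g x * (pflux p (G x + t n *\<^sub>R H x) \<bullet> H x)) \<longlonglongrightarrow> g x * (pflux p (G x) \<bullet> H x)"
        proof (rule AE_I2)
          fix x
          have "(\<lambda>n. G x + t n *\<^sub>R H x) \<longlonglongrightarrow> G x + 0 *\<^sub>R H x" by (intro tendsto_intros t0)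
          then have "(\<lambda>n. pflux p (G x + t n *\<^sub>R H x)) \<longlonglongrightarrow> pflux p (G x)"
            using isCont_tendsto_compose[OF continuous_pflux[OF p_gt_1, of "G x"]] by simp
          then show "(\<lambda>n. g x * (pflux p (G x + t n *\<^sub>R H x) \<bullet> H x)) \<longlonglongrightarrow> g x * (pflux p (G x) \<bullet> H x)"
            by (intro tendsto_intros)
        qed
        show "AE x in N. norm (g x * (pflux p (G x + t n *\<^sub>R H x) \<bullet> H x)) \<le> ?w x" for n
          using g
        proof eventually_elim
          case (elim x)
          have "norm (t n *\<^sub>R H x) powr p \<le> norm (H x) powr p"
            using t[of n] p0 by (intro powr_mono2) (auto simp: mult_left_le_one_le)
          then have "2 powr p * (norm (G x) powr p + norm (t n *\<^sub>R H x) powr p)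
              \<le> 2 powr p * (norm (G x) powr p + norm (H x) powr p)"
            by (intro mult_left_mono add_left_mono) auto
          then have "\<bar>pflux p (G x + t n *\<^sub>R H x) \<bullet> H x\<bar>
              \<le> 2 powr p * (norm (G x) powr p + norm (H x) powr p) + norm (H x) powr p"
            using abs_pflux_inner_le[of "G x + t n *\<^sub>R H x" "H x"]
              powr_mult_le_powr_add[OF p_gt_1 norm_ge_zero norm_ge_zero, of "G x + t n *\<^sub>R H x" "H x"]
              norm_powr_add_le[OF p0, of "G x" "t n *\<^sub>R H x"] by linarith
          then show ?case using elim by (auto simp: abs_mult intro!: mult_mono)
        qed
      qed measurable
    qed (use mu in auto)
    ultimately have "0 \<le> (LINT x|N. g x * (pflux p (G x) \<bullet> H x)) + (LINT x|N. (u x - h x) * \<phi> x) / \<mu>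
            + 0 * (LINT x|N. (\<phi> x)\<^sup>2) / (2 * \<mu>)"
      by (intro LIMSEQ_le_const) auto
    moreover have "(LINT x|N. (h x - u x) / \<mu> * \<phi> x) = - ((LINT x|N. (u x - h x) * \<phi> x) / \<mu>)"
    proof -
      have "(LINT x|N. (h x - u x) / \<mu> * \<phi> x) = (LINT x|N. - (((u x - h x) * \<phi> x) / \<mu>))"
        by (intro Bochner_Integration.integral_cong refl) (use mu in \<open>auto simp: field_simps\<close>)
      then show ?thesis by simp
    qed
    ultimately show ?thesis by simp
  qed
  show ?thesis
    unfolding euler_lagrange_def
  proof (intro conjI uG ballI, clarify)
    fix \<phi> H assume V: "(\<phi>, H) \<in> V"
    have V': "(\<lambda>x. - \<phi> x, \<lambda>x. - H x) \<in> V"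
      using V_lin[OF V V, of "-1" 0] by simp
    from half[OF V] half[OF V']
    show "(LINT x|N. g x * (pflux p (G x) \<bullet> H x)) = (LINT x|N. (h x - u x) / \<mu> * \<phi> x)"
      by simp
  qed
qed


lemma integral_abs_le_square:
  fixes w :: "'x \<Rightarrow> real"
  assumes [measurable]: "w \<in> borel_measurable N" and w2: "integrable N (\<lambda>x. (w x)\<^sup>2)" and d: "0 < \<delta>"
  shows "(LINT x|N. \<bar>w x\<bar>) \<le> \<delta> * measure N (space N) + (LINT x|N. (w x)\<^sup>2) / \<delta>"
proof -
  have "(LINT x|N. \<bar>w x\<bar>) \<le> (LINT x|N. \<delta> + (w x)\<^sup>2 / \<delta>)"
  proof (rule integral_mono)
    fix x
    have "2 * (\<bar>w x\<bar> * \<delta>) \<le> (w x)\<^sup>2 + \<delta>\<^sup>2" "0 \<le> \<bar>w x\<bar> * \<delta>"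
      using sum_squares_bound[of "\<bar>w x\<bar>" \<delta>] d by auto
    then have "\<bar>w x\<bar> * \<delta> \<le> \<delta> * \<delta> + (w x)\<^sup>2" unfolding power2_eq_square[of \<delta>] by argo
    then show "\<bar>w x\<bar> \<le> \<delta> + (w x)\<^sup>2 / \<delta>"
      using d by (simp add: field_simps)
  qed (use w2 integrable_of_square[of w] in auto)
  then show ?thesis using w2 by (simp add: mult.commute)
qed

text \<open>
  A minimising sequence is Cauchy in mean: the excess energy of two members over that of their
  midpoint controls the convexity gap of the gradients and the square of the difference of the
  functions.  This takes the place of weak compactness.
\<close>

lemma minimiser_exists:
  fixes g h :: "'x \<Rightarrow> real"
  assumes [measurable]: "g \<in> borel_measurable N" "h \<in> borel_measurable N"
    and h2: "integrable N (\<lambda>x. (h x)\<^sup>2)"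
    and mu: "0 < \<mu>"
    and g1: "0 < g1" and g: "AE x in N. g1 \<le> g x \<and> g x \<le> g2"
  obtains u G where "(u, G) \<in> V"
    and "\<And>v H. (v, H) \<in> V \<Longrightarrow>
      (LINT x|N. g x * norm (G x) powr p / p + (u x - h x)\<^sup>2 / (2 * \<mu>))
      \<le> (LINT x|N. g x * norm (H x) powr p / p + (v x - h x)\<^sup>2 / (2 * \<mu>))"
proof -
  have p0: "0 < p" using p_gt_1 by simp
  have gb: "AE x in N. \<bar>g x\<bar> \<le> g2" using g by eventually_elim (use g1 in auto)
  define e where "e v H x = g x * norm (H x) powr p / p + (v x - h x)\<^sup>2 / (2 * \<mu>)"
    for v :: "'x \<Rightarrow> real" and H :: "'x \<Rightarrow> 'b" and x
  have e_lower: "AE x in N. g1 / p * norm (H x) powr p + (v x - h x)\<^sup>2 / (2 * \<mu>) \<le> e v H x"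
    for v :: "'x \<Rightarrow> real" and H :: "'x \<Rightarrow> 'b"
    using g
  proof eventually_elim
    case (elim x)
    then have "g1 * norm (H x) powr p / p \<le> g x * norm (H x) powr p / p"
      using p0 by (intro divide_right_mono mult_right_mono) auto
    then show ?case by (simp add: e_def)
  qed
  have e_nonneg: "AE x in N. 0 \<le> e v H x" for v H
    using e_lower[of H v]
  proof eventually_elim
    case (elim x)
    moreover have "0 \<le> g1 / p * norm (H x) powr p + (v x - h x)\<^sup>2 / (2 * \<mu>)"
      using g1 p0 mu by (intro add_nonneg_nonneg) auto
    ultimately show ?case by linarith
  qed
  have int_e: "integrable N (e v H)" if V: "(v, H) \<in> V" for v H
    unfolding e_def using integrable_square_diff[OF V_fun[OF V] _ h2]
      integrable_weighted_powr[OF _ V_grad(1)[OF V] gb V_grad(2)[OF V]] by auto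
  define J where "J z = integral\<^sup>L N (e (fst z) (snd z))" for z
  define m where "m = Inf (J ` V)"
  have bdd: "bdd_below (J ` V)"
    by (intro bdd_belowI2[of _ 0]) (auto simp: J_def intro!: integral_nonneg_AE e_nonneg)
  have m_le: "m \<le> J z" if "z \<in> V" for z
    unfolding m_def using that bdd by (intro cInf_lower) auto
  have "\<exists>z\<in>V. J z < m + 1 / Suc n" for n
  proof -
    have "Inf (J ` V) < m + 1 / Suc n" by (simp add: m_def)
    from cInf_lessD[OF _ this] V_nonempty show ?thesis by auto
  qed
  then obtain z where z: "\<And>n. z n \<in> V" "\<And>n. J (z n) < m + 1 / Suc n" by metis
  define us where "us n = fst (z n)" for n
  define Gs where "Gs n = snd (z n)" for n
  have Vn: "(us n, Gs n) \<in> V" for n using z(1) by (simp add: us_def Gs_def)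
  note [measurable] = V_fun(1)[OF Vn] V_grad(1)[OF Vn]
  have Jn: "integral\<^sup>L N (e (us n) (Gs n)) < m + 1 / Suc n" for n
    using z(2)[of n] by (simp add: J_def us_def Gs_def)
  define \<eta> where "\<eta> k l = (1 / Suc k + 1 / Suc l) / 2" for k l
  have \<eta>_small: "\<exists>n. \<forall>k\<ge>n. \<forall>l\<ge>n. \<eta> k l < t" if t: "0 < t" for t
  proof -
    obtain n where n: "inverse (real (Suc n)) < t" using reals_Archimedean[OF t] by auto
    have "\<eta> k l < t" if "k \<ge> n" "l \<ge> n" for k l
    proof -
      have "1 / real (Suc k) \<le> inverse (real (Suc n))" "1 / real (Suc l) \<le> inverse (real (Suc n))"
        using that by (auto simp: inverse_eq_divide intro!: divide_left_mono)
      then show ?thesis using n by (simp add: \<eta>_def)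
    qed
    then show ?thesis by blast
  qed
  \<comment> \<open>the excess of two members over their midpoint\<close>
  define D where "D k l x = g x * convexity_gap p (Gs k x) (Gs l x) / p + (us k x - us l x)\<^sup>2 / (8 * \<mu>)"
    for k l x
  have D: "integrable N (D k l)" "integral\<^sup>L N (D k l) \<le> \<eta> k l" for k l
  proof -
    let ?u = "\<lambda>x. 1/2 * us k x + 1/2 * us l x" and ?G = "\<lambda>x. (1/2) *\<^sub>R Gs k x + (1/2) *\<^sub>R Gs l x"
    have mid: "(?u, ?G) \<in> V" by (rule V_lin[OF Vn Vn])
    have D_eq: "D k l = (\<lambda>x. (e (us k) (Gs k) x + e (us l) (Gs l) x) / 2 - e ?u ?G x)"
    proof
      fix x
      have sq: "(us k x - us l x)\<^sup>2 / (8 * \<mu>)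
         = ((us k x - h x)\<^sup>2 / (2 * \<mu>) + (us l x - h x)\<^sup>2 / (2 * \<mu>)) / 2
           - (1/2 * us k x + 1/2 * us l x - h x)\<^sup>2 / (2 * \<mu>)"
        using mu by (simp add: power2_eq_square field_simps)
      show "D k l x = (e (us k) (Gs k) x + e (us l) (Gs l) x) / 2 - e ?u ?G x"
        unfolding D_def e_def sq convexity_gap_def scaleR_add_right
        using p0 by (simp add: field_simps)
    qed
    show "integrable N (D k l)"
      unfolding D_eq using int_e[OF Vn[of k]] int_e[OF Vn[of l]] int_e[OF mid] by auto
    have "integral\<^sup>L N (D k l) = (integral\<^sup>L N (e (us k) (Gs k)) + integral\<^sup>L N (e (us l) (Gs l))) / 2
        - integral\<^sup>L N (e ?u ?G)"
      unfolding D_eq using int_e[OF Vn[of k]] int_e[OF Vn[of l]] int_e[OF mid] by simp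
    also have "\<dots> \<le> \<eta> k l"
      using Jn[of k] Jn[of l] m_le[OF mid] unfolding J_def \<eta>_def fst_conv snd_conv by argo
    finally show "integral\<^sup>L N (D k l) \<le> \<eta> k l" .
  qed
  have D_lower: "AE x in N. g1 / p * convexity_gap p (Gs k x) (Gs l x) + (us k x - us l x)\<^sup>2 / (8 * \<mu>) \<le> D k l x"
    for k l
    using g
  proof eventually_elim
    case (elim x)
    then have "g1 * convexity_gap p (Gs k x) (Gs l x) / p \<le> g x * convexity_gap p (Gs k x) (Gs l x) / p"
      using p0 convexity_gap_nonneg[OF p_gt_1] by (intro divide_right_mono mult_right_mono) auto
    then show ?case by (simp add: D_def)
  qed
  have gap_meas [measurable]: "(\<lambda>x. convexity_gap p (Gs k x) (Gs l x)) \<in> borel_measurable N" for k l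
    unfolding convexity_gap_def by measurable
  have sq_le: "AE x in N. (us k x - us l x)\<^sup>2 \<le> 8 * \<mu> * D k l x" for k l
    using D_lower[of k l]
  proof eventually_elim
    case (elim x)
    have "0 \<le> g1 / p * convexity_gap p (Gs k x) (Gs l x)"
      using g1 p0 convexity_gap_nonneg[OF p_gt_1] by (intro mult_nonneg_nonneg) auto
    then have "(us k x - us l x)\<^sup>2 / (8 * \<mu>) \<le> D k l x" using elim by linarith
    then show ?case using mu by (simp add: field_simps)
  qed
  have gap_le: "AE x in N. convexity_gap p (Gs k x) (Gs l x) \<le> p / g1 * D k l x" for k l
    using D_lower[of k l]
  proof eventually_elim
    case (elim x)
    have "0 \<le> (us k x - us l x)\<^sup>2 / (8 * \<mu>)" using mu by simp
    then have "g1 / p * convexity_gap p (Gs k x) (Gs l x) \<le> D k l x" using elim by linarith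
    then show ?case using g1 p0 by (simp add: field_simps)
  qed
  define A where "A = measure N (space N)"
  have A: "0 \<le> A" by (simp add: A_def)
  have int_u: "integrable N (us n)" for n by (rule integrable_of_square[OF V_fun[OF Vn]])
  have int_G: "integrable N (Gs n)" for n by (rule integrable_of_powr[OF V_grad[OF Vn]])
  obtain u where u: "integrable N u" "(\<lambda>n. LINT x|N. norm (us n x - u x)) \<longlonglongrightarrow> 0"
  proof (rule L1_complete[of N us, OF int_u])
    fix t :: real assume t: "0 < t"
    define \<delta> where "\<delta> = t / (2 * (A + 1))"
    have \<delta>: "0 < \<delta>" using t A by (simp add: \<delta>_def)
    have \<delta>A: "\<delta> * A < t / 2"
    proof -
      have "t * A < t * (A + 1)" using t by simp
      then show ?thesis using A by (simp add: \<delta>_def field_simps)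
    qed
    obtain n where n: "\<And>k l. k \<ge> n \<Longrightarrow> l \<ge> n \<Longrightarrow> \<eta> k l < t / 2 * \<delta> / (8 * \<mu>)"
      using \<eta>_small[of "t / 2 * \<delta> / (8 * \<mu>)"] t \<delta> mu by auto
    have "(LINT x|N. norm (us k x - us l x)) < t" if "k \<ge> n" "l \<ge> n" for k l
    proof -
      have sq: "integrable N (\<lambda>x. (us k x - us l x)\<^sup>2)"
        by (rule integrable_square_diff[OF V_fun[OF Vn] V_fun[OF Vn]])
      have "(LINT x|N. norm (us k x - us l x)) \<le> \<delta> * A + (LINT x|N. (us k x - us l x)\<^sup>2) / \<delta>"
        unfolding A_def real_norm_def by (rule integral_abs_le_square[OF _ sq \<delta>]) measurable
      also have "(LINT x|N. (us k x - us l x)\<^sup>2) \<le> (LINT x|N. 8 * \<mu> * D k l x)"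
        by (rule integral_mono_AE[OF sq _ sq_le]) (use D(1) in auto)
      also have "(LINT x|N. 8 * \<mu> * D k l x) = 8 * \<mu> * integral\<^sup>L N (D k l)"
        by simp
      finally have "(LINT x|N. norm (us k x - us l x)) \<le> \<delta> * A + 8 * \<mu> / \<delta> * integral\<^sup>L N (D k l)"
        using \<delta> by (simp add: divide_right_mono)
      also have "8 * \<mu> / \<delta> * integral\<^sup>L N (D k l) \<le> 8 * \<mu> / \<delta> * \<eta> k l"
        using D(2) mu \<delta> by (intro mult_left_mono) auto
      also have "8 * \<mu> / \<delta> * \<eta> k l < 8 * \<mu> / \<delta> * (t / 2 * \<delta> / (8 * \<mu>))"
        using n[OF that] mu \<delta> by (intro mult_strict_left_mono) auto
      also have "8 * \<mu> / \<delta> * (t / 2 * \<delta> / (8 * \<mu>)) = t / 2"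
        using mu \<delta> by simp
      finally show ?thesis using \<delta>A by linarith
    qed
    then show "\<exists>n. \<forall>k\<ge>n. \<forall>l\<ge>n. (LINT x|N. norm (us k x - us l x)) < t" by blast
  qed
  define B where "B = p / g1 * (m + 1)"
  have B: "(LINT x|N. norm (Gs n x) powr p) \<le> B" for n
  proof -
    have "(LINT x|N. norm (Gs n x) powr p) \<le> (LINT x|N. p / g1 * e (us n) (Gs n) x)"
    proof (rule integral_mono_AE)
      show "AE x in N. norm (Gs n x) powr p \<le> p / g1 * e (us n) (Gs n) x"
        using e_lower[of "Gs n" "us n"]
      proof eventually_elim
        case (elim x)
        have "0 \<le> (us n x - h x)\<^sup>2 / (2 * \<mu>)" using mu by simp
        then have "g1 / p * norm (Gs n x) powr p \<le> e (us n) (Gs n) x" using elim by linarith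
        then show ?case using g1 p0 by (simp add: field_simps)
      qed
    qed (use V_grad(2)[OF Vn] int_e[OF Vn] in auto)
    also have "\<dots> = p / g1 * integral\<^sup>L N (e (us n) (Gs n))" by simp
    also have "integral\<^sup>L N (e (us n) (Gs n)) \<le> m + 1"
    proof -
      have "1 / real (Suc n) \<le> 1" by simp
      then show ?thesis using Jn[of n] by linarith
    qed
    finally show ?thesis using p0 g1 by (simp add: B_def divide_right_mono)
  qed
  have "0 \<le> (LINT x|N. norm (Gs 0 x) powr p)" by simp
  then have B0: "0 \<le> B" using B[of 0] by linarith
  obtain G where G: "integrable N G" "(\<lambda>n. LINT x|N. norm (Gs n x - G x)) \<longlonglongrightarrow> 0"
  proof (rule L1_complete[of N Gs, OF int_G])
    fix t :: real assume t: "0 < t"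
    define \<delta> where "\<delta> = t / (2 * (A + 2 * B + 1))"
    have \<delta>: "0 < \<delta>" using t A B0 by (simp add: \<delta>_def)
    have \<delta>A: "\<delta> * (A + 2 * B) < t / 2"
    proof -
      have "t * (A + 2 * B) < t * (A + 2 * B + 1)" using t by simp
      moreover have "0 < A + 2 * B + 1" using A B0 by simp
      ultimately show ?thesis by (simp add: \<delta>_def field_simps)
    qed
    obtain C where C: "0 \<le> C" "\<And>a b :: 'b. norm (a - b)
        \<le> \<delta> * (1 + norm a powr p + norm b powr p) + C * convexity_gap p a b"
      using norm_diff_le_convexity_gap[OF p_gt_1 \<delta>] by metis
    define q where "q = (C + 1) * (p / g1)"
    have q: "0 < q" using C p0 g1 by (simp add: q_def)
    obtain n where n: "\<And>k l. k \<ge> n \<Longrightarrow> l \<ge> n \<Longrightarrow> \<eta> k l < t / 2 / q"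
      using \<eta>_small[of "t / 2 / q"] t q by auto
    have "(LINT x|N. norm (Gs k x - Gs l x)) < t" if kl: "k \<ge> n" "l \<ge> n" for k l
    proof -
      have "(LINT x|N. norm (Gs k x - Gs l x))
          \<le> (LINT x|N. \<delta> * (1 + norm (Gs k x) powr p + norm (Gs l x) powr p) + q * D k l x)"
      proof (rule integral_mono_AE)
        show "AE x in N. norm (Gs k x - Gs l x)
            \<le> \<delta> * (1 + norm (Gs k x) powr p + norm (Gs l x) powr p) + q * D k l x"
          using gap_le[of k l]
        proof eventually_elim
          case (elim x)
          have "C * convexity_gap p (Gs k x) (Gs l x) \<le> (C + 1) * (p / g1 * D k l x)"
            using elim C convexity_gap_nonneg[OF p_gt_1] by (intro mult_mono) auto
          then show ?case using C(2)[of "Gs k x" "Gs l x"] by (simp add: q_def mult.assoc)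
        qed
      qed (use int_G D(1) V_grad(2)[OF Vn] in auto)
      also have "\<dots> = \<delta> * (A + (LINT x|N. norm (Gs k x) powr p) + (LINT x|N. norm (Gs l x) powr p))
          + q * integral\<^sup>L N (D k l)"
        using D(1)[of k l] V_grad(2)[OF Vn[of k]] V_grad(2)[OF Vn[of l]] by (simp add: A_def)
      also have "\<dots> \<le> \<delta> * (A + 2 * B) + q * \<eta> k l"
      proof (rule add_mono)
        have "A + (LINT x|N. norm (Gs k x) powr p) + (LINT x|N. norm (Gs l x) powr p) \<le> A + 2 * B"
          using B[of k] B[of l] by linarith
        then show "\<delta> * (A + (LINT x|N. norm (Gs k x) powr p) + (LINT x|N. norm (Gs l x) powr p))
            \<le> \<delta> * (A + 2 * B)"
          using \<delta> by (intro mult_left_mono) auto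
        show "q * integral\<^sup>L N (D k l) \<le> q * \<eta> k l"
          using D(2)[of k l] q by (intro mult_left_mono) auto
      qed
      also have "q * \<eta> k l < q * (t / 2 / q)"
        using n[OF kl] q by (intro mult_strict_left_mono)
      also have "q * (t / 2 / q) = t / 2" using q by simp
      finally show ?thesis using \<delta>A by linarith
    qed
    then show "\<exists>n. \<forall>k\<ge>n. \<forall>l\<ge>n. (LINT x|N. norm (Gs k x - Gs l x)) < t" by blast
  qed
  have [measurable]: "u \<in> borel_measurable N" "G \<in> borel_measurable N" using u G by auto
  obtain r1 :: "nat \<Rightarrow> nat" where r1: "strict_mono r1" "AE x in N. (\<lambda>n. us (r1 n) x) \<longlonglongrightarrow> u x"
    using L1_tendsto_AE_subseq[OF int_u u] .
  have "(\<lambda>n. LINT x|N. norm (Gs (r1 n) x - G x)) \<longlonglongrightarrow> 0"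
    using LIMSEQ_subseq_LIMSEQ[OF G(2) r1(1)] by (simp add: o_def)
  then obtain r2 :: "nat \<Rightarrow> nat" where r2: "strict_mono r2" "AE x in N. (\<lambda>n. Gs (r1 (r2 n)) x) \<longlonglongrightarrow> G x"
    using L1_tendsto_AE_subseq[of N "\<lambda>n. Gs (r1 n)" G, OF int_G G(1)] by auto
  define r where "r n = r1 (r2 n)" for n
  have r: "strict_mono r" unfolding r_def using r1 r2 by (simp add: strict_mono_def)
  have lim_e: "AE x in N. (\<lambda>n. e (us (r n)) (Gs (r n)) x) \<longlonglongrightarrow> e u G x"
    using r1(2) r2(2)
  proof eventually_elim
    case (elim x)
    have "(\<lambda>n. us (r n) x) \<longlonglongrightarrow> u x"
      using LIMSEQ_subseq_LIMSEQ[OF elim(1) r2(1)] by (simp add: o_def r_def)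
    moreover have "(\<lambda>n. Gs (r n) x) \<longlonglongrightarrow> G x" using elim by (simp add: r_def)
    ultimately show ?case
      unfolding e_def using p0 mu by (intro tendsto_intros tendsto_powr') auto
  qed
  have Fatou: "integrable N (e u G) \<and> integral\<^sup>L N (e u G) \<le> m + t" if t: "0 < t" for t
  proof -
    obtain n where n: "inverse (real (Suc n)) < t" using reals_Archimedean[OF t] by auto
    have "\<forall>\<^sub>F k in sequentially. integral\<^sup>L N (e (us (r k)) (Gs (r k))) \<le> m + t"
      using eventually_ge_at_top[of n]
    proof eventually_elim
      case (elim k)
      then have "n \<le> r k" using r seq_suble le_trans by blast
      then have "1 / real (Suc (r k)) \<le> inverse (real (Suc n))"
        by (auto simp: inverse_eq_divide intro!: divide_left_mono)
      then show ?case using Jn[of "r k"] n by linarith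
    qed
    note limit = integral_le_of_AE_limit[OF int_e[OF Vn] e_nonneg lim_e _ this]
    have "e u G \<in> borel_measurable N" unfolding e_def by measurable
    then show ?thesis by (intro conjI limit)
  qed
  have int_eu: "integrable N (e u G)" using Fatou[of 1] by simp
  have le_m: "integral\<^sup>L N (e u G) \<le> m"
    by (rule field_le_epsilon) (rule Fatou[THEN conjunct2])
  have G_pow: "integrable N (\<lambda>x. norm (G x) powr p)"
  proof (rule Bochner_Integration.integrable_bound)
    show "integrable N (\<lambda>x. p / g1 * e u G x)" using int_eu by simp
    show "AE x in N. norm (norm (G x) powr p) \<le> norm (p / g1 * e u G x)"
      using e_lower[of G u]
    proof eventually_elim
      case (elim x)
      have "0 \<le> (u x - h x)\<^sup>2 / (2 * \<mu>)" using mu by simp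
      then have "g1 / p * norm (G x) powr p \<le> e u G x" using elim by linarith
      then have "norm (G x) powr p \<le> p / g1 * e u G x" using g1 p0 by (simp add: field_simps)
      then show ?case
        unfolding real_norm_def using powr_ge_zero[of "norm (G x)" p] by linarith
    qed
  qed measurable
  have u_sq: "integrable N (\<lambda>x. (u x)\<^sup>2)"
  proof (rule Bochner_Integration.integrable_bound)
    show "integrable N (\<lambda>x. 4 * \<mu> * e u G x + 2 * (h x)\<^sup>2)" using int_eu h2 by simp
    show "AE x in N. norm ((u x)\<^sup>2) \<le> norm (4 * \<mu> * e u G x + 2 * (h x)\<^sup>2)"
      using e_lower[of G u]
    proof eventually_elim
      case (elim x)
      have "0 \<le> g1 / p * norm (G x) powr p" using g1 p0 by simp
      then have "(u x - h x)\<^sup>2 / (2 * \<mu>) \<le> e u G x" using elim by linarith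
      then have "2 * (u x - h x)\<^sup>2 \<le> 4 * \<mu> * e u G x" using mu by (simp add: field_simps)
      moreover have "(u x)\<^sup>2 \<le> 2 * (u x - h x)\<^sup>2 + 2 * (h x)\<^sup>2"
        using zero_le_power2[of "u x - 2 * h x"] by (simp add: power2_eq_square algebra_simps)
      ultimately have "(u x)\<^sup>2 \<le> 4 * \<mu> * e u G x + 2 * (h x)\<^sup>2" by linarith
      then show ?case
        unfolding real_norm_def using zero_le_power2[of "u x"] by linarith
    qed
  qed measurable
  have uG: "(u, G) \<in> V"
    using u(2) G(2) by (intro V_closed[OF Vn _ u_sq _ G_pow]) auto
  show ?thesis
  proof (rule that[OF uG])
    fix v H assume "(v, H) \<in> V"
    from m_le[OF this] le_m
    show "(LINT x|N. g x * norm (G x) powr p / p + (u x - h x)\<^sup>2 / (2 * \<mu>))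
      \<le> (LINT x|N. g x * norm (H x) powr p / p + (v x - h x)\<^sup>2 / (2 * \<mu>))"
      by (simp add: J_def e_def[abs_def])
  qed
qed

theorem euler_lagrange_exists:
  assumes "g \<in> borel_measurable N" "h \<in> borel_measurable N" "integrable N (\<lambda>x. (h x)\<^sup>2)"
    and "0 < \<mu>" "0 < g1" "AE x in N. g1 \<le> g x \<and> g x \<le> g2"
  shows "\<exists>u G. euler_lagrange \<mu> h g u G"
proof -
  have "AE x in N. 0 \<le> g x \<and> g x \<le> g2"
    using assms(6) by eventually_elim (use assms(5) in auto)
  note EL = minimiser_imp_euler_lagrange[OF assms(1-4) this]
  show ?thesis
    by (rule minimiser_exists[OF assms]) (intro exI, rule EL)
qed


text \<open>Testing the equation with \<open>u - h\<close> and applying the tangent inequality at the gradient of the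
  solution bounds at once the distance to the data and the gradient.\<close>

lemma euler_lagrange_energy_bound:
  fixes g h u :: "'x \<Rightarrow> real" and G K :: "'x \<Rightarrow> 'b"
  assumes EL: "euler_lagrange \<mu> h g u G" and hK: "(h, K) \<in> V"
    and g_meas [measurable]: "g \<in> borel_measurable N" and mu: "0 < \<mu>"
    and g1: "0 < g1" and g: "AE x in N. g1 \<le> g x \<and> g x \<le> g2"
  shows "g1 / p * (LINT x|N. norm (G x) powr p) + (LINT x|N. (u x - h x)\<^sup>2) / \<mu>
     \<le> g2 / p * (LINT x|N. norm (K x) powr p)"
proof -
  have p0: "0 < p" using p_gt_1 by simp
  have gb: "AE x in N. \<bar>g x\<bar> \<le> g2" using g by eventually_elim (use g1 in auto)
  have uG: "(u, G) \<in> V" using EL by (simp add: euler_lagrange_def)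
  have diff: "(\<lambda>x. u x - h x, \<lambda>x. G x - K x) \<in> V"
    using V_lin[OF uG hK, of 1 "-1"] by simp
  note V = V_fun[OF uG] V_fun[OF hK] V_grad[OF uG] V_grad[OF hK] V_fun[OF diff] V_grad[OF diff]
  note [measurable] = V
  have flux: "integrable N (\<lambda>x. g x * (pflux p (G x) \<bullet> (G x - K x)))"
    by (rule integrable_flux[OF _ _ _ gb]) (use V in auto)
  have "(LINT x|N. g x * (pflux p (G x) \<bullet> (G x - K x)))
      = (LINT x|N. (h x - u x) / \<mu> * (u x - h x))"
    using EL diff by (force simp: euler_lagrange_def)
  also have "\<dots> = (LINT x|N. - ((u x - h x)\<^sup>2 / \<mu>))"
    by (intro Bochner_Integration.integral_cong refl)
       (use mu in \<open>simp add: field_simps power2_eq_square\<close>)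
  finally have eq: "(LINT x|N. g x * (pflux p (G x) \<bullet> (G x - K x))) = - ((LINT x|N. (u x - h x)\<^sup>2) / \<mu>)"
    by simp
  have "(LINT x|N. g1 / p * norm (G x) powr p - g2 / p * norm (K x) powr p)
      \<le> (LINT x|N. g x * (pflux p (G x) \<bullet> (G x - K x)))"
  proof (rule integral_mono_AE[OF _ flux])
    show "AE x in N. g1 / p * norm (G x) powr p - g2 / p * norm (K x) powr p
       \<le> g x * (pflux p (G x) \<bullet> (G x - K x))"
      using g
    proof eventually_elim
      case (elim x)
      have "norm (G x) powr p - norm (K x) powr p \<le> p * (pflux p (G x) \<bullet> (G x - K x))"
        using pflux_tangent[OF p_gt_1, of "G x" "K x"] by (simp add: algebra_simps inner_diff_right)
      then have "g x * (norm (G x) powr p - norm (K x) powr p) \<le> g x * (p * (pflux p (G x) \<bullet> (G x - K x)))"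
        using elim g1 by (intro mult_left_mono) auto
      moreover have "g1 * norm (G x) powr p \<le> g x * norm (G x) powr p"
          "g x * norm (K x) powr p \<le> g2 * norm (K x) powr p"
        using elim by (auto intro!: mult_right_mono)
      ultimately show ?case using p0 by (simp add: field_simps)
    qed
  qed (use V in auto)
  moreover have "(LINT x|N. g1 / p * norm (G x) powr p - g2 / p * norm (K x) powr p)
     = g1 / p * (LINT x|N. norm (G x) powr p) - g2 / p * (LINT x|N. norm (K x) powr p)"
    using V by simp
  ultimately show ?thesis using eq by linarith
qed

text \<open>Subtracting the equations of two weights, the monotone part of the flux has a sign; what
  remains carries the difference of the weights and the flux of one fixed solution.\<close>

lemma euler_lagrange_difference:
  fixes g g' h u v :: "'x \<Rightarrow> real" and G H :: "'x \<Rightarrow> 'b"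
  assumes EL: "euler_lagrange \<mu> h g u G" and EL': "euler_lagrange \<mu> h g' v H"
    and [measurable]: "g \<in> borel_measurable N" "g' \<in> borel_measurable N" "h \<in> borel_measurable N"
    and h2: "integrable N (\<lambda>x. (h x)\<^sup>2)"
    and mu: "0 < \<mu>"
    and g: "AE x in N. 0 \<le> g x \<and> g x \<le> g2" and g': "AE x in N. 0 \<le> g' x \<and> g' x \<le> g2"
  shows "(LINT x|N. (u x - v x)\<^sup>2) / \<mu>
     \<le> (LINT x|N. \<bar>g x - g' x\<bar> * (norm (G x) powr (p - 1) * norm (G x - H x)))"
proof -
  have gb: "AE x in N. \<bar>g x\<bar> \<le> g2" using g by eventually_elim auto
  have gb': "AE x in N. \<bar>g' x\<bar> \<le> g2" using g' by eventually_elim auto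
  have gd: "AE x in N. \<bar>g x - g' x\<bar> \<le> g2" using g g' by eventually_elim auto
  then have gd': "AE x in N. \<bar>\<bar>g x - g' x\<bar>\<bar> \<le> g2" by simp
  have uG: "(u, G) \<in> V" using EL by (simp add: euler_lagrange_def)
  have vH: "(v, H) \<in> V" using EL' by (simp add: euler_lagrange_def)
  have diff: "(\<lambda>x. u x - v x, \<lambda>x. G x - H x) \<in> V"
    using V_lin[OF uG vH, of 1 "-1"] by simp
  note V = V_fun[OF uG] V_fun[OF vH] V_grad[OF uG] V_grad[OF vH] V_fun[OF diff] V_grad[OF diff]
  note [measurable] = V
  have flux: "integrable N (\<lambda>x. g x * (pflux p (G x) \<bullet> (G x - H x)))"
    by (rule integrable_flux[OF _ _ _ gb]) (use V in auto)
  have flux': "integrable N (\<lambda>x. g' x * (pflux p (H x) \<bullet> (G x - H x)))"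
    by (rule integrable_flux[OF _ _ _ gb']) (use V in auto)
  have int1: "integrable N (\<lambda>x. (h x - u x) / \<mu> * (u x - v x))"
    using integrable_product_of_squares[of "\<lambda>x. h x - u x" "\<lambda>x. u x - v x"] integrable_square_diff[of h u] h2 V
    by simp
  have int2: "integrable N (\<lambda>x. (h x - v x) / \<mu> * (u x - v x))"
    using integrable_product_of_squares[of "\<lambda>x. h x - v x" "\<lambda>x. u x - v x"] integrable_square_diff[of h v] h2 V
    by simp
  have "(LINT x|N. g' x * (pflux p (H x) \<bullet> (G x - H x))) - (LINT x|N. g x * (pflux p (G x) \<bullet> (G x - H x)))
      = (LINT x|N. (h x - v x) / \<mu> * (u x - v x)) - (LINT x|N. (h x - u x) / \<mu> * (u x - v x))"
    using EL EL' diff by (force simp: euler_lagrange_def)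
  also have "\<dots> = (LINT x|N. (h x - v x) / \<mu> * (u x - v x) - (h x - u x) / \<mu> * (u x - v x))"
    using int1 int2 by simp
  also have "\<dots> = (LINT x|N. (u x - v x)\<^sup>2 / \<mu>)"
    by (intro Bochner_Integration.integral_cong refl)
       (use mu in \<open>simp add: field_simps power2_eq_square\<close>)
  finally have "(LINT x|N. (u x - v x)\<^sup>2) / \<mu>
      = (LINT x|N. g' x * (pflux p (H x) \<bullet> (G x - H x)) - g x * (pflux p (G x) \<bullet> (G x - H x)))"
    using flux flux' by simp
  also have "\<dots> \<le> (LINT x|N. \<bar>g x - g' x\<bar> * (norm (G x) powr (p - 1) * norm (G x - H x)))"
  proof (rule integral_mono_AE)
    show "integrable N (\<lambda>x. \<bar>g x - g' x\<bar> * (norm (G x) powr (p - 1) * norm (G x - H x)))"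
      by (rule integrable_weighted_cross[OF _ _ _ gd']) (use V in auto)
    show "AE x in N. g' x * (pflux p (H x) \<bullet> (G x - H x)) - g x * (pflux p (G x) \<bullet> (G x - H x))
       \<le> \<bar>g x - g' x\<bar> * (norm (G x) powr (p - 1) * norm (G x - H x))"
      using g'
    proof eventually_elim
      case (elim x)
      have "0 \<le> g' x * ((pflux p (G x) - pflux p (H x)) \<bullet> (G x - H x))"
        using elim pflux_monotone[OF p_gt_1, of "G x" "H x"] by simp
      moreover have "\<bar>(g x - g' x) * (pflux p (G x) \<bullet> (G x - H x))\<bar>
          \<le> \<bar>g x - g' x\<bar> * (norm (G x) powr (p - 1) * norm (G x - H x))"
        unfolding abs_mult by (intro mult_left_mono abs_pflux_inner_le) auto
      moreover have "g' x * (pflux p (H x) \<bullet> (G x - H x)) - g x * (pflux p (G x) \<bullet> (G x - H x))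
         = - (g' x * ((pflux p (G x) - pflux p (H x)) \<bullet> (G x - H x)))
           - (g x - g' x) * (pflux p (G x) \<bullet> (G x - H x))"
        by (simp add: inner_diff_left algebra_simps)
      ultimately show ?case by linarith
    qed
  qed (use flux flux' in auto)
  finally show ?thesis .
qed

text \<open>Where \<open>X\<close> is at most \<open>n\<close> the weight is estimated in mean; the mean of \<open>X\<close> over the rest is small
  for large \<open>n\<close>.\<close>

lemma integral_small_weight:
  fixes X :: "'x \<Rightarrow> real"
  assumes X: "integrable N X" and X0: "\<And>x. 0 \<le> X x" and b: "0 \<le> b" and t: "0 < t"
  obtains n :: nat where "\<And>c. c \<in> borel_measurable N \<Longrightarrow> AE x in N. 0 \<le> c x \<and> c x \<le> b \<Longrightarrow>
    (LINT x|N. c x * X x) \<le> n * (LINT x|N. c x) + t"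
proof -
  note [measurable] = borel_measurable_integrable[OF X]
  define A where "A n = {x \<in> space N. real n < X x}" for n :: nat
  have A [measurable]: "A n \<in> sets N" for n unfolding A_def by measurable
  have "(\<lambda>n. LINT x|N. indicator (A n) x * X x) \<longlonglongrightarrow> 0"
  proof (rule integral_tail_tendsto_zero[OF X A])
    have "\<forall>\<^sub>F n in sequentially. x \<notin> A n" for x
    proof -
      obtain m :: nat where m: "X x \<le> m" using real_arch_simple by blast
      show ?thesis
        using eventually_ge_at_top[of m] by eventually_elim (use m in \<open>auto simp: A_def\<close>)
    qed
    then show "AE x in N. \<forall>\<^sub>F n in sequentially. x \<notin> A n" by simp
  qed
  from LIMSEQ_D[OF this, of "t / (b + 1)"] obtain n where
    n: "norm ((LINT x|N. indicator (A n) x * X x) - 0) < t / (b + 1)" using t b by auto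
  then have n': "(b + 1) * (LINT x|N. indicator (A n) x * X x) < t"
  proof -
    have "(LINT x|N. indicator (A n) x * X x) < t / (b + 1)" using n unfolding real_norm_def by linarith
    then have "(LINT x|N. indicator (A n) x * X x) * (b + 1) < t"
      using b by (subst (asm) pos_less_divide_eq) auto
    then show ?thesis by (simp only: mult.commute)
  qed
  show ?thesis
  proof (rule that)
    fix c :: "'x \<Rightarrow> real"
    assume [measurable]: "c \<in> borel_measurable N" and c: "AE x in N. 0 \<le> c x \<and> c x \<le> b"
    have intc: "integrable N c"
      by (rule integrable_const_bound[of _ b]) (use c in auto)
    have intA: "integrable N (\<lambda>x. indicator (A n) x * X x)"
      using integrable_real_indicator integrable_mult_indicator[OF A X] by simp
    have "(LINT x|N. c x * X x) \<le> (LINT x|N. n * c x + b * (indicator (A n) x * X x))"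
    proof (rule integral_mono_AE)
      show "integrable N (\<lambda>x. c x * X x)"
      proof (rule Bochner_Integration.integrable_bound)
        show "integrable N (\<lambda>x. b * X x)" using X by simp
        show "AE x in N. norm (c x * X x) \<le> norm (b * X x)"
          using c by eventually_elim (use X0 in \<open>auto simp: abs_mult intro!: mult_right_mono\<close>)
      qed measurable
      show "AE x in N. c x * X x \<le> n * c x + b * (indicator (A n) x * X x)"
        using c AE_space
      proof eventually_elim
        case (elim x)
        show ?case
        proof (cases "x \<in> A n")
          case True
          then have "c x * X x \<le> b * X x" using elim X0 by (intro mult_right_mono) auto
          then show ?thesis using True elim by (simp add: add_increasing)
        next
          case False
          then have "X x \<le> n" using elim by (auto simp: A_def)
          then have "c x * X x \<le> c x * n" using elim by (intro mult_left_mono) auto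
          then show ?thesis using False by (simp add: mult.commute)
        qed
      qed
    qed (use intc intA in auto)
    also have "\<dots> = n * (LINT x|N. c x) + b * (LINT x|N. indicator (A n) x * X x)"
      using intc intA by simp
    also have "b * (LINT x|N. indicator (A n) x * X x) \<le> (b + 1) * (LINT x|N. indicator (A n) x * X x)"
      using X0 by (intro mult_right_mono Bochner_Integration.integral_nonneg) auto
    finally show "(LINT x|N. c x * X x) \<le> n * (LINT x|N. c x) + t" using n' by linarith
  qed
qed

text \<open>
  The solution depends continuously on the weight in mean.  It is this that makes the solution a
  random element as soon as the weight is one.
\<close>

theorem euler_lagrange_continuous_in_weight:
  fixes g h u :: "'x \<Rightarrow> real" and G K :: "'x \<Rightarrow> 'b"
  assumes EL: "euler_lagrange \<mu> h g u G" and hK: "(h, K) \<in> V"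
    and [measurable]: "g \<in> borel_measurable N"
    and mu: "0 < \<mu>" and g1: "0 < g1"
    and g: "AE x in N. g1 \<le> g x \<and> g x \<le> g2"
    and t: "0 < t"
  obtains \<delta> where "0 < \<delta>" and "\<And>g' v H. g' \<in> borel_measurable N \<Longrightarrow>
      AE x in N. g1 \<le> g' x \<and> g' x \<le> g2 \<Longrightarrow> euler_lagrange \<mu> h g' v H \<Longrightarrow>
      (LINT x|N. \<bar>g x - g' x\<bar>) < \<delta> \<Longrightarrow> (LINT x|N. \<bar>u x - v x\<bar>) < t"
proof -
  have p0: "0 < p" using p_gt_1 by simp
  have g_nonneg: "AE x in N. 0 \<le> g x \<and> g x \<le> g2" using g by eventually_elim (use g1 in auto)
  define b where "b = max g2 0"
  have b: "0 \<le> b" by (simp add: b_def)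
  define A where "A = measure N (space N)"
  have A: "0 \<le> A" by (simp add: A_def)
  have uG: "(u, G) \<in> V" using EL by (simp add: euler_lagrange_def)
  note [measurable] = V_fun(1)[OF uG] V_grad(1)[OF uG] V_fun(1)[OF hK] V_grad(1)[OF hK]
  define B where "B = b / g1 * (LINT x|N. norm (K x) powr p)"
  have B0: "0 \<le> B" using g1 b by (simp add: B_def)
  have B: "(LINT x|N. norm (H x) powr p) \<le> B"
    if "euler_lagrange \<mu> h g' v H" "g' \<in> borel_measurable N" "AE x in N. g1 \<le> g' x \<and> g' x \<le> g2" for g' v H
  proof -
    have "AE x in N. g1 \<le> g' x \<and> g' x \<le> b"
      using that(3) by eventually_elim (auto simp: b_def)
    note euler_lagrange_energy_bound[OF that(1) hK that(2) mu g1 this]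
    moreover have "0 \<le> (LINT x|N. (v x - h x)\<^sup>2) / \<mu>" using mu by simp
    ultimately have "g1 / p * (LINT x|N. norm (H x) powr p) \<le> b / p * (LINT x|N. norm (K x) powr p)"
      by linarith
    then show ?thesis using g1 p0 by (simp add: B_def field_simps)
  qed
  define d where "d = t / (2 * (A + 1))"
  have d: "0 < d" using t A by (simp add: d_def)
  have dA: "d * A < t / 2"
  proof -
    have "t * A < t * (A + 1)" using t by simp
    then show ?thesis using A by (simp add: d_def field_simps)
  qed
  \<comment> \<open>bound for the square of the difference, over \<open>\<mu>\<close>, that forces a mean below \<open>t\<close>\<close>
  define q where "q = t / 2 * d / \<mu>"
  have q: "0 < q" using t d mu by (simp add: q_def)
  \<comment> \<open>a positive bound for the mean of \<open>norm (G - H) powr p\<close>, whatever the second weight\<close>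
  define M where "M = 2 powr p * (2 * B) + 1"
  have M: "0 < M" using B0 by (simp add: M_def add_nonneg_pos)
  obtain C where C: "0 \<le> C" "\<And>c x y. 0 \<le> c \<Longrightarrow> c \<le> b \<Longrightarrow> 0 \<le> x \<Longrightarrow> 0 \<le> y \<Longrightarrow>
      c * (x powr (p - 1) * y) \<le> q / 4 / M * y powr p + C * (c * x powr p)"
    using weighted_Young[OF p_gt_1 _ b, of "q / 4 / M"] q M by auto
  obtain n :: nat where n: "\<And>c. c \<in> borel_measurable N \<Longrightarrow> AE x in N. 0 \<le> c x \<and> c x \<le> b \<Longrightarrow>
      (LINT x|N. c x * norm (G x) powr p) \<le> n * (LINT x|N. c x) + q / 4 / (C + 1)"
    using integral_small_weight[OF V_grad(2)[OF uG] _ b, of "q / 4 / (C + 1)"] q C by auto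
  define \<delta> where "\<delta> = q / 4 / (C + 1) / (n + 1)"
  have \<delta>: "0 < \<delta>" using q C by (simp add: \<delta>_def)
  show ?thesis
  proof (rule that[OF \<delta>])
    fix g' v H
    assume [measurable]: "g' \<in> borel_measurable N" and g': "AE x in N. g1 \<le> g' x \<and> g' x \<le> g2"
      and EL': "euler_lagrange \<mu> h g' v H" and close: "(LINT x|N. \<bar>g x - g' x\<bar>) < \<delta>"
    have vH: "(v, H) \<in> V" using EL' by (simp add: euler_lagrange_def)
    note [measurable] = V_fun(1)[OF vH] V_grad(1)[OF vH]
    have g'_nonneg: "AE x in N. 0 \<le> g' x \<and> g' x \<le> g2" using g' by eventually_elim (use g1 in auto)
    let ?c = "\<lambda>x. \<bar>g x - g' x\<bar>"
    have c: "AE x in N. 0 \<le> ?c x \<and> ?c x \<le> b"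
      using g_nonneg g'_nonneg by eventually_elim (auto simp: b_def)
    then have cb: "AE x in N. \<bar>?c x\<bar> \<le> b" by simp
    have diff: "(\<lambda>x. u x - v x, \<lambda>x. G x - H x) \<in> V"
      using V_lin[OF uG vH, of 1 "-1"] by simp
    have powd: "(LINT x|N. norm (G x - H x) powr p) \<le> M"
    proof -
      have "(LINT x|N. norm (G x - H x) powr p)
          \<le> (LINT x|N. 2 powr p * (norm (G x) powr p + norm (H x) powr p))"
      proof (rule integral_mono)
        show "norm (G x - H x) powr p \<le> 2 powr p * (norm (G x) powr p + norm (H x) powr p)" for x
          using norm_powr_add_le[OF p0, of "G x" "- H x"] by simp
      qed (use V_grad(2)[OF diff] V_grad(2)[OF uG] V_grad(2)[OF vH] in auto)
      also have "\<dots> = 2 powr p * ((LINT x|N. norm (G x) powr p) + (LINT x|N. norm (H x) powr p))"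
        using V_grad(2)[OF uG] V_grad(2)[OF vH] by simp
      also have "\<dots> \<le> 2 powr p * (2 * B)"
        using B[OF EL _ g] B[OF EL' _ g'] by (intro mult_left_mono) auto
      finally show ?thesis by (simp add: M_def)
    qed
    have h2: "integrable N (\<lambda>x. (h x)\<^sup>2)" by (rule V_fun(2)[OF hK])
    have "(LINT x|N. (u x - v x)\<^sup>2) / \<mu>
        \<le> (LINT x|N. ?c x * (norm (G x) powr (p - 1) * norm (G x - H x)))"
      by (rule euler_lagrange_difference[OF EL EL' _ _ _ h2 mu g_nonneg g'_nonneg]) measurable
    also have "\<dots> \<le> (LINT x|N. q / 4 / M * norm (G x - H x) powr p + C * (?c x * norm (G x) powr p))"
    proof (rule integral_mono_AE)
      show "integrable N (\<lambda>x. ?c x * (norm (G x) powr (p - 1) * norm (G x - H x)))"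
        by (rule integrable_weighted_cross[OF _ _ _ cb V_grad(2)[OF uG] V_grad(2)[OF diff]]) measurable
      show "integrable N (\<lambda>x. q / 4 / M * norm (G x - H x) powr p + C * (?c x * norm (G x) powr p))"
        using V_grad(2)[OF diff] integrable_weighted_powr[OF _ _ cb V_grad(2)[OF uG]] by auto
      show "AE x in N. ?c x * (norm (G x) powr (p - 1) * norm (G x - H x))
          \<le> q / 4 / M * norm (G x - H x) powr p + C * (?c x * norm (G x) powr p)"
        using c by eventually_elim (intro C(2); auto)
    qed
    also have "\<dots> = q / 4 / M * (LINT x|N. norm (G x - H x) powr p) + C * (LINT x|N. ?c x * norm (G x) powr p)"
      using V_grad(2)[OF diff] integrable_weighted_powr[OF _ _ cb V_grad(2)[OF uG]] by simp
    also have "q / 4 / M * (LINT x|N. norm (G x - H x) powr p) \<le> q / 4 / M * M"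
      using powd q M by (intro mult_left_mono) auto
    also have "q / 4 / M * M = q / 4" using M by simp
    also have "C * (LINT x|N. ?c x * norm (G x) powr p) \<le> (C + 1) * (n * \<delta> + q / 4 / (C + 1))"
    proof (intro mult_mono)
      have "n * (LINT x|N. ?c x) \<le> n * \<delta>" using close by (intro mult_left_mono) auto
      then show "(LINT x|N. ?c x * norm (G x) powr p) \<le> n * \<delta> + q / 4 / (C + 1)"
        using n[OF _ c] by fastforce
    qed (use C in \<open>auto intro!: Bochner_Integration.integral_nonneg\<close>)
    also have "(C + 1) * (n * \<delta> + q / 4 / (C + 1)) = (C + 1) * (n * \<delta>) + q / 4"
      using C by (simp add: field_simps)
    also have "(C + 1) * (n * \<delta>) \<le> q / 4"
    proof -
      have "c * (k * (q / 4 / c / m)) = q / 4 * (k / m)" if "c \<noteq> 0" for c k m :: real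
        using that by simp
      from this[of "C + 1" n "n + 1"] C(1) have "(C + 1) * (n * \<delta>) = q / 4 * (n / (n + 1))"
        unfolding \<delta>_def by linarith
      also have "\<dots> \<le> q / 4 * 1" using q by (intro mult_left_mono) auto
      finally show ?thesis by simp
    qed
    finally have "(LINT x|N. (u x - v x)\<^sup>2) / \<mu> \<le> q / 4 + (q / 4 + q / 4)" by linarith
    then have "(LINT x|N. (u x - v x)\<^sup>2) / \<mu> < q" using q by linarith
    then have "(LINT x|N. (u x - v x)\<^sup>2) / d < t / 2"
      using mu d by (simp add: q_def field_simps)
    moreover have "(LINT x|N. \<bar>u x - v x\<bar>) \<le> d * A + (LINT x|N. (u x - v x)\<^sup>2) / d"
      unfolding A_def by (rule integral_abs_le_square[OF _ V_fun(2)[OF diff] d]) measurable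
    ultimately show "(LINT x|N. \<bar>u x - v x\<bar>) < t" using dA by linarith
  qed
qed

end


section \<open>Continuous functions and polynomials are dense in mean\<close>

lemma borel_measurable_AE_limit_of_continuous:
  fixes f :: "'a::euclidean_space \<Rightarrow> real"
  assumes "f \<in> borel_measurable lborel"
  obtains c :: "nat \<Rightarrow> 'a \<Rightarrow> real" where "\<And>n. continuous_on UNIV (c n)"
    "AE x in lborel. (\<lambda>n. c n x) \<longlonglongrightarrow> f x"
proof -
  have "f \<in> borel_measurable lebesgue" by (rule measurable_completion[OF assms])
  then have "f measurable_on UNIV" by (rule lebesgue_measurable_imp_measurable_on) simp
  then obtain N c where c: "negligible N" "\<And>n. continuous_on UNIV (c n)"
    "\<And>x. x \<notin> N \<Longrightarrow> (\<lambda>n. c n x) \<longlonglongrightarrow> f x"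
    by (auto simp: measurable_on_def)
  have "AE x in lebesgue. x \<notin> N"
    using c(1) by (simp add: negligible_iff_null_sets AE_not_in)
  then have "AE x in lborel. x \<notin> N" by (simp add: AE_completion_iff)
  then have "AE x in lborel. (\<lambda>n. c n x) \<longlonglongrightarrow> f x"
    by eventually_elim (rule c(3))
  with c(2) show ?thesis by (rule that)
qed

lemma continuous_compactly_supported_integrable:
  fixes c :: "'a::euclidean_space \<Rightarrow> real"
  assumes "continuous_on UNIV c" "compact K" "\<And>x. x \<notin> K \<Longrightarrow> c x = 0"
  shows "integrable lborel c"
proof -
  have "integrable lborel (\<lambda>x. indicator K x *\<^sub>R c x)"
    by (intro borel_integrable_compact continuous_on_subset[OF assms(1)] assms) auto
  moreover have "(\<lambda>x. indicator K x *\<^sub>R c x) = c" 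
    using assms(3) by (intro ext) (auto simp: indicator_def)
  ultimately show ?thesis by simp
qed

text \<open>The function is truncated in space and in height first; continuous functions that converge to it
  almost everywhere may then be truncated in the same way, and dominated convergence applies.\<close>

lemma continuous_compactly_supported_dense_L1:
  fixes f :: "'a::euclidean_space \<Rightarrow> real"
  assumes f: "integrable lborel f" and e: "0 < e"
  obtains c K where "continuous_on UNIV c" "compact K" "\<And>x. x \<notin> K \<Longrightarrow> c x = 0"
    "(LINT x|lborel. \<bar>f x - c x\<bar>) < e"
proof -
  have fm [measurable]: "f \<in> borel_measurable borel" using borel_measurable_integrable[OF f] by simp
  define \<kappa> where "\<kappa> k x = max 0 (min 1 (real k + 1 - norm x))" for k :: nat and x :: 'a
  have \<kappa>_cont: "continuous_on UNIV (\<kappa> k)" for k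
    unfolding \<kappa>_def by (intro continuous_intros)
  have \<kappa>_meas [measurable]: "\<kappa> k \<in> borel_measurable borel" for k
    using \<kappa>_cont by (rule borel_measurable_continuous_onI)
  have \<kappa>_range: "0 \<le> \<kappa> k x" "\<kappa> k x \<le> 1" for k x by (auto simp: \<kappa>_def)
  have \<kappa>_supp: "\<kappa> k x = 0" if "x \<notin> cball 0 (real k + 1)" for k x
    using that by (auto simp: \<kappa>_def)
  have \<kappa>_int: "integrable lborel (\<kappa> k)" for k
    by (rule continuous_compactly_supported_integrable[OF \<kappa>_cont compact_cball \<kappa>_supp])
  define tr where "tr k t = max (- real k) (min (real k) t)" for k :: nat and t :: real
  have tr_cont: "continuous_on UNIV (tr k)" for k
    unfolding tr_def by (intro continuous_intros)
  have tr_isCont: "isCont (tr k) t" for k t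
    using tr_cont[of k] by (simp add: continuous_on_eq_continuous_at)
  have tr_meas [measurable]: "tr k \<in> borel_measurable borel" for k
    using tr_cont by (rule borel_measurable_continuous_onI)
  have "(\<lambda>k. LINT x|lborel. \<bar>f x - \<kappa> k x * tr k (f x)\<bar>) \<longlonglongrightarrow> (LINT x::'a|lborel. (0::real))"
  proof (rule integral_dominated_convergence[where w = "\<lambda>x. 2 * \<bar>f x\<bar>"])
    show "AE x in lborel. (\<lambda>k. \<bar>f x - \<kappa> k x * tr k (f x)\<bar>) \<longlonglongrightarrow> 0"
    proof (rule AE_I2)
      fix x :: 'a
      obtain m :: nat where m: "norm x + \<bar>f x\<bar> \<le> m" using real_arch_simple by blast
      have "\<forall>\<^sub>F k in sequentially. \<bar>f x - \<kappa> k x * tr k (f x)\<bar> = 0"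
        using eventually_ge_at_top[of m]
      proof eventually_elim
        case (elim k)
        then have k: "real m \<le> real k" by simp
        have "norm x \<le> k" "\<bar>f x\<bar> \<le> k" using m k by (smt (verit) norm_ge_zero)+
        then show ?case by (simp add: \<kappa>_def tr_def)
      qed
      then show "(\<lambda>k. \<bar>f x - \<kappa> k x * tr k (f x)\<bar>) \<longlonglongrightarrow> 0"
        by (rule tendsto_eventually)
    qed
    show "AE x in lborel. norm \<bar>f x - \<kappa> k x * tr k (f x)\<bar> \<le> 2 * \<bar>f x\<bar>" for k
    proof (rule AE_I2)
      fix x :: 'a
      have "\<bar>\<kappa> k x * tr k (f x)\<bar> \<le> 1 * \<bar>f x\<bar>"
        unfolding abs_mult using \<kappa>_range[of k x] by (intro mult_mono) (auto simp: tr_def)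
      then show "norm \<bar>f x - \<kappa> k x * tr k (f x)\<bar> \<le> 2 * \<bar>f x\<bar>" by simp
    qed
  qed (use f in auto)
  then have "(\<lambda>k. LINT x|lborel. \<bar>f x - \<kappa> k x * tr k (f x)\<bar>) \<longlonglongrightarrow> 0" by simp
  from LIMSEQ_D[OF this, of "e / 2"] e obtain k where
    k: "(LINT x|lborel. \<bar>f x - \<kappa> k x * tr k (f x)\<bar>) < e / 2" by fastforce
  obtain c where c: "\<And>n. continuous_on UNIV (c n)" "AE x in lborel. (\<lambda>n. c n x) \<longlonglongrightarrow> f x"
    using borel_measurable_AE_limit_of_continuous[of f] by auto
  have [measurable]: "c n \<in> borel_measurable borel" for n
    using c(1) by (rule borel_measurable_continuous_onI)
  have trc_le: "\<bar>\<kappa> k x * tr k t\<bar> \<le> k * \<kappa> k x" for x t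
    unfolding abs_mult using \<kappa>_range[of k x]
    by (subst mult.commute, intro mult_mono) (auto simp: tr_def)
  have int1: "integrable lborel (\<lambda>x. \<kappa> k x * tr k (g x))" if [measurable]: "g \<in> borel_measurable borel" for g
  proof (rule Bochner_Integration.integrable_bound)
    show "integrable lborel (\<lambda>x. k * \<kappa> k x)" using \<kappa>_int by simp
    show "AE x in lborel. norm (\<kappa> k x * tr k (g x)) \<le> norm (k * \<kappa> k x)"
      using trc_le \<kappa>_range[of k] by (intro AE_I2) (simp add: abs_of_nonneg)
  qed simp
  have "(\<lambda>n. LINT x|lborel. \<bar>\<kappa> k x * tr k (f x) - \<kappa> k x * tr k (c n x)\<bar>) \<longlonglongrightarrow> (LINT x::'a|lborel. (0::real))"
  proof (rule integral_dominated_convergence[where w = "\<lambda>x. 2 * (k * \<kappa> k x)"])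
    show "AE x in lborel. (\<lambda>n. \<bar>\<kappa> k x * tr k (f x) - \<kappa> k x * tr k (c n x)\<bar>) \<longlonglongrightarrow> 0"
      using c(2)
    proof eventually_elim
      case (elim x)
      have "(\<lambda>n. tr k (c n x)) \<longlonglongrightarrow> tr k (f x)"
        by (rule isCont_tendsto_compose[OF tr_isCont elim])
      then have "(\<lambda>n. \<bar>\<kappa> k x * tr k (f x) - \<kappa> k x * tr k (c n x)\<bar>)
         \<longlonglongrightarrow> \<bar>\<kappa> k x * tr k (f x) - \<kappa> k x * tr k (f x)\<bar>"
        by (intro tendsto_intros)
      then show ?case by simp
    qed
    show "AE x in lborel. norm \<bar>\<kappa> k x * tr k (f x) - \<kappa> k x * tr k (c n x)\<bar> \<le> 2 * (k * \<kappa> k x)" for n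
    proof (rule AE_I2)
      fix x
      show "norm \<bar>\<kappa> k x * tr k (f x) - \<kappa> k x * tr k (c n x)\<bar> \<le> 2 * (k * \<kappa> k x)"
        using trc_le[of x "f x"] trc_le[of x "c n x"] unfolding real_norm_def by linarith
    qed
  qed (use \<kappa>_int in auto)
  then have "(\<lambda>n. LINT x|lborel. \<bar>\<kappa> k x * tr k (f x) - \<kappa> k x * tr k (c n x)\<bar>) \<longlonglongrightarrow> 0" by simp
  from LIMSEQ_D[OF this, of "e / 2"] e obtain n where
    n: "(LINT x|lborel. \<bar>\<kappa> k x * tr k (f x) - \<kappa> k x * tr k (c n x)\<bar>) < e / 2" by fastforce
  show ?thesis
  proof (rule that)
    show "continuous_on UNIV (\<lambda>x. \<kappa> k x * tr k (c n x))"
      by (intro continuous_intros \<kappa>_cont continuous_on_compose2[OF tr_cont c(1)]) auto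
    show "compact (cball (0::'a) (real k + 1))" by simp
    show "\<kappa> k x * tr k (c n x) = 0" if "x \<notin> cball 0 (real k + 1)" for x
      using \<kappa>_supp[OF that] by simp
    have "(LINT x|lborel. \<bar>f x - \<kappa> k x * tr k (c n x)\<bar>)
       \<le> (LINT x|lborel. \<bar>f x - \<kappa> k x * tr k (f x)\<bar> + \<bar>\<kappa> k x * tr k (f x) - \<kappa> k x * tr k (c n x)\<bar>)"
      using f int1[of f] int1[of "c n"] by (intro integral_mono) auto
    also have "\<dots> = (LINT x|lborel. \<bar>f x - \<kappa> k x * tr k (f x)\<bar>)
        + (LINT x|lborel. \<bar>\<kappa> k x * tr k (f x) - \<kappa> k x * tr k (c n x)\<bar>)"
      using f int1[of f] int1[of "c n"] by (intro Bochner_Integration.integral_add) auto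
    finally show "(LINT x|lborel. \<bar>f x - \<kappa> k x * tr k (c n x)\<bar>) < e" using k n by linarith
  qed
qed

lemma lborel_translation:
  fixes f :: "'a::euclidean_space \<Rightarrow> 'b::{banach, second_countable_topology}"
  shows "(LINT x|lborel. f (x + v)) = (LINT x|lborel. f x)"
    and "integrable lborel (\<lambda>x. f (x + v)) \<longleftrightarrow> integrable lborel f"
proof -
  have d: "distr lborel borel (\<lambda>x. x + v) = lborel"
    using lborel_distr_plus[of v] by (simp add: add.commute[of _ v])
  show "(LINT x|lborel. f (x + v)) = (LINT x|lborel. f x)"
  proof (cases "f \<in> borel_measurable borel")
    case True
    then show ?thesis
      using integral_distr[of "\<lambda>x. x + v" lborel borel f] by (simp add: d)
  next
    case False
    moreover have "(\<lambda>x. f (x + v)) \<notin> borel_measurable borel"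
    proof
      assume "(\<lambda>x. f (x + v)) \<in> borel_measurable borel"
      then have "(\<lambda>x. f (x - v + v)) \<in> borel_measurable borel"
        by (rule measurable_compose[rotated]) simp
      with False show False by simp
    qed
    ultimately show ?thesis
      by (subst (1 2) not_integrable_integral_eq) (auto dest: borel_measurable_integrable)
  qed
  have imp: "integrable lborel (\<lambda>x. g (x + w))" if "integrable lborel g" for g :: "'a \<Rightarrow> 'b" and w
  proof -
    have "distr lborel borel (\<lambda>x. x + w) = lborel"
      using lborel_distr_plus[of w] by (simp add: add.commute[of _ w])
    then show ?thesis
      using integrable_distr[of "\<lambda>x. x + w" lborel borel g] that by simp
  qed
  from imp[of f v] imp[of "\<lambda>x. f (x + v)" "- v"]
  show "integrable lborel (\<lambda>x. f (x + v)) \<longleftrightarrow> integrable lborel f" by auto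
qed

lemma L1_continuity_of_translation:
  fixes f :: "'a::euclidean_space \<Rightarrow> real"
  assumes f: "integrable lborel f" and e: "0 < e"
  obtains d where "0 < d" "\<And>v. norm v < d \<Longrightarrow> (LINT x|lborel. \<bar>f (x + v) - f x\<bar>) < e"
proof -
  have e4: "0 < e / 4" using e by simp
  obtain c K where c: "continuous_on UNIV c" "compact K" "\<And>x. x \<notin> K \<Longrightarrow> c x = 0"
    "(LINT x|lborel. \<bar>f x - c x\<bar>) < e / 4"
    using continuous_compactly_supported_dense_L1[OF f e4] by blast
  have intc: "integrable lborel c" by (rule continuous_compactly_supported_integrable[OF c(1-3)])
  define L where "L = {x + y | x y. x \<in> K \<and> y \<in> cball (0::'a) 1}"
  have L: "compact L" unfolding L_def by (intro compact_sums c compact_cball)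
  define A where "A = measure lborel L"
  have A: "0 \<le> A" by (simp add: A_def)
  have intL: "integrable lborel (indicat_real L)"
    using L emeasure_compact_finite[OF L]
    by (intro integrable_real_indicator) (auto intro: borel_compact simp: top.not_eq_extremum)
  have "uniformly_continuous_on L c"
    by (rule compact_uniformly_continuous[OF continuous_on_subset[OF c(1)] L]) simp
  then obtain d where d: "0 < d"
    "\<And>x y. x \<in> L \<Longrightarrow> y \<in> L \<Longrightarrow> dist y x < d \<Longrightarrow> dist (c y) (c x) < e / 4 / (A + 1)"
    unfolding uniformly_continuous_on_def using e A by (metis add_nonneg_pos divide_pos_pos e4 zero_less_one)
  show ?thesis
  proof (rule that)
    show "0 < min d 1" using d by simp
    fix v :: 'a assume v: "norm v < min d 1"
    have fv: "integrable lborel (\<lambda>x. f (x + v))" "integrable lborel (\<lambda>x. c (x + v))"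
      using f intc by (simp_all add: lborel_translation)
    have ptw: "\<bar>c (x + v) - c x\<bar> \<le> e / 4 / (A + 1) * indicator L x" for x
    proof (cases "x \<in> L")
      case xL: True
      show ?thesis
      proof (cases "x + v \<in> L")
        case True
        then show ?thesis using d(2)[of x "x + v"] v xL by (simp add: dist_norm)
      next
        case False
        have "x + v \<notin> K" "x \<notin> K"
        proof -
          show "x \<notin> K" using False v by (force simp: L_def)
          have "x + v = (x + v) + 0" by simp
          then show "x + v \<notin> K" using False unfolding L_def by fastforce
        qed
        then show ?thesis using c(3) xL e A by simp
      qed
    next
      case False
      have "x + v \<notin> K"
      proof
        assume "x + v \<in> K"
        moreover have "x = (x + v) + (- v)" by simp
        moreover have "- v \<in> cball 0 1" using v by simp
        ultimately show False using False unfolding L_def by blast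
      qed
      moreover have "x \<notin> K"
      proof
        assume "x \<in> K"
        moreover have "x = x + 0" by simp
        ultimately show False using False unfolding L_def by fastforce
      qed
      ultimately show ?thesis using c(3) False by simp
    qed
    have "(LINT x|lborel. \<bar>f (x + v) - f x\<bar>)
      \<le> (LINT x|lborel. \<bar>f (x + v) - c (x + v)\<bar> + (\<bar>f x - c x\<bar> + e / 4 / (A + 1) * indicator L x))"
    proof (rule integral_mono)
      show "\<bar>f (x + v) - f x\<bar> \<le> \<bar>f (x + v) - c (x + v)\<bar> + (\<bar>f x - c x\<bar> + e / 4 / (A + 1) * indicator L x)" for x
        using ptw[of x] by linarith
    qed (use f fv intc intL in auto)
    also have "\<dots> = (LINT x|lborel. \<bar>f (x + v) - c (x + v)\<bar>) + ((LINT x|lborel. \<bar>f x - c x\<bar>)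
        + (LINT x|lborel. e / 4 / (A + 1) * indicator L x))"
      using f fv intc intL by simp
    also have "(LINT x|lborel. \<bar>f (x + v) - c (x + v)\<bar>) = (LINT x|lborel. \<bar>f x - c x\<bar>)"
      by (rule lborel_translation(1)[of "\<lambda>x. \<bar>f x - c x\<bar>"])
    also have "(LINT x|lborel. e / 4 / (A + 1) * indicator L x) = e / 4 / (A + 1) * A"
      using intL by (simp add: A_def)
    also have "\<dots> \<le> e / 4" using e A by (simp add: field_simps)
    finally show "(LINT x|lborel. \<bar>f (x + v) - f x\<bar>) < e" using c(4) e by linarith
  qed
qed

text \<open>Rational coefficients give a countable family that is still dense.\<close>

inductive ratpoly :: "('a::euclidean_space \<Rightarrow> real) \<Rightarrow> bool" where
  const: "ratpoly (\<lambda>x. of_rat q)"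
| coord: "b \<in> Basis \<Longrightarrow> ratpoly (\<lambda>x. x \<bullet> b)"
| add: "ratpoly f \<Longrightarrow> ratpoly g \<Longrightarrow> ratpoly (\<lambda>x. f x + g x)"
| mult: "ratpoly f \<Longrightarrow> ratpoly g \<Longrightarrow> ratpoly (\<lambda>x. f x * g x)"

lemma ratpoly_imp_real_polynomial_function: "ratpoly f \<Longrightarrow> real_polynomial_function f"
  by (induction rule: ratpoly.induct)
     (auto intro: real_polynomial_function.intros bounded_linear_inner_left)

lemma countable_ratpoly: "countable {f :: 'a::euclidean_space \<Rightarrow> real. ratpoly f}"
proof -
  define step where "step Q = Q \<union> (\<lambda>(f, g) x. f x + g x) ` (Q \<times> Q) \<union> (\<lambda>(f, g) x. f x * g x) ` (Q \<times> Q)"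
    for Q :: "('a \<Rightarrow> real) set"
  define Q where "Q n = (step ^^ n) (range (\<lambda>q x. of_rat q) \<union> (\<lambda>b x. x \<bullet> b) ` Basis)" for n
  have Q_Suc: "Q (Suc n) = step (Q n)" for n by (simp add: Q_def)
  have step_add: "(\<lambda>x. f x + g x) \<in> step A" and step_mult: "(\<lambda>x. f x * g x) \<in> step A"
    if "f \<in> A" "g \<in> A" for f g A
  proof -
    have "(f, g) \<in> A \<times> A" using that by simp
    from imageI[OF this, of "\<lambda>(f, g) x. f x + g x"] imageI[OF this, of "\<lambda>(f, g) x. f x * g x"]
    show "(\<lambda>x. f x + g x) \<in> step A" "(\<lambda>x. f x * g x) \<in> step A" by (auto simp: step_def)
  qed
  have mono: "Q n \<subseteq> Q m" if "n \<le> m" for n m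
    using that by (rule lift_Suc_mono_le[rotated]) (auto simp: Q_Suc step_def)
  have common: "\<exists>k. f \<in> Q k \<and> g \<in> Q k" if "f \<in> Q n" "g \<in> Q m" for f g n m
    using that mono[of n "max n m"] mono[of m "max n m"] by (intro exI[of _ "max n m"]) auto
  have countable_Q: "countable (Q n)" for n
  proof (induction n)
    case (Suc n)
    then show ?case unfolding Q_Suc step_def by auto
  qed (auto simp: Q_def intro: countable_finite)
  have "\<exists>n. f \<in> Q n" if "ratpoly f" for f
    using that
  proof (induction rule: ratpoly.induct)
    case (const q) show ?case by (intro exI[of _ 0]) (auto simp: Q_def)
  next
    case (coord b) then show ?case by (intro exI[of _ 0]) (auto simp: Q_def)
  next
    case (add f g)
    then obtain k where "f \<in> Q k" "g \<in> Q k" using common by blast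
    then show ?case by (intro exI[of _ "Suc k"]) (simp add: Q_Suc step_add)
  next
    case (mult f g)
    then obtain k where "f \<in> Q k" "g \<in> Q k" using common by blast
    then show ?case by (intro exI[of _ "Suc k"]) (simp add: Q_Suc step_mult)
  qed
  then have "{f. ratpoly f} \<subseteq> (\<Union>n. Q n)" by (intro subsetI) simp
  then show ?thesis
    by (rule countable_subset) (intro countable_UN countable_Q countableI_type)
qed

lemma ratpoly_uniformly_dense:
  fixes f :: "'a::euclidean_space \<Rightarrow> real"
  assumes K: "compact K" and f: "real_polynomial_function f" and e: "0 < e"
  obtains q where "ratpoly q" "\<And>x. x \<in> K \<Longrightarrow> \<bar>f x - q x\<bar> < e"
proof -
  define P where "P f \<longleftrightarrow> continuous_on K f \<and> (\<forall>e>0. \<exists>q. ratpoly q \<and> (\<forall>x\<in>K. \<bar>f x - q x\<bar> < e))"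
    for f :: "'a \<Rightarrow> real"
  have P_const: "P (\<lambda>x. c)" for c
    unfolding P_def
  proof (intro conjI allI impI continuous_on_const)
    fix e :: real assume "0 < e"
    then obtain q where q: "q \<in> \<rat>" "c - e < q" "q < c + e"
      using Rats_dense_in_real[of "c - e" "c + e"] by auto
    then obtain r where r: "q = of_rat r" by (auto elim: Rats_cases)
    show "\<exists>q. ratpoly q \<and> (\<forall>x\<in>K. \<bar>c - q x\<bar> < e)"
      by (rule exI[of _ "\<lambda>x. of_rat r"]) (use q r in \<open>auto intro: ratpoly.const\<close>)
  qed
  have P_coord: "P (\<lambda>x. x \<bullet> b)" if "b \<in> Basis" for b
    unfolding P_def using ratpoly.coord[OF that] by (intro conjI allI impI continuous_intros exI) auto
  have P_add: "P (\<lambda>x. f x + g x)" if fg: "P f" "P g" for f g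
    unfolding P_def
  proof (intro conjI allI impI)
    show "continuous_on K (\<lambda>x. f x + g x)" using fg by (auto simp: P_def intro!: continuous_intros)
    fix e :: real assume "0 < e"
    then obtain q r where qr: "ratpoly q" "\<forall>x\<in>K. \<bar>f x - q x\<bar> < e / 2" "ratpoly r" "\<forall>x\<in>K. \<bar>g x - r x\<bar> < e / 2"
      using fg unfolding P_def by (meson half_gt_zero)
    have "\<bar>f x + g x - (q x + r x)\<bar> < e" if "x \<in> K" for x
      using qr(2,4) that by (smt (verit) field_sum_of_halves)
    then show "\<exists>q. ratpoly q \<and> (\<forall>x\<in>K. \<bar>f x + g x - q x\<bar> < e)"
      by (intro exI[of _ "\<lambda>x. q x + r x"] conjI ratpoly.add[OF qr(1,3)]) auto
  qed
  have P_mult: "P (\<lambda>x. f x * g x)" if fg: "P f" "P g" for f g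
    unfolding P_def
  proof (intro conjI allI impI)
    show "continuous_on K (\<lambda>x. f x * g x)" using fg by (auto simp: P_def intro!: continuous_intros)
    fix e :: real assume e: "0 < e"
    have "bounded (f ` K)" "bounded (g ` K)"
      using fg K by (auto simp: P_def intro!: compact_imp_bounded compact_continuous_image)
    then obtain a b where ab: "\<forall>x\<in>K. \<bar>f x\<bar> \<le> a" "\<forall>x\<in>K. \<bar>g x\<bar> \<le> b"
      by (auto simp: bounded_iff)
    define m where "m = max (max a b) 0 + 1"
    have m: "1 \<le> m" "\<And>x. x \<in> K \<Longrightarrow> \<bar>f x\<bar> \<le> m" "\<And>x. x \<in> K \<Longrightarrow> \<bar>g x\<bar> \<le> m"
      using ab by (force simp: m_def)+
    define d where "d = min 1 (e / (4 * m))"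
    have d: "0 < d" "d \<le> 1" "d * (4 * m) \<le> e"
    proof -
      show "0 < d" "d \<le> 1" using e m by (auto simp: d_def)
      have "d \<le> e / (4 * m)" by (simp add: d_def)
      then show "d * (4 * m) \<le> e" using m by (simp add: field_simps)
    qed
    obtain q r where qr: "ratpoly q" "\<forall>x\<in>K. \<bar>f x - q x\<bar> < d" "ratpoly r" "\<forall>x\<in>K. \<bar>g x - r x\<bar> < d"
      using fg d(1) unfolding P_def by metis
    have "\<bar>f x * g x - q x * r x\<bar> < e" if x: "x \<in> K" for x
    proof -
      have "f x * g x - q x * r x = f x * (g x - r x) + r x * (f x - q x)" by (simp add: algebra_simps)
      then have "\<bar>f x * g x - q x * r x\<bar> \<le> \<bar>f x\<bar> * \<bar>g x - r x\<bar> + \<bar>r x\<bar> * \<bar>f x - q x\<bar>"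
        by (metis abs_mult abs_triangle_ineq)
      also have "\<bar>f x\<bar> * \<bar>g x - r x\<bar> \<le> m * d"
        using m(2)[OF x] qr(4) x m(1) by (intro mult_mono) auto
      also have "\<bar>r x\<bar> * \<bar>f x - q x\<bar> \<le> (m + 1) * d"
      proof (intro mult_mono)
        have "\<bar>g x - r x\<bar> < d" "\<bar>g x\<bar> \<le> m" using qr(4) x m(3) by auto
        then show "\<bar>r x\<bar> \<le> m + 1" using d(2) by linarith
        show "\<bar>f x - q x\<bar> \<le> d" using qr(2) x by (simp add: less_imp_le)
      qed (use m in auto)
      finally have *: "\<bar>f x * g x - q x * r x\<bar> \<le> m * d + (m + 1) * d" by simp
      have "m * d + (m + 1) * d \<le> d * (3 * m)" using m(1) d(1) by (simp add: algebra_simps)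
      also have "\<dots> < d * (4 * m)" using m(1) d(1) by simp
      finally show ?thesis using * d(3) by linarith
    qed
    then show "\<exists>q. ratpoly q \<and> (\<forall>x\<in>K. \<bar>f x * g x - q x\<bar> < e)"
      by (intro exI[of _ "\<lambda>x. q x * r x"] conjI ratpoly.mult[OF qr(1,3)]) auto
  qed
  have "P f" using f
  proof (induction rule: real_polynomial_function.induct)
    case (linear f)
    have "P (\<lambda>x. \<Sum>b\<in>B. (x \<bullet> b) * f b)" if "finite B" "B \<subseteq> Basis" for B
      using that by (induction B rule: finite_induct) (auto intro!: P_add P_mult P_const P_coord)
    from this[of Basis] have "P (\<lambda>x. \<Sum>b\<in>Basis. (x \<bullet> b) * f b)" by simp
    moreover have "(\<lambda>x. \<Sum>b\<in>Basis. (x \<bullet> b) * f b) = f"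
    proof
      fix x
      have "f x = f (\<Sum>b\<in>Basis. (x \<bullet> b) *\<^sub>R b)" by (simp add: euclidean_representation)
      also have "\<dots> = (\<Sum>b\<in>Basis. (x \<bullet> b) * f b)"
        using bounded_linear.linear[OF linear] by (simp add: linear_sum linear_cmul)
      finally show "(\<Sum>b\<in>Basis. (x \<bullet> b) * f b) = f x" ..
    qed
    ultimately show ?case by simp
  qed (auto intro: P_add P_mult P_const)
  then obtain q where "ratpoly q" "\<forall>x\<in>K. \<bar>f x - q x\<bar> < e" using e unfolding P_def by blast
  then show ?thesis using that by blast
qed

lemma ratpoly_dense_L1:
  fixes f :: "'a::euclidean_space \<Rightarrow> real"
  assumes f: "integrable lborel f" and S: "bounded S" "S \<in> sets borel" and e: "0 < e"
  obtains q where "ratpoly q" "(LINT x|lborel. indicator S x * \<bar>f x - q x\<bar>) < e"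
proof -
  have e2: "0 < e / 2" using e by simp
  obtain c K where c: "continuous_on UNIV c" "(LINT x|lborel. \<bar>f x - c x\<bar>) < e / 2"
    "compact K" "\<And>x. x \<notin> K \<Longrightarrow> c x = 0"
    using continuous_compactly_supported_dense_L1[OF f e2] by metis
  have intc: "integrable lborel c" by (rule continuous_compactly_supported_integrable[OF c(1,3,4)])
  define A where "A = measure lborel S"
  have A: "0 \<le> A" by (simp add: A_def)
  have intS: "integrable lborel (indicat_real S)"
    using S emeasure_bounded_finite[OF S(1)]
    by (intro integrable_real_indicator) (auto simp: top.not_eq_extremum)
  have K': "compact (closure S)" using S by simp
  define d where "d = e / 4 / (A + 1)"
  have d: "0 < d" using e A by (simp add: d_def)
  obtain r where r: "real_polynomial_function r" "\<And>x. x \<in> closure S \<Longrightarrow> \<bar>c x - r x\<bar> < d"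
    using Stone_Weierstrass_real_polynomial_function[OF K' continuous_on_subset[OF c(1)] d] by blast
  obtain q where q: "ratpoly q" "\<And>x. x \<in> closure S \<Longrightarrow> \<bar>r x - q x\<bar> < d"
    using ratpoly_uniformly_dense[OF K' r(1) d] by blast
  have [measurable]: "q \<in> borel_measurable borel"
    by (intro borel_measurable_continuous_onI continuous_at_imp_continuous_on ballI
        continuous_real_polymonial_function ratpoly_imp_real_polynomial_function q(1))
  have [measurable]: "f \<in> borel_measurable borel" using borel_measurable_integrable[OF f] by simp
  note [measurable] = S(2)
  have ptw: "indicator S x * \<bar>f x - q x\<bar> \<le> \<bar>f x - c x\<bar> + 2 * d * indicator S x" for x
  proof (cases "x \<in> S")
    case True
    then have "x \<in> closure S" using closure_subset by blast
    from r(2)[OF this] q(2)[OF this] True show ?thesis by simp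
  qed simp
  have int: "integrable lborel (\<lambda>x. \<bar>f x - c x\<bar> + 2 * d * indicator S x)" using f intc intS by auto
  have "(LINT x|lborel. indicator S x * \<bar>f x - q x\<bar>) \<le> (LINT x|lborel. \<bar>f x - c x\<bar> + 2 * d * indicator S x)"
    by (rule integral_mono'[OF int ptw]) (use d in \<open>simp add: add_nonneg_nonneg\<close>)
  also have "\<dots> = (LINT x|lborel. \<bar>f x - c x\<bar>) + 2 * d * A"
    using f intc intS by (simp add: A_def)
  also have "2 * d * A \<le> e / 2" using e A by (simp add: d_def field_simps)
  finally show ?thesis using c(2) q(1) that by fastforce
qed


section \<open>Test functions\<close>

text \<open>The functions \<open>exp (- 1 / s) / s ^ m\<close>, extended by zero to \<open>s \<le> 0\<close>, are closed under
  differentiation up to linear combinations.\<close>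

definition flat_exp :: "nat \<Rightarrow> real \<Rightarrow> real" where
  "flat_exp m s = (if 0 < s then exp (- 1 / s) / s ^ m else 0)"

lemma flat_exp_tendsto_0: "(flat_exp m \<longlongrightarrow> 0) (at 0)"
proof (rule filterlim_split_at_real[OF _ _])
  show "(flat_exp m \<longlongrightarrow> 0) (at_left 0)"
  proof (rule tendsto_eventually)
    show "\<forall>\<^sub>F s in at_left 0. flat_exp m s = 0"
      by (auto simp: eventually_at_left_field flat_exp_def intro!: exI[of _ "-1"])
  qed
  have "((\<lambda>s. inverse s ^ m / exp (inverse s)) \<longlongrightarrow> 0) (at_right (0::real))"
    by (rule filterlim_compose[OF tendsto_power_div_exp_0 filterlim_inverse_at_top_right])
  moreover have "\<forall>\<^sub>F s in at_right 0. inverse s ^ m / exp (inverse s) = flat_exp m s"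
    unfolding eventually_at_right_field
    by (intro exI[of _ 1]) (auto simp: flat_exp_def exp_minus field_simps)
  ultimately show "(flat_exp m \<longlongrightarrow> 0) (at_right 0)"
    by (rule Lim_transform_eventually)
qed

lemma flat_exp_has_derivative:
  "(flat_exp m has_real_derivative flat_exp (m + 2) s - real m * flat_exp (m + 1) s) (at s)"
proof -
  consider "0 < s" | "s < 0" | "s = 0" by linarith
  then show ?thesis
  proof cases
    case 1
    have "((\<lambda>s. exp (- 1 / s) / s ^ m) has_real_derivative
        (exp (- 1 / s) * (1 / s\<^sup>2) * s ^ m - exp (- 1 / s) * (real m * s ^ (m - 1))) / (s ^ m * s ^ m)) (at s)"
      using 1 by (auto intro!: derivative_eq_intros simp: power2_eq_square field_simps)
    moreover have "(exp (- 1 / s) * (1 / s\<^sup>2) * s ^ m - exp (- 1 / s) * (real m * s ^ (m - 1))) / (s ^ m * s ^ m)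
        = flat_exp (m + 2) s - real m * flat_exp (m + 1) s"
      using 1 by (cases m) (auto simp: flat_exp_def power2_eq_square field_simps)
    ultimately have "((\<lambda>s. exp (- 1 / s) / s ^ m) has_real_derivative
        flat_exp (m + 2) s - real m * flat_exp (m + 1) s) (at s)" by simp
    then show ?thesis
    proof (rule has_field_derivative_transform_within_open)
      show "open {0::real<..}" by simp
    qed (use 1 in \<open>auto simp: flat_exp_def\<close>)
  next
    case 2
    have "((\<lambda>s. 0) has_real_derivative 0) (at s)" by simp
    then have "(flat_exp m has_real_derivative 0) (at s)"
    proof (rule has_field_derivative_transform_within_open)
      show "open {..<0::real}" by simp
    qed (use 2 in \<open>auto simp: flat_exp_def\<close>)
    then show ?thesis using 2 by (simp add: flat_exp_def)
  next
    case 3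
    have "((\<lambda>h. (flat_exp m (0 + h) - flat_exp m 0) / h) \<longlongrightarrow> 0) (at 0)"
    proof (rule Lim_transform_eventually[OF flat_exp_tendsto_0[of "m + 1"]])
      show "\<forall>\<^sub>F h in at 0. flat_exp (m + 1) h = (flat_exp m (0 + h) - flat_exp m 0) / h"
        by (rule always_eventually) (auto simp: flat_exp_def)
    qed
    then show ?thesis using 3 by (simp add: DERIV_def flat_exp_def)
  qed
qed

text \<open>All members are smooth because they are differentiable and their partial derivatives are members
  again.\<close>

inductive smooth_gen :: "('a::euclidean_space \<Rightarrow> real) \<Rightarrow> bool" where
  poly: "real_polynomial_function f \<Longrightarrow> smooth_gen f"
| flat: "real_polynomial_function f \<Longrightarrow> smooth_gen (\<lambda>x. flat_exp m (f x))"
| add: "smooth_gen f \<Longrightarrow> smooth_gen g \<Longrightarrow> smooth_gen (\<lambda>x. f x + g x)"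
| mult: "smooth_gen f \<Longrightarrow> smooth_gen g \<Longrightarrow> smooth_gen (\<lambda>x. f x * g x)"

lemma real_polynomial_function_partial:
  assumes "real_polynomial_function f"
  shows "real_polynomial_function (\<lambda>x. frechet_derivative f (at x) v)"
  using assms
proof (induction rule: real_polynomial_function.induct)
  case (linear f)
  have "frechet_derivative f (at x) = f" for x
    using bounded_linear_imp_has_derivative[OF linear] by (rule frechet_derivative_at[symmetric])
  then show ?case by (simp add: real_polynomial_function.intros(2))
next
  case (const c)
  then show ?case by (simp add: frechet_derivative_const real_polynomial_function.intros(2))
next
  case (add f g)
  have "frechet_derivative (\<lambda>x. f x + g x) (at x) v
     = frechet_derivative f (at x) v + frechet_derivative g (at x) v" for x
  proof -
    have "(f has_derivative frechet_derivative f (at x)) (at x)"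
      "(g has_derivative frechet_derivative g (at x)) (at x)"
      using add differentiable_at_real_polynomial_function[of _ x UNIV] by (auto simp: frechet_derivative_works)
    from frechet_derivative_at[OF has_derivative_add[OF this]] show ?thesis by metis
  qed
  then show ?case using add by (simp add: real_polynomial_function.intros(3))
next
  case (mult f g)
  have "frechet_derivative (\<lambda>x. f x * g x) (at x) v
     = f x * frechet_derivative g (at x) v + frechet_derivative f (at x) v * g x" for x
  proof -
    have "(f has_derivative frechet_derivative f (at x)) (at x)"
      "(g has_derivative frechet_derivative g (at x)) (at x)"
      using mult differentiable_at_real_polynomial_function[of _ x UNIV] by (auto simp: frechet_derivative_works)
    from frechet_derivative_at[OF has_derivative_mult[OF this]] show ?thesis by metis
  qed
  then show ?case
    using mult by (simp add: real_polynomial_function.intros(3) real_polynomial_function.intros(4))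
qed

lemma smooth_gen_differentiable:
  assumes "smooth_gen f"
  shows "f differentiable (at x)" and "smooth_gen (\<lambda>x. frechet_derivative f (at x) v)"
proof -
  have "(\<forall>x. f differentiable (at x)) \<and> smooth_gen (\<lambda>x. frechet_derivative f (at x) v)"
    using assms
  proof (induction rule: smooth_gen.induct)
    case (poly f)
    then show ?case
      using differentiable_at_real_polynomial_function real_polynomial_function_partial smooth_gen.poly
      by blast
  next
    case (flat f m)
    have D: "((\<lambda>x. flat_exp m (f x)) has_derivative
        (\<lambda>h. (flat_exp (m + 2) (f x) - real m * flat_exp (m + 1) (f x)) * frechet_derivative f (at x) h)) (at x)" for x
    proof -
      have "(f has_derivative frechet_derivative f (at x)) (at x)"
        using flat differentiable_at_real_polynomial_function[of _ x UNIV] by (auto simp: frechet_derivative_works)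
      from has_derivative_compose[OF this flat_exp_has_derivative[unfolded has_field_derivative_def]]
      show ?thesis by simp
    qed
    have "(\<lambda>x. frechet_derivative (\<lambda>x. flat_exp m (f x)) (at x) v)
      = (\<lambda>x. (flat_exp (m + 2) (f x) + (- real m) * flat_exp (m + 1) (f x)) * frechet_derivative f (at x) v)"
      by (simp add: frechet_derivative_at[OF D, symmetric])
    moreover have "smooth_gen \<dots>"
      by (intro smooth_gen.mult smooth_gen.add smooth_gen.flat flat smooth_gen.poly
          real_polynomial_function_partial real_polynomial_function.intros(2))
    ultimately show ?case using differentiableI[OF D] by simp
  next
    case (add f g)
    then have D: "((\<lambda>x. f x + g x) has_derivative (\<lambda>h. frechet_derivative f (at x) h + frechet_derivative g (at x) h)) (at x)" for x
      by (intro has_derivative_add) (auto simp: frechet_derivative_works)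
    have "(\<lambda>x. frechet_derivative (\<lambda>x. f x + g x) (at x) v)
       = (\<lambda>x. frechet_derivative f (at x) v + frechet_derivative g (at x) v)"
      by (simp add: frechet_derivative_at[OF D, symmetric])
    moreover have "smooth_gen \<dots>" using add by (intro smooth_gen.add) auto
    ultimately show ?case using differentiableI[OF D] by simp
  next
    case (mult f g)
    then have D: "((\<lambda>x. f x * g x) has_derivative (\<lambda>h. f x * frechet_derivative g (at x) h + frechet_derivative f (at x) h * g x)) (at x)" for x
      by (intro has_derivative_mult) (auto simp: frechet_derivative_works)
    have "(\<lambda>x. frechet_derivative (\<lambda>x. f x * g x) (at x) v)
       = (\<lambda>x. f x * frechet_derivative g (at x) v + frechet_derivative f (at x) v * g x)"
      by (simp add: frechet_derivative_at[OF D, symmetric])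
    moreover have "smooth_gen \<dots>" using mult by (intro smooth_gen.add smooth_gen.mult) auto
    ultimately show ?case using differentiableI[OF D] by simp
  qed
  then show "f differentiable (at x)" and "smooth_gen (\<lambda>x. frechet_derivative f (at x) v)" by auto
qed

lemma smooth_gen_C_k: "smooth_gen f \<Longrightarrow> C_k k f"
proof (induction k arbitrary: f)
  case 0
  then show ?case
    by (simp add: continuous_at_imp_continuous_on differentiable_imp_continuous_within smooth_gen_differentiable(1))
next
  case (Suc k)
  show ?case
    unfolding C_k.simps
    by (intro conjI allI ballI Suc.IH smooth_gen_differentiable Suc.prems)
qed

lemma smooth_gen_prod:
  assumes "finite I" "\<And>i. i \<in> I \<Longrightarrow> smooth_gen (f i)"
  shows "smooth_gen (\<lambda>x. \<Prod>i\<in>I. f i x)"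
  using assms
  by (induction I rule: finite_induct)
     (auto intro: smooth_gen.mult smooth_gen.poly real_polynomial_function.intros(2))

text \<open>Supported in a box, and increasing to its indicator as \<open>n\<close> grows.\<close>

definition box_bump :: "'a::euclidean_space \<Rightarrow> 'a \<Rightarrow> nat \<Rightarrow> 'a \<Rightarrow> real" where
  "box_bump a b n x = (\<Prod>i\<in>Basis. flat_exp 0 (n * (x \<bullet> i - a \<bullet> i)) * flat_exp 0 (n * (b \<bullet> i - x \<bullet> i)))"

lemma flat_exp_0_range: "0 \<le> flat_exp 0 s" "flat_exp 0 s \<le> 1"
  by (auto simp: flat_exp_def)

lemma box_bump_range: "0 \<le> box_bump a b n x" "box_bump a b n x \<le> 1"
  unfolding box_bump_def
  by (auto intro!: prod_nonneg prod_le_1 mult_nonneg_nonneg mult_le_one flat_exp_0_range)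

lemma box_bump_eq_0:
  assumes "x \<notin> box a b"
  shows "box_bump a b n x = 0"
proof -
  obtain i where i: "i \<in> Basis" "x \<bullet> i \<le> a \<bullet> i \<or> b \<bullet> i \<le> x \<bullet> i"
    using assms by (auto simp: mem_box not_less)
  then have "flat_exp 0 (n * (x \<bullet> i - a \<bullet> i)) * flat_exp 0 (n * (b \<bullet> i - x \<bullet> i)) = 0"
    by (auto simp: flat_exp_def zero_less_mult_iff)
  with i(1) show ?thesis unfolding box_bump_def by (intro prod_zero) auto
qed

lemma box_bump_tendsto: "(\<lambda>n. box_bump a b n x) \<longlonglongrightarrow> indicator (box a b) x"
proof (cases "x \<in> box a b")
  case True
  have *: "(\<lambda>n. flat_exp 0 (real n * t)) \<longlonglongrightarrow> 1" if t: "0 < t" for t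
  proof -
    have "(\<lambda>n. exp (- (1 / t) * (1 / real n))) \<longlonglongrightarrow> exp (- (1 / t) * 0)"
      by (intro tendsto_intros lim_1_over_n)
    moreover have "\<forall>\<^sub>F n in sequentially. exp (- (1 / t) * (1 / real n)) = flat_exp 0 (real n * t)"
      using eventually_gt_at_top[of 0]
      by eventually_elim (use t in \<open>auto simp: flat_exp_def\<close>)
    ultimately show ?thesis by (simp add: Lim_transform_eventually)
  qed
  have "(\<lambda>n. box_bump a b n x) \<longlonglongrightarrow> (\<Prod>i\<in>(Basis::'a set). 1 * 1)"
    unfolding box_bump_def using True
    by (intro tendsto_prod tendsto_mult *) (auto simp: mem_box)
  then show ?thesis using True by simp
qed (simp add: box_bump_eq_0)

lemma smooth_gen_box_bump: "smooth_gen (box_bump a b n)"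
proof -
  have "real_polynomial_function (\<lambda>x::'a. real n * (x \<bullet> i - a \<bullet> i))"
    "real_polynomial_function (\<lambda>x::'a. real n * (b \<bullet> i - x \<bullet> i))" for i
    by (intro real_polynomial_function.intros(4) real_polynomial_function_diff real_polynomial_function.intros(2)
        real_polynomial_function.intros(1) bounded_linear_inner_left)+
  then show ?thesis
    unfolding box_bump_def[abs_def]
    by (intro smooth_gen_prod smooth_gen.mult smooth_gen.flat) auto
qed

text \<open>
  Testing against smooth functions bounded by one and supported in a box recovers the mean of the
  absolute value over the box, since such functions approximate the sign pointwise almost
  everywhere.  With \<open>c = 0\<close> this is the fundamental lemma of the calculus of variations.
\<close>

lemma L1_norm_le_of_test_functions:
  fixes w :: "'a::euclidean_space \<Rightarrow> real"
  assumes w: "integrable lborel w"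
    and test: "\<And>\<phi>. (\<And>k. C_k k \<phi>) \<Longrightarrow> (\<And>x. x \<notin> cbox a b \<Longrightarrow> \<phi> x = 0) \<Longrightarrow> (\<And>x. \<bar>\<phi> x\<bar> \<le> 1) \<Longrightarrow>
      (LINT x|lborel. w x * \<phi> x) \<le> c"
  shows "(LINT x|lborel. indicator (box a b) x * \<bar>w x\<bar>) \<le> c"
proof -
  have [measurable]: "w \<in> borel_measurable borel" using borel_measurable_integrable[OF w] by simp
  obtain s where s: "\<And>n. continuous_on UNIV (s n)" "AE x in lborel. (\<lambda>n. s n x) \<longlonglongrightarrow> sgn (w x)"
    using borel_measurable_AE_limit_of_continuous[of "\<lambda>x. sgn (w x)"] by auto
  define d where "d n x = max (- 1) (min 1 (s n x))" for n x
  have dcont: "continuous_on (cbox a b) (d n)" for n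
    unfolding d_def by (intro continuous_intros continuous_on_subset[OF s(1)]) auto
  have "\<exists>r. real_polynomial_function r \<and> (\<forall>x\<in>cbox a b. \<bar>d n x - r x\<bar> < 1 / Suc n)" for n
    using Stone_Weierstrass_real_polynomial_function[OF compact_cbox dcont, of "1 / Suc n"]
    by (metis of_nat_0_less_iff zero_less_Suc zero_less_divide_1_iff)
  then obtain r where r: "\<And>n. real_polynomial_function (r n)"
      "\<And>n x. x \<in> cbox a b \<Longrightarrow> \<bar>d n x - r n x\<bar> < 1 / Suc n"
    by metis
  \<comment> \<open>the polynomial exceeds one by at most \<open>1 / Suc n\<close>, hence the factor\<close>
  define \<phi> where "\<phi> n x = box_bump a b n x * (r n x * (1 / (1 + 1 / Suc n)))" for n x
  have smooth: "smooth_gen (\<phi> n)" for n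
    unfolding \<phi>_def[abs_def]
    by (intro smooth_gen.mult smooth_gen.poly r real_polynomial_function.intros(2) smooth_gen_box_bump)
  have supp: "\<phi> n x = 0" if "x \<notin> box a b" for n x
    using that by (simp add: \<phi>_def box_bump_eq_0)
  have bound: "\<bar>\<phi> n x\<bar> \<le> 1" for n x
  proof (cases "x \<in> box a b")
    case True
    then have x: "x \<in> cbox a b" using box_subset_cbox by blast
    have "\<bar>d n x\<bar> \<le> 1" by (auto simp: d_def)
    then have "\<bar>r n x\<bar> \<le> 1 + 1 / Suc n" using r(2)[OF x, of n] by linarith
    moreover have "0 < 1 + 1 / real (Suc n)" by (simp add: add_pos_nonneg)
    ultimately have "\<bar>r n x\<bar> / (1 + 1 / Suc n) \<le> 1" by (subst divide_le_eq_1_pos)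
    then have "\<bar>r n x * (1 / (1 + 1 / Suc n))\<bar> \<le> 1"
      using \<open>0 < 1 + 1 / real (Suc n)\<close> by (simp only: abs_mult abs_divide abs_one abs_of_pos) simp
    then show ?thesis
      unfolding \<phi>_def abs_mult[of "box_bump a b n x"]
      using box_bump_range[of a b n x] by (intro mult_le_one) auto
  qed (simp add: supp)
  have meas [measurable]: "\<phi> n \<in> borel_measurable borel" for n
    using smooth_gen_C_k[OF smooth, of 0 n] by (auto intro: borel_measurable_continuous_onI)
  have lim: "AE x in lborel. (\<lambda>n. w x * \<phi> n x) \<longlonglongrightarrow> indicator (box a b) x * \<bar>w x\<bar>"
    using s(2)
  proof eventually_elim
    case (elim x)
    show ?case
    proof (cases "x \<in> box a b")
      case True
      then have x: "x \<in> cbox a b" using box_subset_cbox by blast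
      have "(\<lambda>n. d n x) \<longlonglongrightarrow> max (- 1) (min 1 (sgn (w x)))"
        unfolding d_def by (intro tendsto_intros elim)
      moreover have "max (- 1) (min 1 (sgn (w x))) = sgn (w x)" by (auto simp: sgn_if)
      ultimately have dl: "(\<lambda>n. d n x) \<longlonglongrightarrow> sgn (w x)" by simp
      have "(\<lambda>n. d n x - r n x) \<longlonglongrightarrow> 0"
      proof (rule Lim_null_comparison)
        show "\<forall>\<^sub>F n in sequentially. norm (d n x - r n x) \<le> 1 / real (Suc n)"
          by (rule always_eventually) (use r(2)[OF x] in \<open>auto simp: less_imp_le\<close>)
        show "(\<lambda>n. 1 / real (Suc n)) \<longlonglongrightarrow> 0"
          using LIMSEQ_inverse_real_of_nat by (simp add: inverse_eq_divide)
      qed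
      from tendsto_diff[OF dl this] have rl: "(\<lambda>n. r n x) \<longlonglongrightarrow> sgn (w x)" by simp
      have il: "(\<lambda>n. 1 / real (Suc n)) \<longlonglongrightarrow> 0"
        using LIMSEQ_inverse_real_of_nat by (simp add: inverse_eq_divide)
      have "(\<lambda>n. w x * \<phi> n x) \<longlonglongrightarrow> w x * (indicator (box a b) x * (sgn (w x) * (1 / (1 + 0))))"
        unfolding \<phi>_def by (intro tendsto_intros rl box_bump_tendsto il) auto
      then show ?thesis using True by (simp add: abs_sgn)
    qed (simp add: supp)
  qed
  have "(\<lambda>n. LINT x|lborel. w x * \<phi> n x) \<longlonglongrightarrow> (LINT x|lborel. indicator (box a b) x * \<bar>w x\<bar>)"
  proof (rule integral_dominated_convergence[where w = "\<lambda>x. \<bar>w x\<bar>", OF _ _ _ lim])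
    show "AE x in lborel. norm (w x * \<phi> n x) \<le> \<bar>w x\<bar>" for n
      using bound by (intro AE_I2) (simp add: abs_mult mult_left_le)
  qed (use w in auto)
  moreover have "(LINT x|lborel. w x * \<phi> n x) \<le> c" for n
  proof (rule test)
    show "C_k k (\<phi> n)" for k by (rule smooth_gen_C_k[OF smooth])
    show "\<phi> n x = 0" if "x \<notin> cbox a b" for x
      using that box_subset_cbox[of a b] by (intro supp) auto
    show "\<bar>\<phi> n x\<bar> \<le> 1" for x by (rule bound)
  qed
  ultimately show ?thesis by (intro LIMSEQ_le_const2) auto
qed


section \<open>Weak gradients\<close>

lemma cbox_around_point:
  fixes x :: "'a::euclidean_space"
  assumes "0 < e"
  obtains a b where "x \<in> box a b" "cbox a b \<subseteq> cball x e"
proof -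
  obtain a b where ab: "x \<in> box a b" "box a b \<subseteq> ball x e"
    using rational_boxes[OF assms, of x] by blast
  have "cbox a b = closure (box a b)" using ab(1) by (intro closure_box[symmetric]) auto
  also have "\<dots> \<subseteq> cball x e" using ab(2) by (intro closure_minimal) auto
  finally show ?thesis using that ab(1) by blast
qed

lemma open_countable_boxes:
  fixes S :: "'a::euclidean_space set"
  assumes "open S"
  obtains C :: "('a \<times> 'a) set" where "countable C" "\<And>a b. (a, b) \<in> C \<Longrightarrow> cbox a b \<subseteq> S"
    "S = (\<Union>(a, b)\<in>C. box a b)"
proof -
  define F where "F = {box a b | a b. cbox a b \<subseteq> S}"
  have "\<Union>F = S"
  proof
    show "\<Union>F \<subseteq> S" using box_subset_cbox by (auto simp: F_def)
    show "S \<subseteq> \<Union>F"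
    proof
      fix x assume "x \<in> S"
      then obtain e where e: "0 < e" "cball x e \<subseteq> S" using assms open_contains_cball by blast
      obtain a b where "x \<in> box a b" "cbox a b \<subseteq> cball x e" using cbox_around_point[OF e(1)] .
      moreover from this have "box a b \<in> F" using e unfolding F_def by blast
      ultimately show "x \<in> \<Union>F" by blast
    qed
  qed
  moreover have "\<And>U. U \<in> F \<Longrightarrow> open U" by (auto simp: F_def)
  ultimately obtain F' where F': "F' \<subseteq> F" "countable F'" "\<Union>F' = S" using Lindelof[of F] by metis
  have "\<forall>U\<in>F'. \<exists>z. U = box (fst z) (snd z) \<and> cbox (fst z) (snd z) \<subseteq> S"
    using F'(1) by (fastforce simp: F_def)
  then obtain z where z: "\<And>U. U \<in> F' \<Longrightarrow> U = box (fst (z U)) (snd (z U)) \<and> cbox (fst (z U)) (snd (z U)) \<subseteq> S"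
    by metis
  show ?thesis
  proof (rule that)
    show "countable (z ` F')" using F'(2) by simp
    show "cbox a b \<subseteq> S" if "(a, b) \<in> z ` F'" for a b
      using that z by (metis (no_types, lifting) fst_conv image_iff snd_conv)
    have "(\<Union>(a, b)\<in>z ` F'. box a b) = (\<Union>U\<in>F'. box (fst (z U)) (snd (z U)))"
      by (simp add: case_prod_beta)
    also have "\<dots> = (\<Union>U\<in>F'. U)" by (intro SUP_cong refl) (use z in metis)
    finally show "S = (\<Union>(a, b)\<in>z ` F'. box a b)" using F'(3) by simp
  qed
qed

lemma test_function_partial:
  fixes \<phi> :: "'a::euclidean_space \<Rightarrow> real"
  assumes smooth: "\<And>k. C_k k \<phi>" and i: "i \<in> Basis"
  shows "continuous_on UNIV (\<lambda>x. frechet_derivative \<phi> (at x) i)"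
    and "(\<phi> has_derivative frechet_derivative \<phi> (at x)) (at x)"
    and "continuous_on UNIV \<phi>"
    and "closed K \<Longrightarrow> (\<And>x. x \<notin> K \<Longrightarrow> \<phi> x = 0) \<Longrightarrow> x \<notin> K \<Longrightarrow> frechet_derivative \<phi> (at x) i = 0"
proof -
  have C1: "C_k (Suc 0) \<phi>" by (rule smooth)
  show "continuous_on UNIV (\<lambda>x. frechet_derivative \<phi> (at x) i)" using C1 i by simp
  show "(\<phi> has_derivative frechet_derivative \<phi> (at x)) (at x)"
    using C1 by (simp add: frechet_derivative_works)
  show "continuous_on UNIV \<phi>" using smooth[of 0] by simp
  assume K: "closed K" "\<And>x. x \<notin> K \<Longrightarrow> \<phi> x = 0" "x \<notin> K"
  have "((\<lambda>x. 0) has_derivative (\<lambda>h. 0)) (at x)" by simp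
  then have "(\<phi> has_derivative (\<lambda>h. 0)) (at x)"
    by (rule has_derivative_transform_within_open[of _ _ _ _ "- K"]) (use K in auto)
  then show "frechet_derivative \<phi> (at x) i = 0" by (metis frechet_derivative_at)
qed

lemma continuous_compactly_supported_bounded:
  fixes c :: "'a::euclidean_space \<Rightarrow> real"
  assumes "continuous_on UNIV c" "compact K" "\<And>x. x \<notin> K \<Longrightarrow> c x = 0"
  obtains B where "0 \<le> B" "\<And>x. \<bar>c x\<bar> \<le> B"
proof -
  have "bounded (c ` K)"
    using assms by (intro compact_imp_bounded compact_continuous_image continuous_on_subset[OF assms(1)]) auto
  then obtain B where B: "\<forall>x\<in>K. \<bar>c x\<bar> \<le> B" by (auto simp: bounded_iff)
  have "\<bar>c x\<bar> \<le> max B 0" for x using B assms(3)[of x] by (cases "x \<in> K") force+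
  then show ?thesis using that[of "max B 0"] by simp
qed

lemma integrable_times_bounded:
  fixes f \<psi> :: "'a::euclidean_space \<Rightarrow> real"
  assumes f: "integrable lborel f" and \<psi>: "continuous_on UNIV \<psi>" "\<And>x. \<bar>\<psi> x\<bar> \<le> B"
  shows "integrable lborel (\<lambda>x. f x * \<psi> x)"
proof (rule Bochner_Integration.integrable_bound)
  have [measurable]: "f \<in> borel_measurable borel" using borel_measurable_integrable[OF f] by simp
  have [measurable]: "\<psi> \<in> borel_measurable borel" using \<psi>(1) by (rule borel_measurable_continuous_onI)
  show "(\<lambda>x. f x * \<psi> x) \<in> borel_measurable lborel" by simp
  show "integrable lborel (\<lambda>x. B * \<bar>f x\<bar>)" using f by simp
  show "AE x in lborel. norm (f x * \<psi> x) \<le> norm (B * \<bar>f x\<bar>)"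
  proof (rule AE_I2)
    fix x
    have "\<bar>f x\<bar> * \<bar>\<psi> x\<bar> \<le> \<bar>f x\<bar> * \<bar>B\<bar>"
      using \<psi>(2)[of x] by (intro mult_left_mono order_trans[OF \<psi>(2) abs_ge_self]) auto
    then show "norm (f x * \<psi> x) \<le> norm (B * \<bar>f x\<bar>)" by (simp add: abs_mult mult.commute)
  qed
qed

text \<open>Cutting the function and its gradient off to a compact set that carries the test function
  makes all integrands integrable on the whole space, where translations are available.\<close>

lemma has_weak_gradientD:
  fixes S :: "'a::euclidean_space set"
  assumes G: "has_weak_gradient S u G" and K: "compact K" "K \<subseteq> S"
  shows "integrable lborel (\<lambda>x. indicator K x * u x)"
    and "i \<in> Basis \<Longrightarrow> integrable lborel (\<lambda>x. indicator K x * (G x \<bullet> i))"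
    and "(\<And>k. C_k k \<phi>) \<Longrightarrow> (\<And>x. x \<notin> K \<Longrightarrow> \<phi> x = 0) \<Longrightarrow> i \<in> Basis \<Longrightarrow>
      (LINT x|lborel. (indicator K x * u x) * frechet_derivative \<phi> (at x) i)
        = - (LINT x|lborel. (indicator K x * (G x \<bullet> i)) * \<phi> x)"
proof -
  have si: "set_integrable lborel K u" "set_integrable lborel K G"
    using G K by (auto simp: has_weak_gradient_def)
  show "integrable lborel (\<lambda>x. indicator K x * u x)" using si(1) by (simp add: set_integrable_def)
  have "integrable lborel (\<lambda>x. (indicator K x *\<^sub>R G x) \<bullet> i)"
    using si(2) by (intro integrable_inner_left) (simp add: set_integrable_def)
  then show "integrable lborel (\<lambda>x. indicator K x * (G x \<bullet> i))" by simp
  assume \<phi>: "\<And>k. C_k k \<phi>" "\<And>x. x \<notin> K \<Longrightarrow> \<phi> x = 0" and i: "i \<in> Basis"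
  have "\<phi> \<in> test_functions S" using \<phi> K by (auto simp: test_functions_def)
  then have "(LINT x:S|lborel. u x * frechet_derivative \<phi> (at x) i) = - (LINT x:S|lborel. (G x \<bullet> i) * \<phi> x)"
    using G i by (simp add: has_weak_gradient_def)
  moreover have "(LINT x:S|lborel. u x * frechet_derivative \<phi> (at x) i)
     = (LINT x|lborel. (indicator K x * u x) * frechet_derivative \<phi> (at x) i)"
    unfolding set_lebesgue_integral_def
    using test_function_partial(4)[OF \<phi>(1) i compact_imp_closed[OF K(1)] \<phi>(2)] K(2)
    by (intro Bochner_Integration.integral_cong refl) (auto simp: indicator_def)
  moreover have "(LINT x:S|lborel. (G x \<bullet> i) * \<phi> x) = (LINT x|lborel. (indicator K x * (G x \<bullet> i)) * \<phi> x)"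
    unfolding set_lebesgue_integral_def
    using \<phi>(2) K(2) by (intro Bochner_Integration.integral_cong refl) (auto simp: indicator_def)
  ultimately show "(LINT x|lborel. (indicator K x * u x) * frechet_derivative \<phi> (at x) i)
        = - (LINT x|lborel. (indicator K x * (G x \<bullet> i)) * \<phi> x)" by simp
qed

lemma has_weak_gradientI:
  fixes S :: "'a::euclidean_space set"
  assumes "\<And>K. compact K \<Longrightarrow> K \<subseteq> S \<Longrightarrow> set_integrable lborel K u"
    and "\<And>K. compact K \<Longrightarrow> K \<subseteq> S \<Longrightarrow> set_integrable lborel K G"
    and "\<And>K \<phi> i. compact K \<Longrightarrow> K \<subseteq> S \<Longrightarrow> (\<And>k. C_k k \<phi>) \<Longrightarrow> (\<And>x. x \<notin> K \<Longrightarrow> \<phi> x = 0) \<Longrightarrow> i \<in> Basis \<Longrightarrow>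
      (LINT x|lborel. (indicator K x * u x) * frechet_derivative \<phi> (at x) i)
        = - (LINT x|lborel. (indicator K x * (G x \<bullet> i)) * \<phi> x)"
  shows "has_weak_gradient S u G"
  unfolding has_weak_gradient_def
proof (intro conjI allI impI ballI)
  fix \<phi> :: "'a \<Rightarrow> real" and i :: 'a assume "\<phi> \<in> test_functions S" and i: "i \<in> Basis"
  then obtain K where K: "compact K" "K \<subseteq> S" and \<phi>: "\<And>k. C_k k \<phi>" "\<And>x. x \<notin> K \<Longrightarrow> \<phi> x = 0"
    by (auto simp: test_functions_def)
  have "(LINT x:S|lborel. u x * frechet_derivative \<phi> (at x) i)
     = (LINT x|lborel. (indicator K x * u x) * frechet_derivative \<phi> (at x) i)"
    unfolding set_lebesgue_integral_def
    using test_function_partial(4)[OF \<phi>(1) i compact_imp_closed[OF K(1)] \<phi>(2)] K(2)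
    by (intro Bochner_Integration.integral_cong refl) (auto simp: indicator_def)
  moreover have "(LINT x:S|lborel. (G x \<bullet> i) * \<phi> x) = (LINT x|lborel. (indicator K x * (G x \<bullet> i)) * \<phi> x)"
    unfolding set_lebesgue_integral_def
    using \<phi>(2) K(2) by (intro Bochner_Integration.integral_cong refl) (auto simp: indicator_def)
  ultimately show "(LINT x:S|lborel. u x * frechet_derivative \<phi> (at x) i)
          = - (LINT x:S|lborel. (G x \<bullet> i) * \<phi> x)"
    using assms(3)[OF K \<phi> i] by simp
qed (use assms in auto)

lemma has_weak_gradient_lincomb:
  fixes S :: "'a::euclidean_space set"
  assumes G: "has_weak_gradient S u G" and H: "has_weak_gradient S v H"
  shows "has_weak_gradient S (\<lambda>x. a * u x + b * v x) (\<lambda>x. a *\<^sub>R G x + b *\<^sub>R H x)"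
proof (rule has_weak_gradientI)
  fix K assume K: "compact K" "K \<subseteq> S"
  then have *: "set_integrable lborel K u" "set_integrable lborel K G"
      "set_integrable lborel K v" "set_integrable lborel K H"
    using G H by (auto simp: has_weak_gradient_def)
  then show "set_integrable lborel K (\<lambda>x. a * u x + b * v x)"
    "set_integrable lborel K (\<lambda>x. a *\<^sub>R G x + b *\<^sub>R H x)"
    by (auto intro!: set_integral_add)
  fix \<phi> :: "'a \<Rightarrow> real" and i :: 'a
  assume \<phi>: "\<And>k. C_k k \<phi>" "\<And>x. x \<notin> K \<Longrightarrow> \<phi> x = 0" and i: "i \<in> Basis"
  let ?D = "\<lambda>x. frechet_derivative \<phi> (at x) i"
  obtain B where B: "\<And>x. \<bar>\<phi> x\<bar> \<le> B"
    using continuous_compactly_supported_bounded[OF test_function_partial(3)[OF \<phi>(1) i] K(1) \<phi>(2)] by blast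
  obtain B' where B': "\<And>x. \<bar>?D x\<bar> \<le> B'"
    using continuous_compactly_supported_bounded[OF test_function_partial(1)[OF \<phi>(1) i] K(1)
        test_function_partial(4)[OF \<phi>(1) i compact_imp_closed[OF K(1)] \<phi>(2)]] by blast
  note int = integrable_times_bounded[OF has_weak_gradientD(1)[OF G K] test_function_partial(1)[OF \<phi>(1) i] B']
    integrable_times_bounded[OF has_weak_gradientD(1)[OF H K] test_function_partial(1)[OF \<phi>(1) i] B']
    integrable_times_bounded[OF has_weak_gradientD(2)[OF G K i] test_function_partial(3)[OF \<phi>(1) i] B]
    integrable_times_bounded[OF has_weak_gradientD(2)[OF H K i] test_function_partial(3)[OF \<phi>(1) i] B]
  have "(LINT x|lborel. indicator K x * (a * u x + b * v x) * ?D x)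
     = (LINT x|lborel. a * (indicator K x * u x * ?D x) + b * (indicator K x * v x * ?D x))"
    by (simp add: algebra_simps)
  also have "\<dots> = a * (LINT x|lborel. indicator K x * u x * ?D x) + b * (LINT x|lborel. indicator K x * v x * ?D x)"
    using int by simp
  also have "\<dots> = - (a * (LINT x|lborel. indicator K x * (G x \<bullet> i) * \<phi> x) + b * (LINT x|lborel. indicator K x * (H x \<bullet> i) * \<phi> x))"
    using has_weak_gradientD(3)[OF G K \<phi> i] has_weak_gradientD(3)[OF H K \<phi> i] by simp
  also have "a * (LINT x|lborel. indicator K x * (G x \<bullet> i) * \<phi> x) + b * (LINT x|lborel. indicator K x * (H x \<bullet> i) * \<phi> x)
    = (LINT x|lborel. a * (indicator K x * (G x \<bullet> i) * \<phi> x) + b * (indicator K x * (H x \<bullet> i) * \<phi> x))"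
    using int by simp
  also have "\<dots> = (LINT x|lborel. indicator K x * ((a *\<^sub>R G x + b *\<^sub>R H x) \<bullet> i) * \<phi> x)"
    by (simp add: algebra_simps inner_add_left)
  finally show "(LINT x|lborel. indicator K x * (a * u x + b * v x) * ?D x)
    = - (LINT x|lborel. indicator K x * ((a *\<^sub>R G x + b *\<^sub>R H x) \<bullet> i) * \<phi> x)" .
qed

text \<open>Test functions and their derivatives are bounded, so both sides of the defining identity are
  continuous in mean.\<close>

lemma has_weak_gradient_L1_limit:
  fixes S :: "'a::euclidean_space set"
  assumes S: "S \<in> sets borel"
    and us: "\<And>n. has_weak_gradient S (us n) (Gs n)"
    and int: "\<And>n. set_integrable lborel S (us n)" "\<And>n. set_integrable lborel S (Gs n)"
      "set_integrable lborel S u" "set_integrable lborel S G"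
    and lim: "(\<lambda>n. LINT x:S|lborel. \<bar>us n x - u x\<bar>) \<longlonglongrightarrow> 0"
      "(\<lambda>n. LINT x:S|lborel. norm (Gs n x - G x)) \<longlonglongrightarrow> 0"
  shows "has_weak_gradient S u G"
proof (rule has_weak_gradientI)
  fix K assume K: "compact K" "K \<subseteq> S"
  then show "set_integrable lborel K u" "set_integrable lborel K G"
    using K S by (auto intro!: set_integrable_subset[OF int(3)] set_integrable_subset[OF int(4)] borel_compact)
  have K_meas [measurable]: "K \<in> sets borel" using K by (simp add: borel_compact)
  fix \<phi> :: "'a \<Rightarrow> real" and i :: 'a
  assume \<phi>: "\<And>k. C_k k \<phi>" "\<And>x. x \<notin> K \<Longrightarrow> \<phi> x = 0" and i: "i \<in> Basis"
  let ?D = "\<lambda>x. frechet_derivative \<phi> (at x) i"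
  have conv: "(\<lambda>n. LINT x|lborel. indicator K x * f n x * \<psi> x) \<longlonglongrightarrow> (LINT x|lborel. indicator K x * g x * \<psi> x)"
    if f: "\<And>n. set_integrable lborel S (f n)" and g: "set_integrable lborel S g"
      and fg: "(\<lambda>n. LINT x:S|lborel. \<bar>f n x - g x\<bar>) \<longlonglongrightarrow> 0"
      and \<psi>: "continuous_on UNIV \<psi>" "\<And>x. x \<notin> K \<Longrightarrow> \<psi> x = 0"
    for f :: "nat \<Rightarrow> 'a \<Rightarrow> real" and g \<psi> :: "'a \<Rightarrow> real"
  proof -
    obtain B where B: "0 \<le> B" "\<And>x. \<bar>\<psi> x\<bar> \<le> B"
      using continuous_compactly_supported_bounded[OF \<psi>(1) K(1) \<psi>(2)] by blast
    have iK: "integrable lborel (\<lambda>x. indicator K x * h x * \<psi> x)" if "set_integrable lborel S h" for h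
    proof -
      have "set_integrable lborel K h" using that K by (auto intro: set_integrable_subset)
      then show ?thesis
        by (intro integrable_times_bounded[OF _ \<psi>(1) B(2)]) (simp add: set_integrable_def)
    qed
    have fgi: "set_integrable lborel S (\<lambda>x. \<bar>f n x - g x\<bar>)" for n
      using f g by (intro set_integrable_abs set_integral_diff)
    have "\<bar>(LINT x|lborel. indicator K x * f n x * \<psi> x) - (LINT x|lborel. indicator K x * g x * \<psi> x)\<bar>
      \<le> B * (LINT x:S|lborel. \<bar>f n x - g x\<bar>)" for n
    proof -
      have "(LINT x|lborel. indicator K x * f n x * \<psi> x) - (LINT x|lborel. indicator K x * g x * \<psi> x)
        = (LINT x|lborel. indicator K x * f n x * \<psi> x - indicator K x * g x * \<psi> x)"
        using iK f g by simp
      also have "\<bar>\<dots>\<bar> \<le> (LINT x|lborel. B * (indicator S x *\<^sub>R \<bar>f n x - g x\<bar>))"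
      proof (rule integral_abs_bound_integral)
        show "integrable lborel (\<lambda>x. indicator K x * f n x * \<psi> x - indicator K x * g x * \<psi> x)"
          using iK f g by simp
        show "integrable lborel (\<lambda>x. B * (indicator S x *\<^sub>R \<bar>f n x - g x\<bar>))"
          using fgi by (simp add: set_integrable_def)
        show "\<bar>indicator K x * f n x * \<psi> x - indicator K x * g x * \<psi> x\<bar> \<le> B * (indicator S x *\<^sub>R \<bar>f n x - g x\<bar>)" for x
        proof (cases "x \<in> K")
          case True
          have "\<bar>f n x * \<psi> x - g x * \<psi> x\<bar> = \<bar>\<psi> x\<bar> * \<bar>f n x - g x\<bar>"
            by (simp add: abs_mult[symmetric] algebra_simps)
          also have "\<dots> \<le> B * \<bar>f n x - g x\<bar>" using B by (intro mult_right_mono) auto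
          finally show ?thesis using True K by auto
        qed (use B in simp)
      qed
      also have "\<dots> = B * (LINT x:S|lborel. \<bar>f n x - g x\<bar>)"
        by (simp add: set_lebesgue_integral_def)
      finally show ?thesis .
    qed
    then have "(\<lambda>n. (LINT x|lborel. indicator K x * f n x * \<psi> x) - (LINT x|lborel. indicator K x * g x * \<psi> x)) \<longlonglongrightarrow> 0"
      by (intro Lim_null_comparison[OF always_eventually tendsto_mult_right_zero[OF fg]]) auto
    then show ?thesis by (simp add: LIM_zero_iff)
  qed
  have 1: "(\<lambda>n. LINT x|lborel. indicator K x * us n x * ?D x) \<longlonglongrightarrow> (LINT x|lborel. indicator K x * u x * ?D x)"
    by (intro conv int lim test_function_partial(1)[OF \<phi>(1) i]
        test_function_partial(4)[OF \<phi>(1) i compact_imp_closed[OF K(1)] \<phi>(2)])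
  have inner_int: "set_integrable lborel S (\<lambda>x. H x \<bullet> i)" if "set_integrable lborel S H" for H :: "'a \<Rightarrow> 'a"
    using integrable_inner_left[of i lborel "\<lambda>x. indicator S x *\<^sub>R H x"] that
    by (simp add: set_integrable_def)
  have "(\<lambda>n. LINT x:S|lborel. \<bar>Gs n x \<bullet> i - G x \<bullet> i\<bar>) \<longlonglongrightarrow> 0"
  proof (rule Lim_null_comparison[OF always_eventually lim(2)], rule allI)
    fix n
    have "(LINT x:S|lborel. \<bar>Gs n x \<bullet> i - G x \<bullet> i\<bar>) \<le> (LINT x:S|lborel. norm (Gs n x - G x))"
    proof (rule set_integral_mono)
      show "set_integrable lborel S (\<lambda>x. \<bar>Gs n x \<bullet> i - G x \<bullet> i\<bar>)"
        by (intro set_integrable_abs set_integral_diff inner_int int)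
      show "set_integrable lborel S (\<lambda>x. norm (Gs n x - G x))"
        by (intro set_integrable_norm set_integral_diff int)
      show "\<bar>Gs n x \<bullet> i - G x \<bullet> i\<bar> \<le> norm (Gs n x - G x)" for x
        using Basis_le_norm[OF i, of "Gs n x - G x"] by (simp add: inner_diff_left)
    qed
    moreover have "0 \<le> (LINT x:S|lborel. \<bar>Gs n x \<bullet> i - G x \<bullet> i\<bar>)"
      by (simp add: set_lebesgue_integral_def)
    ultimately show "norm (LINT x:S|lborel. \<bar>Gs n x \<bullet> i - G x \<bullet> i\<bar>) \<le> (LINT x:S|lborel. norm (Gs n x - G x))"
      by simp
  qed
  then have 2: "(\<lambda>n. LINT x|lborel. indicator K x * (Gs n x \<bullet> i) * \<phi> x) \<longlonglongrightarrow> (LINT x|lborel. indicator K x * (G x \<bullet> i) * \<phi> x)"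
    by (intro conv inner_int int test_function_partial(3)[OF \<phi>(1) i] \<phi>(2))
  have "(\<lambda>n. LINT x|lborel. indicator K x * us n x * ?D x) \<longlonglongrightarrow> - (LINT x|lborel. indicator K x * (G x \<bullet> i) * \<phi> x)"
    using tendsto_minus[OF 2] has_weak_gradientD(3)[OF us K \<phi> i] by simp
  with 1 show "(LINT x|lborel. indicator K x * u x * ?D x) = - (LINT x|lborel. indicator K x * (G x \<bullet> i) * \<phi> x)"
    by (rule LIMSEQ_unique)
qed

text \<open>The difference of two gradients annihilates all test functions on each of countably many boxes.\<close>

lemma has_weak_gradient_unique:
  fixes S :: "'a::euclidean_space set"
  assumes S: "open S" and G: "has_weak_gradient S u G" and H: "has_weak_gradient S u H"
  shows "AE x in lborel. x \<in> S \<longrightarrow> G x = H x"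
proof -
  obtain C :: "('a \<times> 'a) set" where C: "countable C" "\<And>a b. (a, b) \<in> C \<Longrightarrow> cbox a b \<subseteq> S"
    "S = (\<Union>(a, b)\<in>C. box a b)" using open_countable_boxes[OF S] by blast
  have one: "AE x in lborel. x \<in> box a b \<longrightarrow> G x \<bullet> i = H x \<bullet> i" if ab: "cbox a b \<subseteq> S" and i: "i \<in> Basis" for a b i
  proof -
    let ?w = "\<lambda>x. indicator (cbox a b) x * (G x \<bullet> i) - indicator (cbox a b) x * (H x \<bullet> i)"
    note GH = has_weak_gradientD[OF G compact_cbox ab] has_weak_gradientD[OF H compact_cbox ab]
    have w: "integrable lborel ?w" using GH(2)[OF i] GH(5)[OF i] by simp
    have "(LINT x|lborel. indicator (box a b) x * \<bar>?w x\<bar>) \<le> 0"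
    proof (rule L1_norm_le_of_test_functions[OF w])
      fix \<phi> :: "'a \<Rightarrow> real"
      assume \<phi>: "\<And>k. C_k k \<phi>" "\<And>x. x \<notin> cbox a b \<Longrightarrow> \<phi> x = 0" "\<And>x. \<bar>\<phi> x\<bar> \<le> 1"
      note int = integrable_times_bounded[OF GH(2)[OF i] test_function_partial(3)[OF \<phi>(1) i] \<phi>(3)]
        integrable_times_bounded[OF GH(5)[OF i] test_function_partial(3)[OF \<phi>(1) i] \<phi>(3)]
      have "(LINT x|lborel. ?w x * \<phi> x) = (LINT x|lborel. indicator (cbox a b) x * (G x \<bullet> i) * \<phi> x)
          - (LINT x|lborel. indicator (cbox a b) x * (H x \<bullet> i) * \<phi> x)"
        using int by (simp add: left_diff_distrib)
      also have "\<dots> = 0" using GH(3)[OF \<phi>(1,2) i] GH(6)[OF \<phi>(1,2) i] by simp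
      finally show "(LINT x|lborel. ?w x * \<phi> x) \<le> 0" by simp
    qed
    moreover have int: "integrable lborel (\<lambda>x. indicator (box a b) x * \<bar>?w x\<bar>)"
      using integrable_mult_indicator[of "box a b" lborel "\<lambda>x. \<bar>?w x\<bar>"] w by simp
    moreover have "0 \<le> (LINT x|lborel. indicator (box a b) x * \<bar>?w x\<bar>)" by simp
    ultimately have "(LINT x|lborel. indicator (box a b) x * \<bar>?w x\<bar>) = 0" by linarith
    then have "AE x in lborel. indicator (box a b) x * \<bar>?w x\<bar> = 0"
      using integral_nonneg_eq_0_iff_AE[OF int] by simp
    then show ?thesis
    proof eventually_elim
      case (elim x)
      then show ?case using box_subset_cbox[of a b] by (auto simp: indicator_def split: if_splits)
    qed
  qed
  have "AE x in lborel. \<forall>z\<in>C. \<forall>i\<in>Basis. x \<in> box (fst z) (snd z) \<longrightarrow> G x \<bullet> i = H x \<bullet> i"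
    using C(1,2) by (intro AE_ball_countable[THEN iffD2] ballI one) (auto intro: countable_finite)
  then show ?thesis
  proof eventually_elim
    case (elim x)
    show ?case
    proof
      assume "x \<in> S"
      then have "x \<in> (\<Union>(a, b)\<in>C. box a b)" using C(3) by simp
      then obtain z where "z \<in> C" "x \<in> box (fst z) (snd z)" by auto
      with elim have "\<forall>i\<in>Basis. G x \<bullet> i = H x \<bullet> i" by blast
      then show "G x = H x" by (rule euclidean_eq_iff[THEN iffD2])
    qed
  qed
qed

text \<open>A weak gradient is integrable on compact subsets, and countably many of these cover an open set.\<close>

lemma has_weak_gradient_measurable:
  fixes S :: "'a::euclidean_space set"
  assumes S: "open S" and G: "has_weak_gradient S u G"
  shows "u \<in> borel_measurable (restrict_space lborel S)"
    and "G \<in> borel_measurable (restrict_space lborel S)"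
proof -
  obtain C :: "('a \<times> 'a) set" where C: "countable C" "\<And>a b. (a, b) \<in> C \<Longrightarrow> cbox a b \<subseteq> S"
    "S = (\<Union>(a, b)\<in>C. box a b)" using open_countable_boxes[OF S] by blast
  define D where "D = (\<lambda>(a, b). cbox a b) ` C"
  have cov: "S \<subseteq> \<Union>D"
  proof
    fix x assume "x \<in> S"
    then have "x \<in> (\<Union>(a, b)\<in>C. box a b)" using C(3) by simp
    then obtain a b where ab: "(a, b) \<in> C" "x \<in> box a b" by auto
    then have "cbox a b \<in> D" unfolding D_def by force
    then show "x \<in> \<Union>D" using ab(2) box_subset_cbox[of a b] by blast
  qed
  have meas: "f \<in> borel_measurable (restrict_space lborel S)"
    if f: "\<And>K. compact K \<Longrightarrow> K \<subseteq> S \<Longrightarrow> set_integrable lborel K f"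
    for f :: "'a \<Rightarrow> 'b::{banach, second_countable_topology}"
  proof (rule measurable_piecewise_restrict[of D])
    show "countable D" using C(1) by (simp add: D_def)
    show "\<Omega> \<inter> space (restrict_space lborel S) \<in> sets (restrict_space lborel S)" if "\<Omega> \<in> D" for \<Omega>
    proof -
      obtain a b where "\<Omega> = cbox a b" using \<open>\<Omega> \<in> D\<close> unfolding D_def by auto
      then have "\<Omega> \<in> sets lborel" by simp
      then have "S \<inter> \<Omega> \<in> sets (restrict_space lborel S)" unfolding sets_restrict_space by (rule imageI)
      then show ?thesis by (simp add: space_restrict_space Int_commute)
    qed
    show "space (restrict_space lborel S) \<subseteq> \<Union>D" using cov by (simp add: space_restrict_space)
    fix \<Omega> assume "\<Omega> \<in> D"
    then have \<Omega>: "compact \<Omega>" "\<Omega> \<subseteq> S" using C(2) by (auto simp: D_def)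
    have "f \<in> borel_measurable (restrict_space lborel \<Omega>)"
      using borel_measurable_integrable[OF f[OF \<Omega>, unfolded set_integrable_def]] \<Omega>
      by (subst borel_measurable_restrict_space_iff) (auto simp: borel_compact)
    moreover have "restrict_space (restrict_space lborel S) \<Omega> = restrict_space lborel \<Omega>"
      using S \<Omega> by (subst restrict_restrict_space) (auto simp: borel_compact Int_absorb1)
    ultimately show "f \<in> borel_measurable (restrict_space (restrict_space lborel S) \<Omega>)" by simp
  qed
  show "u \<in> borel_measurable (restrict_space lborel S)"
    and "G \<in> borel_measurable (restrict_space lborel S)"
    by (rule meas, use G in \<open>simp add: has_weak_gradient_def\<close>)+
qed

lemma has_weak_gradient_cong_AE:
  fixes S :: "'a::euclidean_space set"
  assumes S: "S \<in> sets borel" and G: "has_weak_gradient S u G"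
    and meas: "v \<in> borel_measurable (restrict_space lborel S)" "H \<in> borel_measurable (restrict_space lborel S)"
    and eq: "AE x in lborel. x \<in> S \<longrightarrow> u x = v x" "AE x in lborel. x \<in> S \<longrightarrow> G x = H x"
  shows "has_weak_gradient S v H"
proof (rule has_weak_gradientI)
  fix K assume K: "compact K" "K \<subseteq> S"
  have [measurable]: "K \<in> sets borel" using K by (simp add: borel_compact)
  have Km: "(\<lambda>x. indicator K x *\<^sub>R f x) \<in> borel_measurable lborel"
    if f: "f \<in> borel_measurable (restrict_space lborel S)" for f :: "'a \<Rightarrow> 'b::{banach, second_countable_topology}"
  proof -
    have "(\<lambda>x. indicator S x *\<^sub>R f x) \<in> borel_measurable lborel"
      using f S by (simp add: borel_measurable_restrict_space_iff)
    then have "(\<lambda>x. indicator K x *\<^sub>R (indicator S x *\<^sub>R f x)) \<in> borel_measurable lborel"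
      by (rule borel_measurable_scaleR[OF borel_measurable_indicator, rotated]) simp
    moreover have "(\<lambda>x. indicator K x *\<^sub>R (indicator S x *\<^sub>R f x)) = (\<lambda>x. indicator K x *\<^sub>R f x)"
      using K(2) by (intro ext) (auto simp: indicator_def)
    ultimately show ?thesis by simp
  qed
  have si: "integrable lborel (\<lambda>x. indicator K x *\<^sub>R u x)" "integrable lborel (\<lambda>x. indicator K x *\<^sub>R G x)"
    using G K by (auto simp: has_weak_gradient_def set_integrable_def)
  have aeK: "AE x in lborel. indicator K x *\<^sub>R u x = indicator K x *\<^sub>R v x"
    "AE x in lborel. indicator K x *\<^sub>R G x = indicator K x *\<^sub>R H x"
  proof -
    show "AE x in lborel. indicator K x *\<^sub>R u x = indicator K x *\<^sub>R v x"
      using eq(1) by eventually_elim (use K(2) in \<open>auto simp: indicator_def\<close>)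
    show "AE x in lborel. indicator K x *\<^sub>R G x = indicator K x *\<^sub>R H x"
      using eq(2) by eventually_elim (use K(2) in \<open>auto simp: indicator_def\<close>)
  qed
  show "set_integrable lborel K v" "set_integrable lborel K H"
    unfolding set_integrable_def
    using integrable_cong_AE_imp[OF si(1) Km[OF meas(1)]] integrable_cong_AE_imp[OF si(2) Km[OF meas(2)]] aeK
    by (auto elim!: eventually_mono)
  fix \<phi> :: "'a \<Rightarrow> real" and i :: 'a
  assume \<phi>: "\<And>k. C_k k \<phi>" "\<And>x. x \<notin> K \<Longrightarrow> \<phi> x = 0" and i: "i \<in> Basis"
  let ?D = "\<lambda>x. frechet_derivative \<phi> (at x) i"
  have [measurable]: "\<phi> \<in> borel_measurable borel" "?D \<in> borel_measurable borel"
    using test_function_partial(1,3)[OF \<phi>(1) i] by (auto intro: borel_measurable_continuous_onI)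
  note [measurable] = Km[OF meas(1), simplified] Km[OF meas(2)] si[THEN borel_measurable_integrable, simplified]
  have e1: "(LINT x|lborel. (indicator K x * u x) * ?D x) = (LINT x|lborel. (indicator K x * v x) * ?D x)"
  proof (rule integral_cong_AE)
    show "AE x in lborel. (indicator K x * u x) * ?D x = (indicator K x * v x) * ?D x"
      using aeK(1) by eventually_elim simp
  qed (use Km[OF meas(1)] si(1) in simp_all)
  have inner_eq: "indicator K x * (F x \<bullet> i) = (indicator K x *\<^sub>R F x) \<bullet> i" for F :: "'a \<Rightarrow> 'a" and x by simp
  have e2: "(LINT x|lborel. (indicator K x * (G x \<bullet> i)) * \<phi> x) = (LINT x|lborel. (indicator K x * (H x \<bullet> i)) * \<phi> x)"
    unfolding inner_eq
  proof (rule integral_cong_AE)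
    show "AE x in lborel. (indicator K x *\<^sub>R G x) \<bullet> i * \<phi> x = (indicator K x *\<^sub>R H x) \<bullet> i * \<phi> x"
      using aeK(2) by eventually_elim (simp only:)
    show "(\<lambda>x. (indicator K x *\<^sub>R G x) \<bullet> i * \<phi> x) \<in> borel_measurable lborel" 
      using si(2) by (intro borel_measurable_times borel_measurable_inner) auto
    show "(\<lambda>x. (indicator K x *\<^sub>R H x) \<bullet> i * \<phi> x) \<in> borel_measurable lborel"
      using Km[OF meas(2)] by (intro borel_measurable_times borel_measurable_inner) auto
  qed
  show "(LINT x|lborel. (indicator K x * v x) * ?D x) = - (LINT x|lborel. (indicator K x * (H x \<bullet> i)) * \<phi> x)"
    using has_weak_gradientD(3)[OF G K \<phi> i] e1 e2 by simp
qed


section \<open>Difference quotients and the chain rule\<close>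

lemma frechet_derivative_translate:
  fixes \<phi> :: "'a::euclidean_space \<Rightarrow> real"
  assumes "\<And>x. \<phi> differentiable (at x)"
  shows "((\<lambda>x. \<phi> (x - v)) has_derivative frechet_derivative \<phi> (at (x - v))) (at x)"
    and "frechet_derivative (\<lambda>x. \<phi> (x - v)) (at x) = frechet_derivative \<phi> (at (x - v))"
proof -
  have "((\<lambda>x. x - v) has_derivative (\<lambda>h. h)) (at x)"
    by (auto intro!: derivative_eq_intros)
  moreover have "(\<phi> has_derivative frechet_derivative \<phi> (at (x - v))) (at (x - v))"
    using assms by (simp add: frechet_derivative_works)
  ultimately show D: "((\<lambda>x. \<phi> (x - v)) has_derivative frechet_derivative \<phi> (at (x - v))) (at x)"
    by (rule has_derivative_compose)
  show "frechet_derivative (\<lambda>x. \<phi> (x - v)) (at x) = frechet_derivative \<phi> (at (x - v))"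
    by (rule frechet_derivative_at[OF D, symmetric])
qed

lemma C_k_translate:
  fixes \<phi> :: "'a::euclidean_space \<Rightarrow> real"
  shows "C_k k \<phi> \<Longrightarrow> C_k k (\<lambda>x. \<phi> (x - v))"
proof (induction k arbitrary: \<phi>)
  case 0
  then show ?case by (auto intro!: continuous_on_compose2[of UNIV \<phi>] continuous_intros)
next
  case (Suc k)
  then have d: "\<And>x. \<phi> differentiable (at x)" by simp
  have "(\<lambda>x. \<phi> (x - v)) differentiable (at x)" for x
    using frechet_derivative_translate(1)[OF d] differentiableI by blast
  moreover have "C_k k (\<lambda>x. frechet_derivative (\<lambda>x. \<phi> (x - v)) (at x) i)" if "i \<in> Basis" for i
    unfolding frechet_derivative_translate(2)[OF d]
    by (rule Suc.IH) (use Suc.prems that in simp)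
  ultimately show ?case by simp
qed

lemma integral_difference_quotient_tendsto:
  fixes f \<phi> :: "'a::euclidean_space \<Rightarrow> real"
  assumes f: "integrable lborel f"
    and \<phi>: "\<And>x. (\<phi> has_derivative \<phi>' x) (at x)"
    and cont: "continuous_on UNIV \<phi>" and B: "\<And>x. \<bar>\<phi>' x v\<bar> \<le> B"
  shows "((\<lambda>t. LINT x|lborel. f x * ((\<phi> (x + t *\<^sub>R v) - \<phi> x) / t)) \<longlongrightarrow> (LINT x|lborel. f x * \<phi>' x v)) (at 0)"
  unfolding tendsto_at_iff_sequentially
proof (intro allI impI)
  fix T :: "nat \<Rightarrow> real" assume "\<forall>n. T n \<in> UNIV - {0}" and T0: "T \<longlonglongrightarrow> 0"
  then have T: "T n \<noteq> 0" for n by simp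
  have [measurable]: "f \<in> borel_measurable borel" using borel_measurable_integrable[OF f] by simp
  have [measurable]: "\<phi> \<in> borel_measurable borel" using cont by (rule borel_measurable_continuous_onI)
  have line: "((\<lambda>s. \<phi> (x + s *\<^sub>R v)) has_real_derivative \<phi>' (x + s *\<^sub>R v) v) (at s)" for x s
  proof -
    have "((\<lambda>s. x + s *\<^sub>R v) has_derivative (\<lambda>h. h *\<^sub>R v)) (at s)"
      by (auto intro!: derivative_eq_intros)
    from has_derivative_compose[OF this \<phi>]
    have "((\<lambda>s. \<phi> (x + s *\<^sub>R v)) has_derivative (\<lambda>h. \<phi>' (x + s *\<^sub>R v) (h *\<^sub>R v))) (at s)" .
    moreover have "\<phi>' (x + s *\<^sub>R v) (h *\<^sub>R v) = \<phi>' (x + s *\<^sub>R v) v * h" for h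
      using linear_cmul[OF has_derivative_linear[OF \<phi>[of "x + s *\<^sub>R v"]], of h v] by simp
    ultimately show ?thesis by (simp add: has_field_derivative_def)
  qed
  have lim: "(\<lambda>n. (\<phi> (x + T n *\<^sub>R v) - \<phi> x) / T n) \<longlonglongrightarrow> \<phi>' x v" for x
  proof -
    have "((\<lambda>h. (\<phi> (x + (0 + h) *\<^sub>R v) - \<phi> (x + 0 *\<^sub>R v)) / h) \<longlongrightarrow> \<phi>' (x + 0 *\<^sub>R v) v) (at 0)"
      using line[of x 0] unfolding DERIV_def .
    then have "((\<lambda>h. (\<phi> (x + h *\<^sub>R v) - \<phi> x) / h) \<longlongrightarrow> \<phi>' x v) (at 0)" by simp
    then show ?thesis
      unfolding tendsto_at_iff_sequentially using T T0 by (auto simp: o_def)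
  qed
  have bd: "\<bar>(\<phi> (x + t *\<^sub>R v) - \<phi> x) / t\<bar> \<le> B" if "t \<noteq> 0" for x t
  proof -
    have "norm (\<phi> (x + t *\<^sub>R v) - \<phi> (x + 0 *\<^sub>R v)) \<le> B * norm (t - 0)"
      by (rule field_differentiable_bound[of UNIV "\<lambda>s. \<phi> (x + s *\<^sub>R v)" "\<lambda>s. \<phi>' (x + s *\<^sub>R v) v"])
         (auto intro: line B)
    then show ?thesis using that by (simp add: field_simps)
  qed
  have meas_D: "(\<lambda>x. \<phi>' x v) \<in> borel_measurable lborel"
  proof (rule borel_measurable_LIMSEQ_real)
    show "(\<lambda>x. (\<phi> (x + T n *\<^sub>R v) - \<phi> x) / T n) \<in> borel_measurable lborel" for n by measurable
    show "(\<lambda>n. (\<phi> (x + T n *\<^sub>R v) - \<phi> x) / T n) \<longlonglongrightarrow> \<phi>' x v" for x by (rule lim)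
  qed
  have "(\<lambda>n. LINT x|lborel. f x * ((\<phi> (x + T n *\<^sub>R v) - \<phi> x) / T n)) \<longlonglongrightarrow> (LINT x|lborel. f x * \<phi>' x v)"
  proof (rule integral_dominated_convergence[where w = "\<lambda>x. \<bar>B\<bar> * \<bar>f x\<bar>"])
    show "AE x in lborel. (\<lambda>n. f x * ((\<phi> (x + T n *\<^sub>R v) - \<phi> x) / T n)) \<longlonglongrightarrow> f x * \<phi>' x v"
      by (intro AE_I2 tendsto_intros lim)
    show "AE x in lborel. norm (f x * ((\<phi> (x + T n *\<^sub>R v) - \<phi> x) / T n)) \<le> \<bar>B\<bar> * \<bar>f x\<bar>" for n
    proof (rule AE_I2)
      fix x
      have "\<bar>f x\<bar> * \<bar>(\<phi> (x + T n *\<^sub>R v) - \<phi> x) / T n\<bar> \<le> \<bar>f x\<bar> * \<bar>B\<bar>"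
        by (intro mult_left_mono order_trans[OF bd[OF T] abs_ge_self]) simp
      then show "norm (f x * ((\<phi> (x + T n *\<^sub>R v) - \<phi> x) / T n)) \<le> \<bar>B\<bar> * \<bar>f x\<bar>"
        by (simp only: real_norm_def abs_mult mult.commute)
    qed
    show "integrable lborel (\<lambda>x. \<bar>B\<bar> * \<bar>f x\<bar>)" using f by simp
    show "(\<lambda>x. f x * \<phi>' x v) \<in> borel_measurable lborel"
      by (intro borel_measurable_times meas_D) simp
  qed measurable
  then show "((\<lambda>t. LINT x|lborel. f x * ((\<phi> (x + t *\<^sub>R v) - \<phi> x) / t)) \<circ> T) \<longlonglongrightarrow> (LINT x|lborel. f x * \<phi>' x v)"
    by (simp add: o_def)
qed

text \<open>The integral is the limit of integrals of difference quotients, and these vanish by translation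
  invariance.\<close>

lemma integral_directional_derivative_eq_0:
  fixes w :: "'a::euclidean_space \<Rightarrow> real"
  assumes K: "compact K" "\<And>x. x \<notin> K \<Longrightarrow> w x = 0"
    and w: "\<And>x. (w has_derivative w' x) (at x)" and cont: "continuous_on UNIV (\<lambda>x. w' x v)"
  shows "(LINT x|lborel. w' x v) = 0"
proof -
  \<comment> \<open>the set \<open>L\<close> carries all difference quotients with a step of at most one\<close>
  define r where "r = norm v + 1"
  have r: "0 < r" by (simp add: r_def add_nonneg_pos)
  define L where "L = {x + y | x y. x \<in> K \<and> y \<in> cball (0::'a) r}"
  have L: "compact L" unfolding L_def by (intro compact_sums K compact_cball)
  have KL: "x \<in> L" if "x + t *\<^sub>R v \<in> K" "\<bar>t\<bar> \<le> 1" for x t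
  proof -
    have "x = (x + t *\<^sub>R v) + - (t *\<^sub>R v)" by simp
    moreover have "norm (t *\<^sub>R v) \<le> 1 * norm v" 
    using mult_right_mono[OF that(2) norm_ge_zero[of v]] by simp
    ultimately show ?thesis using that unfolding L_def r_def
      by (intro CollectI exI[of _ "x + t *\<^sub>R v"] exI[of _ "- (t *\<^sub>R v)"]) auto
  qed
  have cw: "continuous_on UNIV w"
    using w by (intro continuous_at_imp_continuous_on ballI) (auto intro: has_derivative_continuous)
  have w'0: "w' x v = 0" if "x \<notin> K" for x
  proof -
    have "((\<lambda>x. 0) has_derivative (\<lambda>h. 0)) (at x)" by simp
    then have "(w has_derivative (\<lambda>h. 0)) (at x)"
      by (rule has_derivative_transform_within_open[of _ _ _ _ "- K"])
         (use K compact_imp_closed that in auto)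
    from has_derivative_unique[OF w this] show ?thesis by simp
  qed
  obtain B where B: "\<And>x. \<bar>w' x v\<bar> \<le> B"
    using continuous_compactly_supported_bounded[OF cont K(1) w'0] by blast
  have intL: "integrable lborel (indicat_real L)"
    using L emeasure_compact_finite[OF L]
    by (intro integrable_real_indicator) (auto intro: borel_compact simp: top.not_eq_extremum)
  have intw: "integrable lborel w" by (rule continuous_compactly_supported_integrable[OF cw K])
  have lim: "((\<lambda>t. LINT x|lborel. indicator L x * ((w (x + t *\<^sub>R v) - w x) / t)) \<longlongrightarrow> (LINT x|lborel. indicator L x * w' x v)) (at 0)"
    by (rule integral_difference_quotient_tendsto[OF intL w cw B])
  have zero: "\<forall>\<^sub>F t in at 0. (LINT x|lborel. indicator L x * ((w (x + t *\<^sub>R v) - w x) / t)) = 0"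
    unfolding eventually_at
  proof (intro exI[of _ 1] conjI ballI impI)
    fix t :: real assume t: "t \<noteq> 0 \<and> dist t 0 < 1"
    have "(LINT x|lborel. indicator L x * ((w (x + t *\<^sub>R v) - w x) / t)) = (LINT x|lborel. (w (x + t *\<^sub>R v) - w x) / t)"
    proof (intro Bochner_Integration.integral_cong refl)
      fix x
      show "indicator L x * ((w (x + t *\<^sub>R v) - w x) / t) = (w (x + t *\<^sub>R v) - w x) / t"
      proof (cases "x \<in> L")
        case False
        then have "x + t *\<^sub>R v \<notin> K" "x \<notin> K" using KL[of x t] KL[of x 0] t by auto
        then have "w (x + t *\<^sub>R v) = 0" "w x = 0" by (auto intro: K(2))
        then show ?thesis by simp
      qed simp
    qed
    also have "\<dots> = ((LINT x|lborel. w (x + t *\<^sub>R v)) - (LINT x|lborel. w x)) / t"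
      using intw by (simp add: lborel_translation(2)[of w "t *\<^sub>R v"])
    also have "\<dots> = 0" by (simp add: lborel_translation(1)[of w "t *\<^sub>R v"])
    finally show "(LINT x|lborel. indicator L x * ((w (x + t *\<^sub>R v) - w x) / t)) = 0" .
  qed simp
  have "(LINT x|lborel. indicator L x * w' x v) = 0"
    by (rule tendsto_unique[OF trivial_limit_at lim tendsto_eventually[OF zero]])
  moreover have "(LINT x|lborel. indicator L x * w' x v) = (LINT x|lborel. w' x v)"
  proof (intro Bochner_Integration.integral_cong refl)
    fix x show "indicator L x * w' x v = w' x v"
      using KL[of x 0] w'0[of x] by (cases "x \<in> L") auto
  qed
  ultimately show ?thesis by simp
qed

lemma C1_has_weak_gradient:
  fixes u :: "'a::euclidean_space \<Rightarrow> real"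
  assumes u: "\<And>x. (u has_derivative (\<lambda>h. D x \<bullet> h)) (at x)" and D: "continuous_on UNIV D"
  shows "has_weak_gradient S u D"
proof (rule has_weak_gradientI)
  have cu: "continuous_on UNIV u"
    using u by (intro continuous_at_imp_continuous_on ballI) (auto intro: has_derivative_continuous)
  fix K assume K: "compact K" "K \<subseteq> S"
  show "set_integrable lborel K u" "set_integrable lborel K D"
    unfolding set_integrable_def
    by (intro borel_integrable_compact K continuous_on_subset[OF cu] continuous_on_subset[OF D] subset_UNIV)+
  fix \<phi> :: "'a \<Rightarrow> real" and i :: 'a
  assume \<phi>: "\<And>k. C_k k \<phi>" "\<And>x. x \<notin> K \<Longrightarrow> \<phi> x = 0" and i: "i \<in> Basis"
  let ?d = "\<lambda>x. frechet_derivative \<phi> (at x) i"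
  have d0: "?d x = 0" if "x \<notin> K" for x
    by (rule test_function_partial(4)[OF \<phi>(1) i compact_imp_closed[OF K(1)] \<phi>(2) that])
  have cd: "continuous_on UNIV ?d" by (rule test_function_partial(1)[OF \<phi>(1) i])
  have c\<phi>: "continuous_on UNIV \<phi>" by (rule test_function_partial(3)[OF \<phi>(1) i])
  have "(LINT x|lborel. (\<lambda>h. u x * frechet_derivative \<phi> (at x) h + (D x \<bullet> h) * \<phi> x) i) = 0"
  proof (rule integral_directional_derivative_eq_0[OF K(1)])
    show "u x * \<phi> x = 0" if "x \<notin> K" for x using \<phi>(2)[OF that] by simp
    show "((\<lambda>x. u x * \<phi> x) has_derivative (\<lambda>h. u x * frechet_derivative \<phi> (at x) h + (D x \<bullet> h) * \<phi> x)) (at x)" for x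
      by (intro has_derivative_mult u test_function_partial(2)[OF \<phi>(1) i])
    show "continuous_on UNIV (\<lambda>x. (\<lambda>h. u x * frechet_derivative \<phi> (at x) h + (D x \<bullet> h) * \<phi> x) i)"
      by (intro continuous_intros cu cd c\<phi> D)
  qed
  moreover have "integrable lborel (\<lambda>x. u x * ?d x)"
    by (rule continuous_compactly_supported_integrable[OF _ K(1)])
       (use d0 cu cd in \<open>auto intro!: continuous_intros\<close>)
  moreover have "integrable lborel (\<lambda>x. (D x \<bullet> i) * \<phi> x)"
    by (rule continuous_compactly_supported_integrable[OF _ K(1)])
       (use \<phi>(2) D c\<phi> in \<open>auto intro!: continuous_intros\<close>)
  ultimately have "(LINT x|lborel. u x * ?d x) = - (LINT x|lborel. (D x \<bullet> i) * \<phi> x)" by simp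
  moreover have "(\<lambda>x. indicator K x * u x * ?d x) = (\<lambda>x. u x * ?d x)"
    using d0 by (intro ext) (auto simp: indicator_def)
  moreover have "(\<lambda>x. indicator K x * (D x \<bullet> i) * \<phi> x) = (\<lambda>x. (D x \<bullet> i) * \<phi> x)"
    using \<phi>(2) by (intro ext) (auto simp: indicator_def)
  ultimately show "(LINT x|lborel. indicator K x * u x * ?d x) = - (LINT x|lborel. indicator K x * (D x \<bullet> i) * \<phi> x)"
    by simp
qed

text \<open>
  Difference quotients of a weakly differentiable function converge locally in mean to the weak
  derivative.  Tested with \<open>\<phi>\<close>, the quotient is by the mean value theorem the weak derivative
  tested with a slightly translated \<open>\<phi>\<close>, so that the continuity of translations in mean applies.
\<close>

lemma difference_quotient_L1_box:
  fixes u :: "'a::euclidean_space \<Rightarrow> real"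
  assumes G: "has_weak_gradient S u G" and K: "compact K" "K \<subseteq> S" and r: "0 < r"
    and near: "\<And>x y. x \<in> cbox a b \<Longrightarrow> norm y \<le> r \<Longrightarrow> x + y \<in> K"
    and i: "i \<in> Basis" and e: "0 < e"
  defines "uK \<equiv> \<lambda>x. indicator K x * u x" and "GK \<equiv> \<lambda>x. indicator K x * (G x \<bullet> i)"
  obtains d where "0 < d" "\<And>t. 0 < t \<Longrightarrow> t < d \<Longrightarrow>
    (LINT x|lborel. indicator (box a b) x * \<bar>(uK (x + t *\<^sub>R i) - uK x) / t - GK x\<bar>) \<le> e"
proof -
  have intu: "integrable lborel uK" unfolding uK_def by (rule has_weak_gradientD(1)[OF G K])
  have intG: "integrable lborel GK" unfolding GK_def by (rule has_weak_gradientD(2)[OF G K i])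
  obtain d0 where d0: "0 < d0" "\<And>v. norm v < d0 \<Longrightarrow> (LINT x|lborel. \<bar>GK (x + v) - GK x\<bar>) < e"
    using L1_continuity_of_translation[OF intG e] by blast
  show ?thesis
  proof (rule that)
    show "0 < min r d0" using r d0 by simp
    fix t assume t: "0 < t" "t < min r d0"
    let ?w = "\<lambda>x. (uK (x + t *\<^sub>R i) - uK x) / t - GK x"
    have ut: "integrable lborel (\<lambda>x. uK (x + t *\<^sub>R i))" using intu by (simp add: lborel_translation(2)[of uK])
    have intw: "integrable lborel ?w" using intu ut intG by simp
    show "(LINT x|lborel. indicator (box a b) x * \<bar>?w x\<bar>) \<le> e"
    proof (rule L1_norm_le_of_test_functions[OF intw])
      fix \<phi> :: "'a \<Rightarrow> real"
      assume \<phi>: "\<And>k. C_k k \<phi>" "\<And>x. x \<notin> cbox a b \<Longrightarrow> \<phi> x = 0" "\<And>x. \<bar>\<phi> x\<bar> \<le> 1"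
      have c\<phi>: "continuous_on UNIV \<phi>" by (rule test_function_partial(3)[OF \<phi>(1) i])
      have dif: "\<phi> differentiable (at x)" for x
        using test_function_partial(2)[OF \<phi>(1) i] differentiableI by blast
      define \<psi> where "\<psi> s x = \<phi> (x - s *\<^sub>R i)" for s x
      have \<psi>_smooth: "C_k k (\<psi> s)" for k s
        unfolding \<psi>_def[abs_def] by (rule C_k_translate[OF \<phi>(1)])
      have \<psi>_cont: "continuous_on UNIV (\<psi> s)" for s by (rule test_function_partial(3)[OF \<psi>_smooth i])
      have \<psi>_le: "\<bar>\<psi> s x\<bar> \<le> 1" for s x by (simp add: \<psi>_def \<phi>(3))
      have \<psi>_supp: "\<psi> s x = 0" if "x \<notin> K" "0 \<le> s" "s \<le> t" for s x
      proof (rule ccontr)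
        assume "\<psi> s x \<noteq> 0"
        then have "x - s *\<^sub>R i \<in> cbox a b" using \<phi>(2) by (auto simp: \<psi>_def)
        moreover have "norm (s *\<^sub>R i) \<le> r" using that t i by simp
        ultimately have "x - s *\<^sub>R i + s *\<^sub>R i \<in> K" by (rule near)
        with that show False by simp
      qed
      have dcont: "continuous_on UNIV (\<lambda>x. frechet_derivative \<phi> (at x) i)"
        by (rule test_function_partial(1)[OF \<phi>(1) i])
      have d_supp: "frechet_derivative \<phi> (at x) i = 0" if "x \<notin> cbox a b" for x
        by (rule test_function_partial(4)[OF \<phi>(1) i closed_cbox \<phi>(2) that])
      obtain B where B: "\<And>x. \<bar>frechet_derivative \<phi> (at x) i\<bar> \<le> B"
        using continuous_compactly_supported_bounded[OF dcont compact_cbox d_supp] by blast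
      define m where "m s = (LINT x|lborel. uK x * \<psi> s x)" for s
      define m' where "m' s = (LINT x|lborel. GK x * \<psi> s x)" for s
      have int_prod: "integrable lborel (\<lambda>x. uK x * \<psi> s x)" "integrable lborel (\<lambda>x. GK x * \<psi> s x)" for s
        using integrable_times_bounded[OF intu \<psi>_cont \<psi>_le] integrable_times_bounded[OF intG \<psi>_cont \<psi>_le] by auto
      have der: "(m has_real_derivative m' s) (at s)" if s: "0 \<le> s" "s \<le> t" for s
      proof -
        have D: "(\<psi> s has_derivative frechet_derivative \<phi> (at (x - s *\<^sub>R i))) (at x)" for x
          unfolding \<psi>_def[abs_def] by (rule frechet_derivative_translate(1)[OF dif])
        have minus: "frechet_derivative \<phi> (at x) (- i) = - frechet_derivative \<phi> (at x) i" for x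
          using linear_neg[OF has_derivative_linear[OF test_function_partial(2)[OF \<phi>(1) i]]] .
        have "((\<lambda>h. LINT x|lborel. uK x * ((\<psi> s (x + h *\<^sub>R (- i)) - \<psi> s x) / h)) \<longlongrightarrow>
            (LINT x|lborel. uK x * frechet_derivative \<phi> (at (x - s *\<^sub>R i)) (- i))) (at 0)"
          by (rule integral_difference_quotient_tendsto[OF intu D \<psi>_cont, of _ B]) (simp add: minus B)
        moreover have "(LINT x|lborel. uK x * ((\<psi> s (x + h *\<^sub>R (- i)) - \<psi> s x) / h)) = (m (s + h) - m s) / h" for h
        proof -
          have eq: "\<psi> s (x + h *\<^sub>R (- i)) = \<psi> (s + h) x" for x
            by (simp add: \<psi>_def algebra_simps)
          have "(LINT x|lborel. uK x * ((\<psi> s (x + h *\<^sub>R (- i)) - \<psi> s x) / h))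
              = (LINT x|lborel. (uK x * \<psi> (s + h) x - uK x * \<psi> s x) / h)"
            unfolding eq by (simp add: right_diff_distrib)
          also have "\<dots> = (m (s + h) - m s) / h" using int_prod by (simp add: m_def)
          finally show ?thesis .
        qed
        moreover have "(LINT x|lborel. uK x * frechet_derivative \<phi> (at (x - s *\<^sub>R i)) (- i)) = m' s"
        proof -
          have "(LINT x|lborel. uK x * frechet_derivative \<phi> (at (x - s *\<^sub>R i)) (- i))
             = - (LINT x|lborel. uK x * frechet_derivative (\<psi> s) (at x) i)"
            unfolding minus \<psi>_def[abs_def] frechet_derivative_translate(2)[OF dif] by simp
          also have "\<dots> = m' s"
            using has_weak_gradientD(3)[OF G K \<psi>_smooth \<psi>_supp[OF _ s] i] by (simp add: uK_def GK_def m'_def)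
          finally show ?thesis .
        qed
        ultimately show ?thesis by (simp only: DERIV_def)
      qed
      obtain z where z: "0 < z" "z < t" "m t - m 0 = (t - 0) * m' z"
        using MVT2[OF t(1), of m m'] der by blast
      have shift: "(LINT x|lborel. f (x + s *\<^sub>R i) * \<phi> x) = (LINT x|lborel. f x * \<psi> s x)" for f :: "'a \<Rightarrow> real" and s
        using lborel_translation(1)[of "\<lambda>x. f x * \<psi> s x" "s *\<^sub>R i"] by (simp add: \<psi>_def)
      have \<phi>0: "\<phi> = \<psi> 0" by (simp add: \<psi>_def[abs_def])
      have int_sh: "integrable lborel (\<lambda>x. f (x + s *\<^sub>R i) * \<phi> x)" if "integrable lborel f" for f :: "'a \<Rightarrow> real" and s
        by (rule integrable_times_bounded[OF _ c\<phi> \<phi>(3)]) (use that in \<open>simp add: lborel_translation(2)[of f]\<close>)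
      have "(LINT x|lborel. ?w x * \<phi> x) = (LINT x|lborel. (uK (x + t *\<^sub>R i) * \<phi> x - uK x * \<phi> x) / t - GK x * \<phi> x)"
        by (intro Bochner_Integration.integral_cong refl) (simp add: field_simps)
      also have "\<dots> = ((LINT x|lborel. uK (x + t *\<^sub>R i) * \<phi> x) - (LINT x|lborel. uK x * \<phi> x)) / t - (LINT x|lborel. GK x * \<phi> x)"
        using int_sh[OF intu, of t] int_prod[of 0] by (simp add: \<phi>0[symmetric])
      also have "\<dots> = (m t - m 0) / t - m' 0"
        unfolding shift by (simp add: m_def m'_def \<phi>0[symmetric])
      also have "\<dots> = m' z - m' 0" using z t by simp
      also have "\<dots> = (LINT x|lborel. GK (x + z *\<^sub>R i) * \<phi> x) - (LINT x|lborel. GK x * \<phi> x)"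
        unfolding shift by (simp add: m'_def \<phi>0[symmetric])
      also have "\<dots> = (LINT x|lborel. (GK (x + z *\<^sub>R i) - GK x) * \<phi> x)"
        using int_sh[OF intG, of z] int_sh[OF intG, of 0] by (simp add: left_diff_distrib)
      also have "\<dots> \<le> (LINT x|lborel. \<bar>GK (x + z *\<^sub>R i) - GK x\<bar>)"
      proof (rule integral_mono)
        show "integrable lborel (\<lambda>x. (GK (x + z *\<^sub>R i) - GK x) * \<phi> x)"
          using int_sh[OF intG, of z] int_sh[OF intG, of 0] by (simp add: left_diff_distrib)
        show "integrable lborel (\<lambda>x. \<bar>GK (x + z *\<^sub>R i) - GK x\<bar>)"
          using intG by (simp add: lborel_translation(2)[of GK])
        show "(GK (x + z *\<^sub>R i) - GK x) * \<phi> x \<le> \<bar>GK (x + z *\<^sub>R i) - GK x\<bar>" for x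
        proof -
          have "\<bar>GK (x + z *\<^sub>R i) - GK x\<bar> * \<bar>\<phi> x\<bar> \<le> \<bar>GK (x + z *\<^sub>R i) - GK x\<bar> * 1"
            using \<phi>(3) by (intro mult_left_mono) auto
          then have "\<bar>(GK (x + z *\<^sub>R i) - GK x) * \<phi> x\<bar> \<le> \<bar>GK (x + z *\<^sub>R i) - GK x\<bar>"
            by (simp only: abs_mult mult_1_right)
          then show ?thesis by (rule order_trans[OF abs_ge_self])
        qed
      qed
      also have "\<dots> < e" using z t i by (intro d0(2)) simp
      finally show "(LINT x|lborel. ?w x * \<phi> x) \<le> e" by simp
    qed
  qed
qed

lemma difference_quotient_L1_compact:
  fixes u :: "'a::euclidean_space \<Rightarrow> real"
  assumes S: "open S" and G: "has_weak_gradient S u G" and K: "compact K" "K \<subseteq> S" and i: "i \<in> Basis"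
  obtains K' where "compact K'" "K' \<subseteq> S" "K \<subseteq> K'"
    "\<And>e. 0 < e \<Longrightarrow> \<exists>d>0. \<forall>t. 0 < t \<longrightarrow> t < d \<longrightarrow>
      (LINT x|lborel. indicator K x * \<bar>(indicator K' (x + t *\<^sub>R i) * u (x + t *\<^sub>R i) - indicator K' x * u x) / t
         - indicator K' x * (G x \<bullet> i)\<bar>) \<le> e"
proof -
  obtain e0 where e0: "0 < e0" "(\<Union>x\<in>K. ball x e0) \<subseteq> S"
    using compact_subset_open_imp_ball_epsilon_subset[OF K(1) S K(2)] .
  \<comment> \<open>room for a box of radius \<open>r\<close> about a point of \<open>K\<close> and a step of length \<open>r\<close>\<close>
  define r where "r = e0 / 3"
  have r: "0 < r" using e0 by (simp add: r_def)
  define K' where "K' = {x + y | x y. x \<in> K \<and> y \<in> cball (0::'a) (2 * r)}"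
  have K': "compact K'" unfolding K'_def by (intro compact_sums K compact_cball)
  have K'S: "K' \<subseteq> S"
  proof
    fix z assume "z \<in> K'"
    then obtain x y where xy: "z = x + y" "x \<in> K" "norm y \<le> 2 * r" by (auto simp: K'_def)
    then have "z \<in> ball x e0" using e0(1) by (simp add: r_def dist_norm)
    then show "z \<in> S" using e0(2) xy(2) by blast
  qed
  have KK': "K \<subseteq> K'"
  proof
    fix x assume "x \<in> K"
    moreover have "x = x + 0" by simp
    ultimately show "x \<in> K'" unfolding K'_def using r by fastforce
  qed
  have "\<exists>z. x \<in> box (fst z) (snd z) \<and> cbox (fst z) (snd z) \<subseteq> cball x r" for x :: 'a
    using cbox_around_point[OF r, of x] by (metis fst_conv snd_conv)
  then obtain z where z: "\<And>x::'a. x \<in> box (fst (z x)) (snd (z x))" "\<And>x. cbox (fst (z x)) (snd (z x)) \<subseteq> cball x r"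
    by metis
  obtain X where X: "X \<subseteq> K" "finite X" "K \<subseteq> (\<Union>x\<in>X. box (fst (z x)) (snd (z x)))"
  proof (rule compactE_image[OF K(1), of K "\<lambda>x. box (fst (z x)) (snd (z x))"])
    show "K \<subseteq> (\<Union>x\<in>K. box (fst (z x)) (snd (z x)))" using z(1) by blast
  qed (auto intro: that)
  let ?w = "\<lambda>t x. (indicator K' (x + t *\<^sub>R i) * u (x + t *\<^sub>R i) - indicator K' x * u x) / t - indicator K' x * (G x \<bullet> i)"
  have intw: "integrable lborel (\<lambda>x. \<bar>?w t x\<bar>)" for t
    using has_weak_gradientD(1)[OF G K' K'S] has_weak_gradientD(2)[OF G K' K'S i]
      lborel_translation(2)[of "\<lambda>x. indicator K' x * u x" "t *\<^sub>R i"] by simp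
  have intwA: "integrable lborel (\<lambda>x. indicator A x * \<bar>?w t x\<bar>)" if "A \<in> sets borel" for A t
    using integrable_mult_indicator[of A lborel "\<lambda>x. \<bar>?w t x\<bar>"] intw[of t] that by simp
  have step: "\<exists>d>0. \<forall>t. 0 < t \<longrightarrow> t < d \<longrightarrow>
      (LINT x|lborel. indicator (\<Union>x\<in>Y. box (fst (z x)) (snd (z x))) x * \<bar>?w t x\<bar>) \<le> e"
    if "finite Y" "Y \<subseteq> K" "0 < e" for Y e
    using that
  proof (induction Y arbitrary: e rule: finite_induct)
    case empty
    then show ?case by (intro exI[of _ 1]) simp
  next
    case (insert y Y)
    let ?A = "box (fst (z y)) (snd (z y))" and ?U = "\<Union>x\<in>Y. box (fst (z x)) (snd (z x))"
    have near: "x + v \<in> K'" if "x \<in> cbox (fst (z y)) (snd (z y))" "norm v \<le> r" for x v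
    proof -
      have "norm (x - y) \<le> r" using z(2)[of y] that(1) by (auto simp: dist_norm norm_minus_commute)
      then have "norm (x - y + v) \<le> 2 * r" using that(2) norm_triangle_ineq[of "x - y" v] by linarith
      moreover have "x + v = y + (x - y + v)" by simp
      moreover have "y \<in> K" using insert by simp
      ultimately show ?thesis unfolding K'_def
        by (intro CollectI exI[of _ y] exI[of _ "x - y + v"]) auto
    qed
    have e2: "0 < e / 2" using insert by simp
    obtain d1 where d1: "0 < d1" "\<And>t. 0 < t \<Longrightarrow> t < d1 \<Longrightarrow> (LINT x|lborel. indicator ?A x * \<bar>?w t x\<bar>) \<le> e / 2"
      using difference_quotient_L1_box[OF G K' K'S r near i e2] by blast
    obtain d2 where d2: "0 < d2" "\<And>t. 0 < t \<Longrightarrow> t < d2 \<Longrightarrow> (LINT x|lborel. indicator ?U x * \<bar>?w t x\<bar>) \<le> e / 2"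
      using insert.IH[of "e / 2"] e2 insert.prems by auto
    have sets: "?A \<in> sets borel" "?U \<in> sets borel" "(\<Union>x\<in>insert y Y. box (fst (z x)) (snd (z x))) \<in> sets borel"
      by (auto intro!: borel_open)
    show ?case
    proof (intro exI[of _ "min d1 d2"] conjI allI impI)
      show "0 < min d1 d2" using d1 d2 by simp
      fix t assume t: "0 < t" "t < min d1 d2"
      have "(LINT x|lborel. indicator (\<Union>x\<in>insert y Y. box (fst (z x)) (snd (z x))) x * \<bar>?w t x\<bar>)
        \<le> (LINT x|lborel. indicator ?A x * \<bar>?w t x\<bar> + indicator ?U x * \<bar>?w t x\<bar>)"
      proof (rule integral_mono)
        show "indicator (\<Union>x\<in>insert y Y. box (fst (z x)) (snd (z x))) x * \<bar>?w t x\<bar>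
           \<le> indicator ?A x * \<bar>?w t x\<bar> + indicator ?U x * \<bar>?w t x\<bar>" for x
          by (auto simp: indicator_def)
      qed (use intwA sets in auto)
      also have "\<dots> = (LINT x|lborel. indicator ?A x * \<bar>?w t x\<bar>) + (LINT x|lborel. indicator ?U x * \<bar>?w t x\<bar>)"
        using intwA sets by (intro Bochner_Integration.integral_add) auto
      finally show "(LINT x|lborel. indicator (\<Union>x\<in>insert y Y. box (fst (z x)) (snd (z x))) x * \<bar>?w t x\<bar>) \<le> e"
        using d1(2)[of t] d2(2)[of t] t by simp
    qed
  qed
  show ?thesis
  proof (rule that[OF K' K'S KK'])
    fix e :: real assume e: "0 < e"
    obtain d where d: "0 < d" "\<And>t. 0 < t \<Longrightarrow> t < d \<Longrightarrow>
        (LINT x|lborel. indicator (\<Union>x\<in>X. box (fst (z x)) (snd (z x))) x * \<bar>?w t x\<bar>) \<le> e"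
      using step[OF X(2,1) e] by blast
    have "(LINT x|lborel. indicator K x * \<bar>?w t x\<bar>)
        \<le> (LINT x|lborel. indicator (\<Union>x\<in>X. box (fst (z x)) (snd (z x))) x * \<bar>?w t x\<bar>)" for t
    proof (rule integral_mono)
      show "indicator K x * \<bar>?w t x\<bar> \<le> indicator (\<Union>x\<in>X. box (fst (z x)) (snd (z x))) x * \<bar>?w t x\<bar>" for x
        using X(3) by (intro mult_right_mono) (auto simp: indicator_def)
    qed (use intwA K in \<open>auto intro!: intwA borel_open simp: borel_compact\<close>)
    with d show "\<exists>d>0. \<forall>t. 0 < t \<longrightarrow> t < d \<longrightarrow> (LINT x|lborel. indicator K x * \<bar>?w t x\<bar>) \<le> e"
      by (meson order_trans)
  qed
qed


text \<open>
  By the mean value theorem the difference quotient of \<open>F \<circ> u\<close> is \<open>F'\<close> at an intermediate value times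
  that of \<open>u\<close>.  The latter converges locally in mean.  Intermediate values tend to \<open>u\<close> almost everywhere
  along a sequence of steps, and the Lipschitz bound on \<open>F'\<close> transfers this to \<open>F'\<close> without any
  measurable choice of intermediate values.
\<close>

theorem has_weak_gradient_chain:
  fixes S :: "'a::euclidean_space set" and F F' :: "real \<Rightarrow> real"
  assumes S: "open S" and G: "has_weak_gradient S u G"
    and F: "\<And>s. (F has_real_derivative F' s) (at s)" and F0: "F 0 = 0"
    and L: "\<And>s. \<bar>F' s\<bar> \<le> L" and M: "\<And>s t. \<bar>F' s - F' t\<bar> \<le> M * \<bar>s - t\<bar>"
  shows "has_weak_gradient S (\<lambda>x. F (u x)) (\<lambda>x. F' (u x) *\<^sub>R G x)"
proof (rule has_weak_gradientI)
  have L0: "0 \<le> L" using L[of 0] by linarith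
  have M0: "0 \<le> M" using M[of 0 1] abs_ge_zero[of "F' 0 - F' 1"] by simp
  have mv: "\<exists>\<xi>. \<bar>\<xi> - s\<bar> \<le> \<bar>t - s\<bar> \<and> F t - F s = F' \<xi> * (t - s)" for s t
  proof -
    consider "s < t" | "t < s" | "s = t" by linarith
    then show ?thesis
    proof cases
      case 1
      obtain z where "s < z" "z < t" "F t - F s = (t - s) * F' z" using MVT2[OF 1, of F F'] F by blast
      then show ?thesis by (intro exI[of _ z]) (auto simp: mult.commute)
    next
      case 2
      obtain z where "t < z" "z < s" "F s - F t = (s - t) * F' z" using MVT2[OF 2, of F F'] F by blast
      then show ?thesis by (intro exI[of _ z]) (auto simp: algebra_simps)
    qed auto
  qed
  have F_Lip: "\<bar>F t - F s\<bar> \<le> L * \<bar>t - s\<bar>" for s t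
  proof -
    obtain \<xi> where "F t - F s = F' \<xi> * (t - s)" using mv by blast
    then show ?thesis using mult_right_mono[OF L, of "\<bar>t - s\<bar>" \<xi>] by (simp add: abs_mult)
  qed
  have F_cont: "continuous_on UNIV F"
    using F by (intro continuous_at_imp_continuous_on ballI) (auto intro: DERIV_isCont)
  have F'_cont: "continuous_on UNIV F'"
  proof (rule continuous_at_imp_continuous_on, intro ballI)
    fix s
    show "isCont F' s"
      unfolding isCont_def
    proof (rule LIM_zero_cancel, rule Lim_null_comparison)
      show "\<forall>\<^sub>F t in at s. norm (F' t - F' s) \<le> M * \<bar>t - s\<bar>" by (rule always_eventually) (use M in auto)
      have "((\<lambda>t. M * \<bar>t - s\<bar>) \<longlongrightarrow> M * \<bar>s - s\<bar>) (at s)" by (intro tendsto_intros)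
      then show "((\<lambda>t. M * \<bar>t - s\<bar>) \<longlongrightarrow> 0) (at s)" by simp
    qed
  qed
  have Fm [measurable]: "F \<in> borel_measurable borel" and F'm [measurable]: "F' \<in> borel_measurable borel"
    using F_cont F'_cont by (auto intro: borel_measurable_continuous_onI)
  have F_le: "\<bar>F s\<bar> \<le> L * \<bar>s\<bar>" for s using F_Lip[of s 0] F0 by simp
  fix K assume K: "compact K" "K \<subseteq> S"
  have [measurable]: "K \<in> sets borel" using K by (simp add: borel_compact)
  have siu: "set_integrable lborel K u" and siG: "set_integrable lborel K G"
    using G K by (auto simp: has_weak_gradient_def)
  have uKm: "(\<lambda>x. indicator K x * u x) \<in> borel_measurable borel"
    using borel_measurable_integrable[OF siu[unfolded set_integrable_def]] by simp
  have GKm: "(\<lambda>x. indicator K x *\<^sub>R G x) \<in> borel_measurable borel"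
    using borel_measurable_integrable[OF siG[unfolded set_integrable_def]] by simp
  show "set_integrable lborel K (\<lambda>x. F (u x))"
    unfolding set_integrable_def
  proof (rule Bochner_Integration.integrable_bound)
    show "integrable lborel (\<lambda>x. L * (indicator K x *\<^sub>R u x))"
      using siu by (simp add: set_integrable_def)
    have "(\<lambda>x. indicator K x *\<^sub>R F (u x)) = (\<lambda>x. F (indicator K x * u x))"
      by (intro ext) (auto simp: indicator_def F0)
    also have "\<dots> \<in> borel_measurable lborel" using measurable_compose[OF uKm Fm] by simp
    finally show "(\<lambda>x. indicator K x *\<^sub>R F (u x)) \<in> borel_measurable lborel" .
    show "AE x in lborel. norm (indicator K x *\<^sub>R F (u x)) \<le> norm (L * (indicator K x *\<^sub>R u x))"
      using F_le L0 by (intro AE_I2) (auto simp: indicator_def abs_mult)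
  qed
  show "set_integrable lborel K (\<lambda>x. F' (u x) *\<^sub>R G x)"
    unfolding set_integrable_def
  proof (rule Bochner_Integration.integrable_bound)
    show "integrable lborel (\<lambda>x. L *\<^sub>R (indicator K x *\<^sub>R G x))"
      by (intro integrable_scaleR_right siG[unfolded set_integrable_def])
    have "(\<lambda>x. indicator K x *\<^sub>R (F' (u x) *\<^sub>R G x)) = (\<lambda>x. F' (indicator K x * u x) *\<^sub>R (indicator K x *\<^sub>R G x))"
      by (intro ext) (auto simp: indicator_def)
    also have "\<dots> \<in> borel_measurable lborel" 
      using borel_measurable_scaleR[OF measurable_compose[OF uKm F'm] GKm] by simp
    finally show "(\<lambda>x. indicator K x *\<^sub>R (F' (u x) *\<^sub>R G x)) \<in> borel_measurable lborel" .
    show "AE x in lborel. norm (indicator K x *\<^sub>R (F' (u x) *\<^sub>R G x)) \<le> norm (L *\<^sub>R (indicator K x *\<^sub>R G x))"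
      by (intro AE_I2) (simp add: indicator_def mult_right_mono[OF order_trans[OF L abs_ge_self]])
  qed
  fix \<phi> :: "'a \<Rightarrow> real" and i :: 'a
  assume \<phi>: "\<And>k. C_k k \<phi>" "\<And>x. x \<notin> K \<Longrightarrow> \<phi> x = 0" and i: "i \<in> Basis"
  let ?d = "\<lambda>x. frechet_derivative \<phi> (at x) i"
  have d0: "?d x = 0" if "x \<notin> K" for x
    by (rule test_function_partial(4)[OF \<phi>(1) i compact_imp_closed[OF K(1)] \<phi>(2) that])
  have cd: "continuous_on UNIV ?d" by (rule test_function_partial(1)[OF \<phi>(1) i])
  have c\<phi>: "continuous_on UNIV \<phi>" by (rule test_function_partial(3)[OF \<phi>(1) i])
  note D\<phi> = test_function_partial(2)[OF \<phi>(1) i]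
  obtain B where B: "0 \<le> B" "\<And>x. \<bar>\<phi> x\<bar> \<le> B"
    using continuous_compactly_supported_bounded[OF c\<phi> K(1) \<phi>(2)] by blast
  obtain B' where B': "\<And>x. \<bar>?d x\<bar> \<le> B'"
    using continuous_compactly_supported_bounded[OF cd K(1) d0] by blast
  obtain K' where K': "compact K'" "K' \<subseteq> S" "K \<subseteq> K'" and
    dq: "\<And>e. 0 < e \<Longrightarrow> \<exists>d>0. \<forall>t. 0 < t \<longrightarrow> t < d \<longrightarrow>
      (LINT x|lborel. indicator K x * \<bar>(indicator K' (x + t *\<^sub>R i) * u (x + t *\<^sub>R i) - indicator K' x * u x) / t
         - indicator K' x * (G x \<bullet> i)\<bar>) \<le> e"
    using difference_quotient_L1_compact[OF S G K i] by blast
  define U where "U x = indicator K' x * u x" for x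
  define g where "g x = indicator K' x * (G x \<bullet> i)" for x
  have intU: "integrable lborel U" unfolding U_def by (rule has_weak_gradientD(1)[OF G K'(1,2)])
  have intg: "integrable lborel g" unfolding g_def by (rule has_weak_gradientD(2)[OF G K'(1,2) i])
  have [measurable]: "U \<in> borel_measurable borel" "g \<in> borel_measurable borel"
    using borel_measurable_integrable[OF intU] borel_measurable_integrable[OF intg] by auto
  have intU_sh: "integrable lborel (\<lambda>x. U (x + v))" for v using intU by (simp add: lborel_translation(2)[of U])
  have intFU: "integrable lborel (\<lambda>x. F (U x))"
  proof (rule Bochner_Integration.integrable_bound)
    show "integrable lborel (\<lambda>x. L * U x)" using intU by simp
    show "AE x in lborel. norm (F (U x)) \<le> norm (L * U x)"
      using F_le L0 by (intro AE_I2) (auto simp: abs_mult)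
  qed measurable
  \<comment> \<open>steps along which the translates of \<open>U\<close> converge almost everywhere\<close>
  define T where "T n = 1 / real (Suc n)" for n
  have T: "0 < T n" for n by (simp add: T_def)
  have T0: "T \<longlonglongrightarrow> 0" unfolding T_def by (rule LIMSEQ_inverse_real_of_nat[unfolded inverse_eq_divide])
  have "(\<lambda>n. LINT x|lborel. norm (U (x + T n *\<^sub>R i) - U x)) \<longlonglongrightarrow> 0"
  proof (rule LIMSEQ_I)
    fix e :: real assume "0 < e"
    then obtain d where d: "0 < d" "\<And>v. norm v < d \<Longrightarrow> (LINT x|lborel. \<bar>U (x + v) - U x\<bar>) < e"
      using L1_continuity_of_translation[OF intU] by blast
    obtain n0 where n0: "\<And>n. n \<ge> n0 \<Longrightarrow> norm (T n - 0) < d" using LIMSEQ_D[OF T0 d(1)] by blast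
    show "\<exists>n0. \<forall>n\<ge>n0. norm ((LINT x|lborel. norm (U (x + T n *\<^sub>R i) - U x)) - 0) < e"
    proof (intro exI[of _ n0] allI impI)
      fix n assume "n \<ge> n0"
      then have "norm (T n *\<^sub>R i) < d" using n0[of n] i by simp
      from d(2)[OF this] show "norm ((LINT x|lborel. norm (U (x + T n *\<^sub>R i) - U x)) - 0) < e" by simp
    qed
  qed
  then obtain r :: "nat \<Rightarrow> nat" where r: "strict_mono r" "AE x in lborel. (\<lambda>n. U (x + T (r n) *\<^sub>R i)) \<longlonglongrightarrow> U x"
    using L1_tendsto_AE_subseq[of lborel "\<lambda>n x. U (x + T n *\<^sub>R i)" U, OF intU_sh intU] by blast
  define t where "t n = T (r n)" for n
  have t: "0 < t n" for n by (simp add: t_def T)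
  have t0: "t \<longlonglongrightarrow> 0" using LIMSEQ_subseq_LIMSEQ[OF T0 r(1)] by (simp add: t_def[abs_def] o_def)
  have aet: "AE x in lborel. (\<lambda>n. U (x + t n *\<^sub>R i)) \<longlonglongrightarrow> U x" using r(2) by (simp add: t_def)
  define Q where "Q n x = (U (x + t n *\<^sub>R i) - U x) / t n - g x" for n x
  \<comment> \<open>the error of replacing \<open>F'\<close> at an intermediate value by \<open>F' (U x)\<close>\<close>
  define R where "R n x = min (2 * L) (M * \<bar>U (x + t n *\<^sub>R i) - U x\<bar>) * \<bar>g x\<bar>" for n x
  have intQ: "integrable lborel (Q n)" for n unfolding Q_def[abs_def] using intU intU_sh intg by simp
  have intKQ: "integrable lborel (\<lambda>x. indicator K x * \<bar>Q n x\<bar>)" for n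
    using integrable_mult_indicator[of K lborel "\<lambda>x. \<bar>Q n x\<bar>"] intQ by simp
  have Q0: "(\<lambda>n. LINT x|lborel. indicator K x * \<bar>Q n x\<bar>) \<longlonglongrightarrow> 0"
  proof (rule LIMSEQ_I)
    fix e :: real assume e: "0 < e"
    then obtain d where d: "0 < d" "\<And>s. 0 < s \<Longrightarrow> s < d \<Longrightarrow>
      (LINT x|lborel. indicator K x * \<bar>(indicator K' (x + s *\<^sub>R i) * u (x + s *\<^sub>R i) - indicator K' x * u x) / s
         - indicator K' x * (G x \<bullet> i)\<bar>) \<le> e / 2"
      using dq[of "e / 2"] by auto
    obtain n0 where n0: "\<And>n. n \<ge> n0 \<Longrightarrow> norm (t n - 0) < d" using LIMSEQ_D[OF t0 d(1)] by blast
    show "\<exists>n0. \<forall>n\<ge>n0. norm ((LINT x|lborel. indicator K x * \<bar>Q n x\<bar>) - 0) < e"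
    proof (intro exI[of _ n0] allI impI)
      fix n assume "n \<ge> n0"
      then have "t n < d" using n0[of n] by simp
      from d(2)[OF t this] have "(LINT x|lborel. indicator K x * \<bar>Q n x\<bar>) \<le> e / 2"
        by (simp add: Q_def U_def g_def)
      moreover have "0 \<le> (LINT x|lborel. indicator K x * \<bar>Q n x\<bar>)" by simp
      ultimately show "norm ((LINT x|lborel. indicator K x * \<bar>Q n x\<bar>) - 0) < e" using e by simp
    qed
  qed
  have R_range: "0 \<le> R n x" "R n x \<le> 2 * L * \<bar>g x\<bar>" for n x
    unfolding R_def using L0 M0 by (auto intro!: mult_right_mono)
  have intR: "integrable lborel (R n)" for n
  proof (rule Bochner_Integration.integrable_bound)
    show "integrable lborel (\<lambda>x. 2 * L * \<bar>g x\<bar>)" using intg by simp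
    show "R n \<in> borel_measurable lborel" unfolding R_def[abs_def] by measurable
    show "AE x in lborel. norm (R n x) \<le> norm (2 * L * \<bar>g x\<bar>)"
    proof (rule AE_I2)
      fix x show "norm (R n x) \<le> norm (2 * L * \<bar>g x\<bar>)"
        using R_range[of n x] unfolding real_norm_def by linarith
    qed
  qed
  have R0: "(\<lambda>n. LINT x|lborel. R n x) \<longlonglongrightarrow> (LINT x::'a|lborel. (0::real))"
  proof (rule integral_dominated_convergence[where w = "\<lambda>x. 2 * L * \<bar>g x\<bar>"])
    show "AE x in lborel. (\<lambda>n. R n x) \<longlonglongrightarrow> 0"
      using aet
    proof eventually_elim
      case (elim x)
      have "(\<lambda>n. R n x) \<longlonglongrightarrow> min (2 * L) (M * \<bar>U x - U x\<bar>) * \<bar>g x\<bar>"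
        unfolding R_def by (intro tendsto_intros elim)
      then show ?case using L0 by simp
    qed
    show "AE x in lborel. norm (R n x) \<le> 2 * L * \<bar>g x\<bar>" for n
      using R_range by (intro AE_I2) simp
  qed (use intg intR in auto)
  let ?q = "\<lambda>n x. (F (U (x + t n *\<^sub>R i)) - F (U x)) / t n"
  have ptw: "\<bar>?q n x - F' (U x) * g x\<bar> \<le> L * \<bar>Q n x\<bar> + R n x" for n x
  proof -
    obtain \<xi> where \<xi>: "\<bar>\<xi> - U x\<bar> \<le> \<bar>U (x + t n *\<^sub>R i) - U x\<bar>"
      "F (U (x + t n *\<^sub>R i)) - F (U x) = F' \<xi> * (U (x + t n *\<^sub>R i) - U x)"
      using mv by blast
    have "?q n x - F' (U x) * g x = F' \<xi> * Q n x + (F' \<xi> - F' (U x)) * g x"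
      unfolding \<xi>(2) Q_def by (simp add: algebra_simps)
    also have "\<bar>\<dots>\<bar> \<le> \<bar>F' \<xi>\<bar> * \<bar>Q n x\<bar> + \<bar>F' \<xi> - F' (U x)\<bar> * \<bar>g x\<bar>"
      unfolding abs_mult[symmetric] by (rule abs_triangle_ineq)
    also have "\<dots> \<le> L * \<bar>Q n x\<bar> + R n x"
      unfolding R_def
    proof (intro add_mono mult_right_mono L)
      have "M * \<bar>\<xi> - U x\<bar> \<le> M * \<bar>U (x + t n *\<^sub>R i) - U x\<bar>" using \<xi>(1) M0 by (intro mult_left_mono)
      then show "\<bar>F' \<xi> - F' (U x)\<bar> \<le> min (2 * L) (M * \<bar>U (x + t n *\<^sub>R i) - U x\<bar>)"
        using M[of \<xi> "U x"] L[of \<xi>] L[of "U x"] by linarith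
    qed auto
    finally show ?thesis .
  qed
  have intF'g: "integrable lborel (\<lambda>x. F' (U x) * g x)"
  proof (rule Bochner_Integration.integrable_bound)
    show "integrable lborel (\<lambda>x. L * g x)" using intg by simp
    show "AE x in lborel. norm (F' (U x) * g x) \<le> norm (L * g x)"
      by (intro AE_I2) (simp add: abs_mult mult_right_mono[OF order_trans[OF L abs_ge_self]])
  qed measurable
  have intFU_sh: "integrable lborel (\<lambda>x. F (U (x + v)))" for v
    using intFU lborel_translation(2)[of "\<lambda>x. F (U x)" v] by simp
  have intq: "integrable lborel (?q n)" for n using intFU intFU_sh by simp
  have lim1: "(\<lambda>n. LINT x|lborel. ?q n x * \<phi> x) \<longlonglongrightarrow> (LINT x|lborel. F' (U x) * g x * \<phi> x)"
  proof (rule LIM_zero_cancel, rule Lim_null_comparison[OF always_eventually], rule allI)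
    fix n
    have "(LINT x|lborel. ?q n x * \<phi> x) - (LINT x|lborel. F' (U x) * g x * \<phi> x)
        = (LINT x|lborel. (?q n x - F' (U x) * g x) * \<phi> x)"
      using integrable_times_bounded[OF intq c\<phi> B(2)] integrable_times_bounded[OF intF'g c\<phi> B(2)]
      by (simp add: left_diff_distrib)
    also have "\<bar>\<dots>\<bar> \<le> (LINT x|lborel. B * (L * (indicator K x * \<bar>Q n x\<bar>) + R n x))"
    proof (rule integral_abs_bound_integral)
      show "integrable lborel (\<lambda>x. (?q n x - F' (U x) * g x) * \<phi> x)"
        using intq intF'g by (intro integrable_times_bounded[OF _ c\<phi> B(2)]) simp
      show "integrable lborel (\<lambda>x. B * (L * (indicator K x * \<bar>Q n x\<bar>) + R n x))"
        using intKQ intR by simp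
      show "\<bar>(?q n x - F' (U x) * g x) * \<phi> x\<bar> \<le> B * (L * (indicator K x * \<bar>Q n x\<bar>) + R n x)" for x
      proof (cases "x \<in> K")
        case True
        have "\<bar>(?q n x - F' (U x) * g x) * \<phi> x\<bar> = \<bar>\<phi> x\<bar> * \<bar>?q n x - F' (U x) * g x\<bar>"
          by (simp only: abs_mult mult.commute)
        also have "\<dots> \<le> B * (L * \<bar>Q n x\<bar> + R n x)"
          using B ptw by (intro mult_mono) auto
        finally show ?thesis using True by simp
      next
        case False
        then show ?thesis using \<phi>(2)[OF False] B(1) R_range[of n x] by simp
      qed
    qed
    also have "\<dots> = B * (L * (LINT x|lborel. indicator K x * \<bar>Q n x\<bar>) + (LINT x|lborel. R n x))"
      using intKQ intR by simp
    finally show "norm ((LINT x|lborel. ?q n x * \<phi> x) - (LINT x|lborel. F' (U x) * g x * \<phi> x))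
       \<le> B * (L * (LINT x|lborel. indicator K x * \<bar>Q n x\<bar>) + (LINT x|lborel. R n x))" by simp
  next
    have "(\<lambda>n. B * (L * (LINT x|lborel. indicator K x * \<bar>Q n x\<bar>) + (LINT x|lborel. R n x)))
       \<longlonglongrightarrow> B * (L * 0 + (LINT x::'a|lborel. (0::real)))"
      by (intro tendsto_intros Q0 R0)
    then show "(\<lambda>n. B * (L * (LINT x|lborel. indicator K x * \<bar>Q n x\<bar>) + (LINT x|lborel. R n x))) \<longlonglongrightarrow> 0"
      by simp
  qed
  have lim2: "(\<lambda>n. LINT x|lborel. ?q n x * \<phi> x) \<longlonglongrightarrow> - (LINT x|lborel. F (U x) * ?d x)"
  proof -
    have minus: "frechet_derivative \<phi> (at x) (- i) = - ?d x" for x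
      using linear_neg[OF has_derivative_linear[OF D\<phi>]] .
    have "((\<lambda>s. LINT x|lborel. F (U x) * ((\<phi> (x + s *\<^sub>R (- i)) - \<phi> x) / s)) \<longlongrightarrow>
        (LINT x|lborel. F (U x) * frechet_derivative \<phi> (at x) (- i))) (at 0)"
      by (rule integral_difference_quotient_tendsto[OF intFU D\<phi> c\<phi>, of _ B']) (simp add: minus B')
    moreover have "filterlim t (at 0) sequentially"
      by (rule filterlim_atI[OF t0 always_eventually]) (use t in \<open>auto simp: less_imp_neq[symmetric]\<close>)
    ultimately have "(\<lambda>n. LINT x|lborel. F (U x) * ((\<phi> (x + t n *\<^sub>R (- i)) - \<phi> x) / t n)) \<longlonglongrightarrow>
        (LINT x|lborel. F (U x) * frechet_derivative \<phi> (at x) (- i))"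
      by (rule filterlim_compose)
    moreover have "(LINT x|lborel. F (U x) * frechet_derivative \<phi> (at x) (- i)) = - (LINT x|lborel. F (U x) * ?d x)"
      by (simp add: minus)
    moreover have "(LINT x|lborel. F (U x) * ((\<phi> (x + t n *\<^sub>R (- i)) - \<phi> x) / t n)) = (LINT x|lborel. ?q n x * \<phi> x)" for n
    proof -
      have sh: "(LINT x|lborel. F (U (x + t n *\<^sub>R i)) * \<phi> x) = (LINT x|lborel. F (U x) * \<phi> (x - t n *\<^sub>R i))"
        using lborel_translation(1)[of "\<lambda>x. F (U x) * \<phi> (x - t n *\<^sub>R i)" "t n *\<^sub>R i"] by simp
      have int1: "integrable lborel (\<lambda>x. F (U x) * \<phi> (x - t n *\<^sub>R i))"
        by (rule integrable_times_bounded[OF intFU _ B(2)])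
           (auto intro!: continuous_on_compose2[OF c\<phi>] continuous_intros)
      have int2: "integrable lborel (\<lambda>x. F (U x) * \<phi> x)" by (rule integrable_times_bounded[OF intFU c\<phi> B(2)])
      have int3: "integrable lborel (\<lambda>x. F (U (x + t n *\<^sub>R i)) * \<phi> x)"
        by (rule integrable_times_bounded[OF intFU_sh c\<phi> B(2)])
      have "(LINT x|lborel. F (U x) * ((\<phi> (x + t n *\<^sub>R (- i)) - \<phi> x) / t n))
          = (LINT x|lborel. (F (U x) * \<phi> (x - t n *\<^sub>R i) - F (U x) * \<phi> x) / t n)"
        by (simp add: right_diff_distrib)
      also have "\<dots> = ((LINT x|lborel. F (U x) * \<phi> (x - t n *\<^sub>R i)) - (LINT x|lborel. F (U x) * \<phi> x)) / t n"
        using int1 int2 by simp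
      also have "\<dots> = ((LINT x|lborel. F (U (x + t n *\<^sub>R i)) * \<phi> x) - (LINT x|lborel. F (U x) * \<phi> x)) / t n"
        by (simp only: sh)
      also have "\<dots> = (LINT x|lborel. (F (U (x + t n *\<^sub>R i)) * \<phi> x - F (U x) * \<phi> x) / t n)"
        using int3 int2 by simp
      also have "\<dots> = (LINT x|lborel. ?q n x * \<phi> x)"
        by (simp add: left_diff_distrib)
      finally show ?thesis .
    qed
    ultimately show ?thesis by (simp only:)
  qed
  have "(LINT x|lborel. F' (U x) * g x * \<phi> x) = - (LINT x|lborel. F (U x) * ?d x)"
    by (rule LIMSEQ_unique[OF lim1 lim2])
  moreover have "(LINT x|lborel. indicator K x * F (u x) * ?d x) = (LINT x|lborel. F (U x) * ?d x)"
  proof (intro Bochner_Integration.integral_cong refl)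
    fix x show "indicator K x * F (u x) * ?d x = F (U x) * ?d x"
      using d0[of x] K'(3) by (cases "x \<in> K") (auto simp: U_def)
  qed
  moreover have "(LINT x|lborel. indicator K x * (F' (u x) *\<^sub>R G x \<bullet> i) * \<phi> x) = (LINT x|lborel. F' (U x) * g x * \<phi> x)"
  proof (intro Bochner_Integration.integral_cong refl)
    fix x show "indicator K x * (F' (u x) *\<^sub>R G x \<bullet> i) * \<phi> x = F' (U x) * g x * \<phi> x"
      using \<phi>(2)[of x] K'(3) by (cases "x \<in> K") (auto simp: U_def g_def)
  qed
  ultimately show "(LINT x|lborel. indicator K x * F (u x) * ?d x)
     = - (LINT x|lborel. indicator K x * (F' (u x) *\<^sub>R G x \<bullet> i) * \<phi> x)" by simp
qed


section \<open>Solutions on a bounded open set\<close>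

definition sobolev_pairs :: "real \<Rightarrow> 'a::euclidean_space set \<Rightarrow> (('a \<Rightarrow> real) \<times> ('a \<Rightarrow> 'a)) set" where
  "sobolev_pairs p S = {(u, G). u \<in> borel_measurable (restrict_space lborel S) \<and>
     integrable (restrict_space lborel S) (\<lambda>x. (u x)\<^sup>2) \<and>
     G \<in> borel_measurable (restrict_space lborel S) \<and>
     integrable (restrict_space lborel S) (\<lambda>x. norm (G x) powr p) \<and> has_weak_gradient S u G}"

lemma
  fixes f :: "'a::euclidean_space \<Rightarrow> 'b::{banach, second_countable_topology}"
  assumes "S \<in> sets borel"
  shows integrable_restrict_lborel: "integrable (restrict_space lborel S) f \<longleftrightarrow> set_integrable lborel S f"
    and integral_restrict_lborel: "integral\<^sup>L (restrict_space lborel S) f = (LINT x:S|lborel. f x)"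
  using assms by (simp_all add: integrable_restrict_space integral_restrict_space
      set_integrable_def set_lebesgue_integral_def)

lemma finite_measure_restrict_lborel:
  assumes "bounded S" "S \<in> sets borel"
  shows "finite_measure (restrict_space lborel S)"
  using emeasure_bounded_finite[OF assms(1)] assms(2)
  by (intro finite_measureI) (simp add: emeasure_restrict_space space_restrict_space top.not_eq_extremum)

lemma gradient_pairs_sobolev:
  fixes S :: "'a::euclidean_space set"
  assumes S: "open S" "bounded S" and p: "1 < p"
  shows "gradient_pairs (restrict_space lborel S) p (sobolev_pairs p S)"
proof -
  have Sb: "S \<in> sets borel" using S by simp
  interpret finite_measure "restrict_space lborel S" by (rule finite_measure_restrict_lborel[OF S(2) Sb])
  let ?N = "restrict_space lborel S"
  have p0: "0 < p" using p by simp
  show ?thesis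
  proof
    show "1 < p" by (rule p)
    have "has_weak_gradient S (\<lambda>x. 0) (\<lambda>x. 0)"
      by (rule C1_has_weak_gradient) auto
    then have "(\<lambda>x. 0, \<lambda>x. 0) \<in> sobolev_pairs p S" using p0 by (simp add: sobolev_pairs_def)
    then show "sobolev_pairs p S \<noteq> {}" by blast
    fix u :: "'a \<Rightarrow> real" and G :: "'a \<Rightarrow> 'a"
    assume uG: "(u, G) \<in> sobolev_pairs p S"
    then show um: "u \<in> borel_measurable ?N" and u2: "integrable ?N (\<lambda>x. (u x)\<^sup>2)"
      and Gm: "G \<in> borel_measurable ?N" and Gp: "integrable ?N (\<lambda>x. norm (G x) powr p)"
      by (auto simp: sobolev_pairs_def)
    fix v :: "'a \<Rightarrow> real" and H :: "'a \<Rightarrow> 'a" and a b :: real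
    assume vH: "(v, H) \<in> sobolev_pairs p S"
    have vm: "v \<in> borel_measurable ?N" and v2: "integrable ?N (\<lambda>x. (v x)\<^sup>2)"
      and Hm: "H \<in> borel_measurable ?N" and Hp: "integrable ?N (\<lambda>x. norm (H x) powr p)"
      using vH by (auto simp: sobolev_pairs_def)
    note [measurable] = um vm Gm Hm
    have "integrable ?N (\<lambda>x. (a * u x + b * v x)\<^sup>2)"
    proof (rule Bochner_Integration.integrable_bound)
      show "integrable ?N (\<lambda>x. 2 * a\<^sup>2 * (u x)\<^sup>2 + 2 * b\<^sup>2 * (v x)\<^sup>2)" using u2 v2 by simp
      show "AE x in ?N. norm ((a * u x + b * v x)\<^sup>2) \<le> norm (2 * a\<^sup>2 * (u x)\<^sup>2 + 2 * b\<^sup>2 * (v x)\<^sup>2)"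
      proof (rule AE_I2)
        fix x
        have "0 \<le> (a * u x - b * v x)\<^sup>2" by simp
        then have "(a * u x + b * v x)\<^sup>2 \<le> 2 * a\<^sup>2 * (u x)\<^sup>2 + 2 * b\<^sup>2 * (v x)\<^sup>2"
          by (simp add: power2_eq_square algebra_simps)
        then show "norm ((a * u x + b * v x)\<^sup>2) \<le> norm (2 * a\<^sup>2 * (u x)\<^sup>2 + 2 * b\<^sup>2 * (v x)\<^sup>2)"
          by (simp add: abs_of_nonneg)
      qed
    qed measurable
    moreover have "integrable ?N (\<lambda>x. norm (a *\<^sub>R G x + b *\<^sub>R H x) powr p)"
    proof (rule Bochner_Integration.integrable_bound)
      show "integrable ?N (\<lambda>x. 2 powr p * (\<bar>a\<bar> powr p * norm (G x) powr p + \<bar>b\<bar> powr p * norm (H x) powr p))"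
        using Gp Hp by simp
      show "AE x in ?N. norm (norm (a *\<^sub>R G x + b *\<^sub>R H x) powr p)
          \<le> norm (2 powr p * (\<bar>a\<bar> powr p * norm (G x) powr p + \<bar>b\<bar> powr p * norm (H x) powr p))"
        using norm_powr_add_le[OF p0] by (intro AE_I2) (simp add: add_nonneg_nonneg flip: powr_mult norm_scaleR)
    qed measurable
    moreover have "has_weak_gradient S (\<lambda>x. a * u x + b * v x) (\<lambda>x. a *\<^sub>R G x + b *\<^sub>R H x)"
      using uG vH by (intro has_weak_gradient_lincomb) (auto simp: sobolev_pairs_def)
    ultimately show "(\<lambda>x. a * u x + b * v x, \<lambda>x. a *\<^sub>R G x + b *\<^sub>R H x) \<in> sobolev_pairs p S"
      unfolding sobolev_pairs_def by simp
  next
    fix us :: "nat \<Rightarrow> 'a \<Rightarrow> real" and Gs :: "nat \<Rightarrow> 'a \<Rightarrow> 'a" and u :: "'a \<Rightarrow> real" and G :: "'a \<Rightarrow> 'a"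
    assume V: "\<And>n. (us n, Gs n) \<in> sobolev_pairs p S"
      and u: "u \<in> borel_measurable ?N" "integrable ?N (\<lambda>x. (u x)\<^sup>2)"
      and G: "G \<in> borel_measurable ?N" "integrable ?N (\<lambda>x. norm (G x) powr p)"
      and lim: "(\<lambda>n. LINT x|?N. \<bar>us n x - u x\<bar>) \<longlonglongrightarrow> 0"
        "(\<lambda>n. LINT x|?N. norm (Gs n x - G x)) \<longlonglongrightarrow> 0"
    have int: "integrable ?N f" if [measurable]: "f \<in> borel_measurable ?N" and q: "1 < q"
        and fq: "integrable ?N (\<lambda>x. norm (f x) powr q)"
      for f :: "'a \<Rightarrow> 'c::euclidean_space" and q
    proof (rule Bochner_Integration.integrable_bound)
      show "integrable ?N (\<lambda>x. 1 + norm (f x) powr q)" using fq by simp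
      show "AE x in ?N. norm (f x) \<le> norm (1 + norm (f x) powr q)"
        using norm_le_one_plus_powr[OF q] by (intro AE_I2) simp
    qed measurable
    have int2: "integrable ?N f" if "f \<in> borel_measurable ?N" "integrable ?N (\<lambda>x. (f x)\<^sup>2)" for f :: "'a \<Rightarrow> real"
      by (rule int[of f 2]) (use that in simp_all)
    have Vn: "us n \<in> borel_measurable ?N" "integrable ?N (\<lambda>x. (us n x)\<^sup>2)" "Gs n \<in> borel_measurable ?N"
      "integrable ?N (\<lambda>x. norm (Gs n x) powr p)" "has_weak_gradient S (us n) (Gs n)" for n
      using V[of n] by (auto simp: sobolev_pairs_def)
    have "has_weak_gradient S u G"
    proof (rule has_weak_gradient_L1_limit[OF Sb Vn(5)])
      show "set_integrable lborel S (us n)" for n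
        using int2[OF Vn(1,2)] by (simp only: integrable_restrict_lborel[OF Sb])
      show "set_integrable lborel S (Gs n)" for n
        using int[OF Vn(3) p Vn(4)] by (simp only: integrable_restrict_lborel[OF Sb])
      show "set_integrable lborel S u" using int2[OF u] by (simp only: integrable_restrict_lborel[OF Sb])
      show "set_integrable lborel S G" using int[OF G(1) p G(2)] by (simp only: integrable_restrict_lborel[OF Sb])
      show "(\<lambda>n. LINT x:S|lborel. \<bar>us n x - u x\<bar>) \<longlonglongrightarrow> 0"
        "(\<lambda>n. LINT x:S|lborel. norm (Gs n x - G x)) \<longlonglongrightarrow> 0"
        using lim by (simp_all only: integral_restrict_lborel[OF Sb])
    qed
    with u G show "(u, G) \<in> sobolev_pairs p S" by (simp add: sobolev_pairs_def)
  qed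
qed

text \<open>A substitute for the positive part that has a bounded Lipschitz derivative, as the chain rule
  requires.\<close>

definition soft_excess :: "real \<Rightarrow> real" where
  "soft_excess s = sqrt (1 + (max 0 s)\<^sup>2) - 1"

definition soft_slope :: "real \<Rightarrow> real" where
  "soft_slope s = max 0 s / sqrt (1 + (max 0 s)\<^sup>2)"

lemma soft_excess_derivative: "(soft_excess has_real_derivative soft_slope s) (at s)"
proof -
  have sq: "((\<lambda>s. (max 0 s)\<^sup>2) has_real_derivative 2 * max 0 s) (at s)"
  proof -
    consider "0 < s" | "s < 0" | "s = 0" by linarith
    then show ?thesis
    proof cases
      case 1
      have "((\<lambda>s. s\<^sup>2) has_real_derivative 2 * s) (at s)" by (auto intro!: derivative_eq_intros)
      then have "((\<lambda>s. (max 0 s)\<^sup>2) has_real_derivative 2 * s) (at s)"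
        by (rule has_field_derivative_transform_within_open[of _ _ _ "{0<..}"]) (use 1 in auto)
      then show ?thesis using 1 by simp
    next
      case 2
      have "((\<lambda>s. 0) has_real_derivative 0) (at s)" by simp
      then have "((\<lambda>s. (max 0 s)\<^sup>2) has_real_derivative 0) (at s)"
        by (rule has_field_derivative_transform_within_open[of _ _ _ "{..<0}"]) (use 2 in auto)
      then show ?thesis using 2 by simp
    next
      case 3
      have "((\<lambda>h. ((max 0 (0 + h))\<^sup>2 - (max 0 0)\<^sup>2) / h) \<longlongrightarrow> (0::real)) (at 0)"
      proof (rule Lim_null_comparison)
        show "\<forall>\<^sub>F h in at 0. norm (((max 0 (0 + h))\<^sup>2 - (max 0 0)\<^sup>2) / h) \<le> \<bar>h::real\<bar>"
          by (rule always_eventually) (auto simp: max_def power2_eq_square)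
        show "((\<lambda>h::real. \<bar>h\<bar>) \<longlongrightarrow> 0) (at 0)"
          using tendsto_rabs[OF tendsto_ident_at[of "0::real" UNIV]] by simp
      qed
      then show ?thesis using 3 by (simp add: DERIV_def)
    qed
  qed
  have pos: "0 < 1 + (max 0 s)\<^sup>2" by (simp add: add_pos_nonneg)
  have inner: "((\<lambda>s. 1 + (max 0 s)\<^sup>2) has_real_derivative 2 * max 0 s) (at s)"
    using DERIV_add[OF DERIV_const sq, of 1] by simp
  have "((\<lambda>s. sqrt (1 + (max 0 s)\<^sup>2)) has_real_derivative
      inverse (sqrt (1 + (max 0 s)\<^sup>2)) / 2 * (2 * max 0 s)) (at s)"
    by (rule DERIV_chain2[where f = sqrt and g = "\<lambda>s. 1 + (max 0 s)\<^sup>2", OF DERIV_real_sqrt[OF pos] inner])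
  then have "((\<lambda>s. sqrt (1 + (max 0 s)\<^sup>2) - 1) has_real_derivative
      inverse (sqrt (1 + (max 0 s)\<^sup>2)) / 2 * (2 * max 0 s) - 0) (at s)"
    by (rule DERIV_diff[OF _ DERIV_const])
  moreover have "inverse X / 2 * (2 * m) - 0 = m / X" for X m :: real
    by (simp add: field_simps)
  ultimately show ?thesis
    by (simp only: soft_excess_def[abs_def] soft_slope_def)
qed

lemma soft_slope_range: "0 \<le> soft_slope s" "soft_slope s \<le> 1"
proof -
  show "0 \<le> soft_slope s" by (simp add: soft_slope_def)
  have "sqrt ((max 0 s)\<^sup>2) \<le> sqrt (1 + (max 0 s)\<^sup>2)" by (intro real_sqrt_le_mono) simp
  moreover have "0 < sqrt (1 + (max 0 s)\<^sup>2)" by (simp add: add_pos_nonneg)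
  ultimately show "soft_slope s \<le> 1" by (simp add: soft_slope_def)
qed

lemma soft_slope_Lipschitz: "\<bar>soft_slope s - soft_slope t\<bar> \<le> \<bar>s - t\<bar>"
proof -
  have *: "\<bar>a / sqrt (1 + a\<^sup>2) - b / sqrt (1 + b\<^sup>2)\<bar> \<le> b - a" if ab: "0 \<le> a" "a \<le> b" for a b :: real
  proof -
    have pa: "1 \<le> sqrt (1 + a\<^sup>2)" and pb: "1 \<le> sqrt (1 + b\<^sup>2)" by simp_all
    have "sqrt (a\<^sup>2 * (1 + b\<^sup>2)) \<le> sqrt (b\<^sup>2 * (1 + a\<^sup>2))"
      using ab by (intro real_sqrt_le_mono) (simp add: algebra_simps power_mono)
    then have "a * sqrt (1 + b\<^sup>2) \<le> b * sqrt (1 + a\<^sup>2)"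
      using ab by (simp add: real_sqrt_mult)
    then have mono: "a / sqrt (1 + a\<^sup>2) \<le> b / sqrt (1 + b\<^sup>2)"
    proof -
      have "a / X \<le> b / Y" if "a * Y \<le> b * X" "0 < X" "0 < Y" for X Y :: real
        using that by (simp add: field_simps)
      from this[OF \<open>a * sqrt (1 + b\<^sup>2) \<le> b * sqrt (1 + a\<^sup>2)\<close>] pa pb show ?thesis by linarith
    qed
    have "sqrt (1 + a\<^sup>2) \<le> sqrt (1 + b\<^sup>2)" using ab by (intro real_sqrt_le_mono) (simp add: power_mono)
    then have "b / sqrt (1 + b\<^sup>2) \<le> b / sqrt (1 + a\<^sup>2)"
      using ab by (intro frac_le) (auto simp: add_pos_nonneg)
    then have "b / sqrt (1 + b\<^sup>2) - a / sqrt (1 + a\<^sup>2) \<le> (b - a) / sqrt (1 + a\<^sup>2)"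
      by (simp add: diff_divide_distrib)
    also have "\<dots> \<le> (b - a) / 1" using ab by (intro frac_le) (auto simp: add_pos_nonneg)
    finally show ?thesis using mono by simp
  qed
  show ?thesis
  proof (cases "s \<le> t")
    case True
    have "\<bar>soft_slope s - soft_slope t\<bar> \<le> max 0 t - max 0 s"
      unfolding soft_slope_def by (rule *) (use True in auto)
    also have "\<dots> \<le> \<bar>s - t\<bar>" by linarith
    finally show ?thesis .
  next
    case False
    have "\<bar>soft_slope t - soft_slope s\<bar> \<le> max 0 s - max 0 t"
      unfolding soft_slope_def by (rule *) (use False in auto)
    also have "\<dots> \<le> \<bar>s - t\<bar>" by linarith
    finally show ?thesis by (simp add: abs_minus_commute)
  qed
qed

lemma soft_excess_sign: "0 \<le> soft_excess s" "0 < soft_excess s \<longleftrightarrow> 0 < s"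
proof -
  show "0 \<le> soft_excess s" by (simp add: soft_excess_def)
  show "0 < soft_excess s \<longleftrightarrow> 0 < s"
    by (cases "0 < s") (auto simp: soft_excess_def)
qed

text \<open>Testing the equation with the excess of the solution over the bound of the data makes the
  flux term nonnegative and the other term nonpositive.\<close>

lemma euler_lagrange_bounded:
  fixes S :: "'a::euclidean_space set"
  assumes S: "open S" "bounded S" and p: "1 < p"
    and EL: "gradient_pairs.euler_lagrange (restrict_space lborel S) p (sobolev_pairs p S) \<mu> h g u G"
    and [measurable]: "g \<in> borel_measurable (restrict_space lborel S)"
    and hK: "(h, K) \<in> sobolev_pairs p S"
    and mu: "0 < \<mu>" and g: "AE x in restrict_space lborel S. 0 \<le> g x \<and> g x \<le> g2"
    and h: "AE x in restrict_space lborel S. \<bar>h x\<bar> \<le> C"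
  shows "AE x in restrict_space lborel S. \<bar>u x\<bar> \<le> C"
proof -
  interpret gradient_pairs "restrict_space lborel S" p "sobolev_pairs p S"
    by (rule gradient_pairs_sobolev[OF S p])
  let ?N = "restrict_space lborel S"
  define F where "F s = soft_excess (s - C) - soft_excess (- s - C)" for s
  define F' where "F' s = soft_slope (s - C) + soft_slope (- s - C)" for s
  have F: "(F has_real_derivative F' s) (at s)" for s
  proof -
    have "((\<lambda>s. soft_excess (s - C)) has_real_derivative soft_slope (s - C) * (1 - 0)) (at s)"
      by (intro DERIV_chain2[OF soft_excess_derivative] DERIV_diff DERIV_ident DERIV_const)
    moreover have "((\<lambda>s. soft_excess (- s - C)) has_real_derivative soft_slope (- s - C) * (- 1 - 0)) (at s)"
      by (intro DERIV_chain2[OF soft_excess_derivative] DERIV_diff DERIV_minus DERIV_ident DERIV_const)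
    ultimately have "((\<lambda>s. soft_excess (s - C) - soft_excess (- s - C)) has_real_derivative
        soft_slope (s - C) * (1 - 0) - soft_slope (- s - C) * (- 1 - 0)) (at s)"
      by (rule DERIV_diff)
    then show ?thesis by (simp add: F_def[abs_def] F'_def)
  qed
  have F0: "F 0 = 0" by (simp add: F_def)
  have F'_range: "0 \<le> F' s" "F' s \<le> 2" for s
    using soft_slope_range[of "s - C"] soft_slope_range[of "- s - C"] by (auto simp: F'_def)
  have F'_Lip: "\<bar>F' s - F' t\<bar> \<le> 2 * \<bar>s - t\<bar>" for s t
    using soft_slope_Lipschitz[of "s - C" "t - C"] soft_slope_Lipschitz[of "- s - C" "- t - C"]
    unfolding F'_def by argo
  have F_le: "\<bar>F s\<bar> \<le> 2 * \<bar>s\<bar>" for s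
  proof -
    have "norm (F s - F 0) \<le> 2 * norm (s - 0)"
      by (rule field_differentiable_bound[of UNIV F F']) (use F F'_range in auto)
    then show ?thesis using F0 by simp
  qed
  have "continuous_on UNIV F"
    using F by (auto intro!: continuous_at_imp_continuous_on DERIV_isCont)
  then have [measurable]: "F \<in> borel_measurable borel" by (rule borel_measurable_continuous_onI)
  have [measurable]: "F' \<in> borel_measurable borel"
    unfolding F'_def[abs_def] soft_slope_def by measurable
  have uG: "(u, G) \<in> sobolev_pairs p S" using EL by (simp add: euler_lagrange_def)
  note [measurable] = V_fun(1)[OF uG] V_grad(1)[OF uG] V_fun(1)[OF hK]
  have FV: "(\<lambda>x. F (u x), \<lambda>x. F' (u x) *\<^sub>R G x) \<in> sobolev_pairs p S"
    unfolding sobolev_pairs_def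
  proof (intro CollectI case_prodI conjI)
    show "(\<lambda>x. F (u x)) \<in> borel_measurable ?N" by measurable
    show "(\<lambda>x. F' (u x) *\<^sub>R G x) \<in> borel_measurable ?N" by measurable
    show "integrable ?N (\<lambda>x. (F (u x))\<^sup>2)"
    proof (rule Bochner_Integration.integrable_bound)
      show "integrable ?N (\<lambda>x. 4 * (u x)\<^sup>2)" using V_fun(2)[OF uG] by simp
      show "AE x in ?N. norm ((F (u x))\<^sup>2) \<le> norm (4 * (u x)\<^sup>2)"
      proof (rule AE_I2)
        fix x
        have "\<bar>F (u x)\<bar>\<^sup>2 \<le> (2 * \<bar>u x\<bar>)\<^sup>2" by (intro power_mono F_le) simp
        then show "norm ((F (u x))\<^sup>2) \<le> norm (4 * (u x)\<^sup>2)" by (simp add: power_mult_distrib)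
      qed
    qed measurable
    show "integrable ?N (\<lambda>x. norm (F' (u x) *\<^sub>R G x) powr p)"
    proof (rule Bochner_Integration.integrable_bound)
      show "integrable ?N (\<lambda>x. 2 powr p * norm (G x) powr p)" using V_grad(2)[OF uG] by simp
      show "AE x in ?N. norm (norm (F' (u x) *\<^sub>R G x) powr p) \<le> norm (2 powr p * norm (G x) powr p)"
      proof (rule AE_I2)
        fix x
        have "norm (F' (u x) *\<^sub>R G x) powr p \<le> (2 * norm (G x)) powr p"
          using F'_range p by (intro powr_mono2) (auto intro!: mult_right_mono)
        then show "norm (norm (F' (u x) *\<^sub>R G x) powr p) \<le> norm (2 powr p * norm (G x) powr p)"
          by (simp add: powr_mult)
      qed
    qed measurable
    have wg: "has_weak_gradient S u G" using uG by (simp add: sobolev_pairs_def)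
    show "has_weak_gradient S (\<lambda>x. F (u x)) (\<lambda>x. F' (u x) *\<^sub>R G x)"
      by (rule has_weak_gradient_chain[OF S(1) wg F F0 _ F'_Lip, of 2]) (use F'_range in simp)
  qed
  have "0 \<le> (LINT x|?N. g x * (pflux p (G x) \<bullet> (F' (u x) *\<^sub>R G x)))"
  proof (rule integral_nonneg_AE)
    show "AE x in ?N. 0 \<le> g x * (pflux p (G x) \<bullet> (F' (u x) *\<^sub>R G x))"
      using g by eventually_elim (use F'_range in \<open>simp add: pflux_inner_self\<close>)
  qed
  also have "\<dots> = (LINT x|?N. (h x - u x) / \<mu> * F (u x))"
    using EL FV by (force simp: euler_lagrange_def)
  finally have ge: "0 \<le> (LINT x|?N. (h x - u x) / \<mu> * F (u x))" .
  have neg: "AE x in ?N. 0 \<le> (u x - h x) / \<mu> * F (u x) \<and> (C < \<bar>u x\<bar> \<longrightarrow> 0 < (u x - h x) / \<mu> * F (u x))"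
    using h
  proof eventually_elim
    case (elim x)
    have C0: "0 \<le> C" using elim by linarith
    consider "C < u x" | "u x < - C" | "\<bar>u x\<bar> \<le> C" by linarith
    then show ?case
    proof cases
      case 1
      have "soft_excess (- u x - C) = 0" "0 < soft_excess (u x - C)"
        using soft_excess_sign[of "- u x - C"] soft_excess_sign[of "u x - C"] 1 C0 by linarith+
      then have "0 < F (u x)" by (simp add: F_def)
      then show ?thesis using 1 elim mu by (simp add: zero_less_mult_iff)
    next
      case 2
      have "soft_excess (u x - C) = 0" "0 < soft_excess (- u x - C)"
        using soft_excess_sign[of "- u x - C"] soft_excess_sign[of "u x - C"] 2 C0 by linarith+
      then have "F (u x) < 0" by (simp add: F_def)
      moreover have "(u x - h x) / \<mu> < 0" using 2 elim mu by (simp add: divide_neg_pos)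
      ultimately have "0 < (u x - h x) / \<mu> * F (u x)" by (intro mult_neg_neg)
      then show ?thesis by (blast intro: less_imp_le)
    next
      case 3
      have "soft_excess (u x - C) = 0" "soft_excess (- u x - C) = 0"
        using soft_excess_sign[of "- u x - C"] soft_excess_sign[of "u x - C"] 3 by linarith+
      then show ?thesis using 3 by (simp add: F_def)
    qed
  qed
  have int: "integrable ?N (\<lambda>x. (u x - h x) / \<mu> * F (u x))"
    using integrable_product_of_squares[of "\<lambda>x. u x - h x" "\<lambda>x. F (u x)"]
      integrable_square_diff[OF V_fun[OF uG] V_fun[OF hK]] V_fun(2)[OF FV] by simp
  have "(LINT x|?N. (u x - h x) / \<mu> * F (u x)) = - (LINT x|?N. (h x - u x) / \<mu> * F (u x))"
  proof -
    have "(LINT x|?N. (u x - h x) / \<mu> * F (u x)) = (LINT x|?N. - ((h x - u x) / \<mu> * F (u x)))"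
      by (intro Bochner_Integration.integral_cong refl) (use mu in \<open>simp add: field_simps\<close>)
    then show ?thesis by simp
  qed
  moreover have nn: "AE x in ?N. 0 \<le> (u x - h x) / \<mu> * F (u x)" using neg by eventually_elim simp
  moreover have "0 \<le> (LINT x|?N. (u x - h x) / \<mu> * F (u x))" by (rule integral_nonneg_AE[OF nn])
  ultimately have "(LINT x|?N. (u x - h x) / \<mu> * F (u x)) = 0" using ge by linarith
  then have "AE x in ?N. (u x - h x) / \<mu> * F (u x) = 0"
    using integral_nonneg_eq_0_iff_AE[OF int nn] by simp
  then show ?thesis
    using neg by eventually_elim (metis less_irrefl not_le)
qed


subsection \<open>Classes and representatives\<close>

lemma L1_rel_refl: "integrable lborel f \<Longrightarrow> L1_rel f f"
  by (simp add: L1_rel_def)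

lemma rep_abs_L1: "integrable lborel f \<Longrightarrow> AE x in lborel. rep_L1 (abs_L1 f) x = f x"
  using Quotient_rep_abs[OF Quotient_L1, of f] by (simp add: L1_rel_def)

lemma abs_rep_L1: "abs_L1 (rep_L1 u) = u"
  by (rule Quotient_abs_rep[OF Quotient_L1])

lemma norm_diff_abs_L1:
  assumes "integrable lborel f" "integrable lborel k"
  shows "norm (abs_L1 f - abs_L1 k) = (LINT x|lborel. \<bar>f x - k x\<bar>)"
  using assms by (simp add: minus_L1.abs_eq norm_L1.abs_eq L1_rel_def)

lemma norm_diff_L1: "norm (u - v) = (LINT x|lborel. \<bar>rep_L1 u x - rep_L1 v x\<bar>)"
  using norm_diff_abs_L1[OF integrable_rep_L1 integrable_rep_L1, of u v] by (simp add: abs_rep_L1)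

definition class_on :: "'a::euclidean_space set \<Rightarrow> ('a \<Rightarrow> real) \<Rightarrow> 'a L1" where
  "class_on S f = abs_L1 (\<lambda>x. indicator S x * f x)"

lemma
  assumes "set_integrable lborel S f"
  shows rep_class_on: "AE x in lborel. rep_L1 (class_on S f) x = indicator S x * f x"
    and class_on_L1_on: "class_on S f \<in> L1_on S"
proof -
  show *: "AE x in lborel. rep_L1 (class_on S f) x = indicator S x * f x"
    unfolding class_on_def using assms by (intro rep_abs_L1) (simp add: set_integrable_def)
  show "class_on S f \<in> L1_on S"
    unfolding L1_on_def using * by (auto elim!: eventually_mono)
qed

lemma norm_diff_class_on:
  fixes S :: "'a::euclidean_space set"
  assumes "S \<in> sets borel" "set_integrable lborel S f" "set_integrable lborel S k"
  shows "norm (class_on S f - class_on S k) = (LINT x|restrict_space lborel S. \<bar>f x - k x\<bar>)"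
proof -
  have "norm (class_on S f - class_on S k) = (LINT x|lborel. \<bar>indicator S x * f x - indicator S x * k x\<bar>)"
    unfolding class_on_def using assms(2,3) by (intro norm_diff_abs_L1) (auto simp: set_integrable_def)
  also have "\<dots> = (LINT x|lborel. indicator S x *\<^sub>R \<bar>f x - k x\<bar>)"
    by (intro Bochner_Integration.integral_cong refl) (auto simp: indicator_def)
  also have "\<dots> = (LINT x|restrict_space lborel S. \<bar>f x - k x\<bar>)"
    using assms(1) by (simp add: integral_restrict_lborel set_lebesgue_integral_def)
  finally show ?thesis .
qed

lemma AE_restrict_lborel:
  "S \<in> sets borel \<Longrightarrow> (AE x in restrict_space lborel S. P x) \<longleftrightarrow> (AE x in lborel. x \<in> S \<longrightarrow> P x)"
  by (subst AE_restrict_space_iff) auto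

text \<open>Bounded Sobolev functions are admissible in the variational problem, whichever version of the
  weak gradient is taken.\<close>

lemma sobolev_pair_of_class:
  fixes S :: "'a::euclidean_space set"
  assumes S: "open S" "bounded S" and \<phi>: "\<phi> \<in> W1p p S \<inter> Linf_on S"
  shows "(rep_L1 \<phi>, weak_grad S \<phi>) \<in> sobolev_pairs p S"
proof -
  have Sb: "S \<in> sets borel" using S by simp
  let ?N = "restrict_space lborel S"
  interpret finite_measure ?N by (rule finite_measure_restrict_lborel[OF S(2) Sb])
  obtain G where G: "has_weak_gradient S (rep_L1 \<phi>) G" "set_integrable lborel S (\<lambda>x. norm (G x) powr p)"
    using \<phi> by (auto simp: W1p_def)
  have wg: "has_weak_gradient S (rep_L1 \<phi>) (weak_grad S \<phi>)"
    unfolding weak_grad_def by (rule someI[of _ G]) (rule G(1))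
  have [measurable]: "rep_L1 \<phi> \<in> borel_measurable ?N" "weak_grad S \<phi> \<in> borel_measurable ?N" "G \<in> borel_measurable ?N"
    using has_weak_gradient_measurable[OF S(1) wg] has_weak_gradient_measurable[OF S(1) G(1)] by auto
  have eq: "AE x in ?N. G x = weak_grad S \<phi> x"
    using has_weak_gradient_unique[OF S(1) G(1) wg] by (simp add: AE_restrict_lborel[OF Sb])
  obtain C where C: "AE x in ?N. \<bar>rep_L1 \<phi> x\<bar> \<le> C"
    using \<phi> by (auto simp: Linf_on_def AE_restrict_lborel[OF Sb])
  have "integrable ?N (\<lambda>x. (rep_L1 \<phi> x)\<^sup>2)"
  proof (rule integrable_const_bound)
    show "AE x in ?N. norm ((rep_L1 \<phi> x)\<^sup>2) \<le> C\<^sup>2"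
      using C by eventually_elim (simp add: abs_le_square_iff[symmetric])
  qed measurable
  moreover have "integrable ?N (\<lambda>x. norm (weak_grad S \<phi> x) powr p)"
  proof (rule integrable_cong_AE_imp)
    show "integrable ?N (\<lambda>x. norm (G x) powr p)" using G(2) by (simp add: integrable_restrict_lborel[OF Sb])
    show "AE x in ?N. norm (G x) powr p = norm (weak_grad S \<phi> x) powr p"
      using eq by eventually_elim simp
  qed measurable
  ultimately show ?thesis using wg by (simp add: sobolev_pairs_def)
qed

lemma class_of_bounded_sobolev_pair:
  fixes S :: "'a::euclidean_space set"
  assumes S: "open S" "bounded S" and p: "1 < p"
    and uG: "(u, G) \<in> sobolev_pairs p S" and C: "AE x in restrict_space lborel S. \<bar>u x\<bar> \<le> C"
  shows "class_on S u \<in> W1p p S \<inter> Linf_on S"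
    and "AE x in restrict_space lborel S. weak_grad S (class_on S u) x = G x"
proof -
  have Sb: "S \<in> sets borel" using S by simp
  let ?N = "restrict_space lborel S"
  interpret gradient_pairs ?N p "sobolev_pairs p S" by (rule gradient_pairs_sobolev[OF S p])
  have int: "set_integrable lborel S u"
    using integrable_of_square[OF V_fun[OF uG]] by (simp add: integrable_restrict_lborel[OF Sb])
  have rep: "AE x in lborel. rep_L1 (class_on S u) x = indicator S x * u x" by (rule rep_class_on[OF int])
  have repN: "AE x in ?N. rep_L1 (class_on S u) x = u x"
    using rep unfolding AE_restrict_lborel[OF Sb] by eventually_elim simp
  have "rep_L1 (class_on S u) \<in> borel_measurable lborel" using integrable_rep_L1 by blast
  then have rm [measurable]: "rep_L1 (class_on S u) \<in> borel_measurable ?N"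
    by (rule measurable_restrict_space1)
  have wg: "has_weak_gradient S (rep_L1 (class_on S u)) G"
  proof (rule has_weak_gradient_cong_AE[OF Sb _ rm V_grad(1)[OF uG]])
    show "has_weak_gradient S u G" using uG by (simp add: sobolev_pairs_def)
    show "AE x in lborel. x \<in> S \<longrightarrow> u x = rep_L1 (class_on S u) x"
      using rep by eventually_elim simp
  qed simp
  have bd: "AE x in ?N. \<bar>rep_L1 (class_on S u) x\<bar> \<le> C" using repN C by eventually_elim simp
  have "integrable ?N (\<lambda>x. \<bar>rep_L1 (class_on S u) x\<bar> powr p)"
  proof (rule integrable_const_bound)
    show "AE x in ?N. norm (\<bar>rep_L1 (class_on S u) x\<bar> powr p) \<le> C powr p"
      using bd by eventually_elim (use p in \<open>auto intro!: powr_mono2\<close>)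
  qed measurable
  moreover have "set_integrable lborel S (\<lambda>x. norm (G x) powr p)"
    using V_grad(2)[OF uG] by (simp add: integrable_restrict_lborel[OF Sb])
  ultimately have "class_on S u \<in> W1p p S"
    unfolding W1p_def using class_on_L1_on[OF int] wg by (auto simp: integrable_restrict_lborel[OF Sb])
  moreover have "class_on S u \<in> Linf_on S"
    unfolding Linf_on_def using class_on_L1_on[OF int] bd by (auto simp: AE_restrict_lborel[OF Sb])
  ultimately show "class_on S u \<in> W1p p S \<inter> Linf_on S" by simp
  have "has_weak_gradient S (rep_L1 (class_on S u)) (weak_grad S (class_on S u))"
    unfolding weak_grad_def by (rule someI[of _ G]) (rule wg)
  from has_weak_gradient_unique[OF S(1) this wg]
  show "AE x in ?N. weak_grad S (class_on S u) x = G x" by (simp add: AE_restrict_lborel[OF Sb])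
qed

lemma ratpoly_sobolev_pair:
  fixes S :: "'a::euclidean_space set"
  assumes S: "open S" "bounded S" and p: "1 < p" and q: "ratpoly q"
  obtains D C where "(q, D) \<in> sobolev_pairs p S" "\<And>x. x \<in> S \<Longrightarrow> \<bar>q x\<bar> \<le> C"
proof -
  have Sb: "S \<in> sets borel" using S by simp
  let ?N = "restrict_space lborel S"
  interpret finite_measure ?N by (rule finite_measure_restrict_lborel[OF S(2) Sb])
  have rq: "real_polynomial_function q" by (rule ratpoly_imp_real_polynomial_function[OF q])
  have cont: "continuous_on UNIV f" if "real_polynomial_function f" for f :: "'a \<Rightarrow> real"
    using continuous_real_polymonial_function[OF that] by (simp add: continuous_at_imp_continuous_on)
  define D where "D x = (\<Sum>i\<in>Basis. frechet_derivative q (at x) i *\<^sub>R i)" for x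
  have cD: "continuous_on UNIV D"
    unfolding D_def by (intro continuous_intros cont real_polynomial_function_partial[OF rq])
  have der: "(q has_derivative (\<lambda>h. D x \<bullet> h)) (at x)" for x
  proof -
    have d: "(q has_derivative frechet_derivative q (at x)) (at x)"
      using differentiable_at_real_polynomial_function[OF rq, of x UNIV] by (simp add: frechet_derivative_works)
    have "frechet_derivative q (at x) h = D x \<bullet> h" for h
    proof -
      have "frechet_derivative q (at x) h = frechet_derivative q (at x) (\<Sum>i\<in>Basis. (h \<bullet> i) *\<^sub>R i)"
        by (simp add: euclidean_representation)
      also have "\<dots> = (\<Sum>i\<in>Basis. (h \<bullet> i) * frechet_derivative q (at x) i)"
        using has_derivative_linear[OF d] by (simp add: linear_sum linear_cmul)
      also have "\<dots> = D x \<bullet> h"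
        unfolding D_def inner_sum_left
        by (intro sum.cong refl) (simp add: inner_commute[of h] mult.commute)
      finally show ?thesis .
    qed
    then have "frechet_derivative q (at x) = (\<lambda>h. D x \<bullet> h)" by (rule ext)
    with d show ?thesis by simp
  qed
  have K: "compact (closure S)" using S by simp
  have bdd: "\<exists>C. \<forall>x\<in>S. norm (f x) \<le> C" if "continuous_on UNIV f" for f :: "'a \<Rightarrow> 'c::euclidean_space"
  proof -
    have "bounded (f ` closure S)"
      by (intro compact_imp_bounded compact_continuous_image continuous_on_subset[OF that] K) simp
    then show ?thesis using closure_subset[of S] by (auto simp: bounded_iff)
  qed
  obtain C where C: "\<forall>x\<in>S. norm (q x) \<le> C" using bdd[OF cont[OF rq]] by blast
  obtain C' where C': "\<forall>x\<in>S. norm (D x) \<le> C'" using bdd[OF cD] by blast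
  have meas [measurable]: "q \<in> borel_measurable ?N" "D \<in> borel_measurable ?N"
    by (auto intro!: measurable_restrict_space1 borel_measurable_continuous_onI cD cont rq)
  have sp: "x \<in> space ?N \<Longrightarrow> x \<in> S" for x by (simp add: space_restrict_space)
  have "integrable ?N (\<lambda>x. (q x)\<^sup>2)"
  proof (rule integrable_const_bound)
    show "AE x in ?N. norm ((q x)\<^sup>2) \<le> C\<^sup>2"
    proof (rule AE_I2)
      fix x assume "x \<in> space ?N"
      then have "\<bar>q x\<bar> \<le> C" using C sp by auto
      then have "\<bar>q x\<bar>\<^sup>2 \<le> C\<^sup>2" by (intro power_mono) auto
      then show "norm ((q x)\<^sup>2) \<le> C\<^sup>2" by simp
    qed
  qed measurable
  moreover have "integrable ?N (\<lambda>x. norm (D x) powr p)"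
  proof (rule integrable_const_bound)
    show "AE x in ?N. norm (norm (D x) powr p) \<le> C' powr p"
      using C' sp p by (intro AE_I2) (auto intro!: powr_mono2)
  qed measurable
  moreover have "has_weak_gradient S q D" by (rule C1_has_weak_gradient[OF der cD])
  ultimately have "(q, D) \<in> sobolev_pairs p S" using meas by (simp add: sobolev_pairs_def)
  with C that show ?thesis by auto
qed

subsection \<open>The solution as a function of the weight\<close>

lemma measurable_rep_L1: "rep_L1 \<gamma> \<in> borel_measurable (restrict_space lborel S)"
  by (rule measurable_restrict_space1[OF borel_measurable_integrable[OF integrable_rep_L1]])

text \<open>
  Truncating the weight to \<open>[g1, g2]\<close> extends the solution map to all of \<open>L\<^sup>1\<close> without spoiling its
  continuity; so its composition with a random weight is measurable.  The distance to the polynomial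
  \<open>q\<close> is controlled by \<open>\<mu>\<close> uniformly in the weight.
\<close>

lemma solution_map:
  fixes S :: "'a::euclidean_space set"
  assumes S: "open S" "bounded S" and p: "1 < p" and g12: "0 < g1" "g1 \<le> g2"
    and q: "ratpoly q" and e: "0 < e"
  obtains \<Phi> \<Psi> :: "'a L1 \<Rightarrow> 'a L1" and c where
    "continuous_on UNIV \<Phi>" "continuous_on UNIV \<Psi>"
    "\<And>\<gamma>. \<Phi> \<gamma> \<in> L1_on S" "\<And>\<gamma>. \<Psi> \<gamma> \<in> L1_on S"
    "\<And>\<gamma>. norm (class_on S q - \<Phi> \<gamma>) < e" "\<And>\<gamma>. norm (\<Psi> \<gamma>) \<le> c"
    "\<And>\<gamma>. \<Phi> \<gamma> \<in> W1p p S \<inter> Linf_on S"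
    "\<And>\<gamma> \<phi>. \<gamma> \<in> L1_between g1 g2 S \<Longrightarrow> \<phi> \<in> W1p p S \<inter> Linf_on S \<Longrightarrow>
      (LINT x:S|lborel. rep_L1 \<gamma> x *
            ((norm (weak_grad S (\<Phi> \<gamma>) x) powr (p - 2) *\<^sub>R weak_grad S (\<Phi> \<gamma>) x) \<bullet> weak_grad S \<phi> x))
          = (LINT x:S|lborel. rep_L1 (\<Psi> \<gamma>) x * rep_L1 \<phi> x)"
proof -
  have Sb: "S \<in> sets borel" using S by simp
  let ?N = "restrict_space lborel S"
  interpret gradient_pairs ?N p "sobolev_pairs p S" by (rule gradient_pairs_sobolev[OF S p])
  have p0: "0 < p" using p by simp
  obtain D C where D: "(q, D) \<in> sobolev_pairs p S" "\<And>x. x \<in> S \<Longrightarrow> \<bar>q x\<bar> \<le> C"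
    using ratpoly_sobolev_pair[OF S p q] by blast
  note [measurable] = V_fun(1)[OF D(1)] measurable_rep_L1
  define A where "A = measure ?N (space ?N)"
  have A: "0 \<le> A" by (simp add: A_def)
  define E where "E = g2 / p * (LINT x|?N. norm (D x) powr p)"
  have E: "0 \<le> E" using g12 p0 by (simp add: E_def)
  define d where "d = e / (2 * (A + 1))"
  have d: "0 < d" using e A by (simp add: d_def)
  have dA: "d * A < e / 2"
  proof -
    have "e * A < e * (A + 1)" using e by simp
    then show ?thesis using A by (simp add: d_def field_simps)
  qed
  \<comment> \<open>the energy bound \<open>\<mu> * E\<close> for the squared distance must give at most \<open>e / 2\<close> after division by \<open>d\<close>\<close>
  define \<mu> where "\<mu> = d * e / (2 * (E + 1))"
  have mu: "0 < \<mu>" using d e E by (simp add: \<mu>_def)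
  have \<mu>E: "\<mu> * E / d \<le> e / 2"
  proof -
    have "d * e / (2 * k) * E / d = e / 2 * (E / k)" if "0 < k" for k
      using d that by (simp add: field_simps)
    from this[of "E + 1"] have "\<mu> * E / d = e / 2 * (E / (E + 1))" using E by (simp add: \<mu>_def)
    also have "\<dots> \<le> e / 2 * 1" using e E by (intro mult_left_mono) auto
    finally show ?thesis by simp
  qed
  define wt where "wt \<gamma> x = max g1 (min g2 (rep_L1 \<gamma> x))" for \<gamma> :: "'a L1" and x
  have wt_m [measurable]: "wt \<gamma> \<in> borel_measurable ?N" for \<gamma> unfolding wt_def[abs_def] by measurable
  have wt_range: "AE x in ?N. g1 \<le> wt \<gamma> x \<and> wt \<gamma> x \<le> g2" for \<gamma> using g12 by (auto simp: wt_def)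
  have wt_nonneg: "AE x in ?N. 0 \<le> wt \<gamma> x \<and> wt \<gamma> x \<le> g2" for \<gamma> using g12 by (auto simp: wt_def)
  have "\<exists>z. euler_lagrange \<mu> q (wt \<gamma>) (fst z) (snd z)" for \<gamma>
    using euler_lagrange_exists[OF wt_m V_fun[OF D(1)] mu g12(1) wt_range] by auto
  then obtain sol where sol: "\<And>\<gamma>. euler_lagrange \<mu> q (wt \<gamma>) (fst (sol \<gamma>)) (snd (sol \<gamma>))" by metis
  define u where "u \<gamma> = fst (sol \<gamma>)" for \<gamma>
  define G where "G \<gamma> = snd (sol \<gamma>)" for \<gamma>
  have EL: "euler_lagrange \<mu> q (wt \<gamma>) (u \<gamma>) (G \<gamma>)" for \<gamma> using sol by (simp add: u_def G_def)
  have uG: "(u \<gamma>, G \<gamma>) \<in> sobolev_pairs p S" for \<gamma> using EL[of \<gamma>] by (simp add: euler_lagrange_def)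
  note [measurable] = V_fun(1)[OF uG] V_grad(1)[OF uG]
  have int: "set_integrable lborel S f" if "f \<in> borel_measurable ?N" "integrable ?N (\<lambda>x. (f x)\<^sup>2)" for f :: "'a \<Rightarrow> real"
    using integrable_of_square[OF that] by (simp add: integrable_restrict_lborel[OF Sb])
  have int_u: "set_integrable lborel S (u \<gamma>)" for \<gamma> by (rule int[OF V_fun[OF uG]])
  have int_q: "set_integrable lborel S q" by (rule int[OF V_fun[OF D(1)]])
  have bd: "AE x in ?N. \<bar>u \<gamma> x\<bar> \<le> C" for \<gamma>
  proof (rule euler_lagrange_bounded[OF S p EL wt_m D(1) mu wt_nonneg])
    show "AE x in ?N. \<bar>q x\<bar> \<le> C" using D(2) by (intro AE_I2) (simp add: space_restrict_space)
  qed
  define \<Phi> where "\<Phi> \<gamma> = class_on S (u \<gamma>)" for \<gamma>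
  define \<Psi> where "\<Psi> \<gamma> = (1 / \<mu>) *\<^sub>R (class_on S q - \<Phi> \<gamma>)" for \<gamma>
  have close: "norm (class_on S q - \<Phi> \<gamma>) < e" for \<gamma>
  proof -
    have sq: "integrable ?N (\<lambda>x. (u \<gamma> x - q x)\<^sup>2)"
      by (rule integrable_square_diff[OF V_fun[OF uG] V_fun[OF D(1)]])
    have "0 \<le> g1 / p * (LINT x|?N. norm (G \<gamma> x) powr p)" using g12 p0 by simp
    then have "(LINT x|?N. (u \<gamma> x - q x)\<^sup>2) / \<mu> \<le> E"
      using euler_lagrange_energy_bound[OF EL[of \<gamma>] D(1) wt_m mu g12(1) wt_range] unfolding E_def by linarith
    then have "(LINT x|?N. (u \<gamma> x - q x)\<^sup>2) \<le> \<mu> * E" using mu by (simp add: field_simps)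
    then have "(LINT x|?N. (u \<gamma> x - q x)\<^sup>2) / d \<le> \<mu> * E / d" using d by (intro divide_right_mono) auto
    moreover have "(LINT x|?N. \<bar>u \<gamma> x - q x\<bar>) \<le> d * A + (LINT x|?N. (u \<gamma> x - q x)\<^sup>2) / d"
      unfolding A_def by (rule integral_abs_le_square[OF _ sq d]) measurable
    moreover have "norm (class_on S q - \<Phi> \<gamma>) = (LINT x|?N. \<bar>u \<gamma> x - q x\<bar>)"
      unfolding \<Phi>_def using norm_diff_class_on[OF Sb int_q int_u, of \<gamma>] by (simp add: abs_minus_commute)
    ultimately show ?thesis using dA \<mu>E by linarith
  qed
  have cont: "continuous_on UNIV \<Phi>"
    unfolding continuous_on_iff
  proof (intro ballI allI impI)
    fix \<gamma> :: "'a L1" and t :: real assume t: "0 < t"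
    show "\<exists>\<delta>>0. \<forall>\<gamma>'\<in>UNIV. dist \<gamma>' \<gamma> < \<delta> \<longrightarrow> dist (\<Phi> \<gamma>') (\<Phi> \<gamma>) < t"
    proof (rule euler_lagrange_continuous_in_weight[OF EL[of \<gamma>] D(1) wt_m mu g12(1) wt_range t])
      fix \<delta> :: real
      assume \<delta>: "0 < \<delta>" "\<And>g' v H. g' \<in> borel_measurable ?N \<Longrightarrow>
      AE x in ?N. g1 \<le> g' x \<and> g' x \<le> g2 \<Longrightarrow> euler_lagrange \<mu> q g' v H \<Longrightarrow>
      (LINT x|?N. \<bar>wt \<gamma> x - g' x\<bar>) < \<delta> \<Longrightarrow> (LINT x|?N. \<bar>u \<gamma> x - v x\<bar>) < t"
      have "dist (\<Phi> \<gamma>') (\<Phi> \<gamma>) < t" if "dist \<gamma>' \<gamma> < \<delta>" for \<gamma>'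
      proof -
        have int_rep: "integrable lborel (\<lambda>x. \<bar>rep_L1 \<gamma> x - rep_L1 \<gamma>' x\<bar>)"
          using integrable_rep_L1[of \<gamma>] integrable_rep_L1[of \<gamma>'] by simp
        have "(LINT x|?N. \<bar>wt \<gamma> x - wt \<gamma>' x\<bar>) = (LINT x|lborel. indicator S x *\<^sub>R \<bar>wt \<gamma> x - wt \<gamma>' x\<bar>)"
          by (simp add: integral_restrict_lborel[OF Sb] set_lebesgue_integral_def)
        also have "\<dots> \<le> (LINT x|lborel. \<bar>rep_L1 \<gamma> x - rep_L1 \<gamma>' x\<bar>)"
          by (rule integral_mono'[OF int_rep]) (auto simp: wt_def indicator_def)
        also have "\<dots> < \<delta>" using that by (simp add: dist_norm norm_minus_commute norm_diff_L1[symmetric])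
        finally have "(LINT x|?N. \<bar>u \<gamma> x - u \<gamma>' x\<bar>) < t" by (rule \<delta>(2)[OF wt_m wt_range EL])
        then show ?thesis
          unfolding \<Phi>_def dist_norm using norm_diff_class_on[OF Sb int_u int_u, of \<gamma> \<gamma>']
          by (simp add: norm_minus_commute)
      qed
      with \<delta>(1) show "\<exists>\<delta>>0. \<forall>\<gamma>'\<in>UNIV. dist \<gamma>' \<gamma> < \<delta> \<longrightarrow> dist (\<Phi> \<gamma>') (\<Phi> \<gamma>) < t"
        by blast
    qed
  qed
  have \<Phi>W: "\<Phi> \<gamma> \<in> W1p p S \<inter> Linf_on S" for \<gamma>
    unfolding \<Phi>_def by (rule class_of_bounded_sobolev_pair(1)[OF S p uG bd])
  have \<Psi>_eq: "\<Psi> \<gamma> = class_on S (\<lambda>x. (q x - u \<gamma> x) / \<mu>)" for \<gamma>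
  proof -
    have 1: "integrable lborel (\<lambda>x. indicator S x * q x)" "integrable lborel (\<lambda>x. indicator S x * u \<gamma> x)"
      using int_q int_u by (auto simp: set_integrable_def)
    have "class_on S q - \<Phi> \<gamma> = abs_L1 (\<lambda>x. indicator S x * q x - indicator S x * u \<gamma> x)"
      unfolding \<Phi>_def class_on_def by (intro minus_L1.abs_eq L1_rel_refl 1)
    then have "\<Psi> \<gamma> = abs_L1 (\<lambda>x. (1 / \<mu>) * (indicator S x * q x - indicator S x * u \<gamma> x))"
      unfolding \<Psi>_def using 1 by (simp only:) (intro scaleR_L1.abs_eq L1_rel_refl; simp)
    moreover have "(\<lambda>x. (1 / \<mu>) * (indicator S x * q x - indicator S x * u \<gamma> x))
        = (\<lambda>x. indicator S x * ((q x - u \<gamma> x) / \<mu>))"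
      by (intro ext) (auto simp: indicator_def)
    ultimately show ?thesis by (simp add: class_on_def)
  qed
  have int_\<psi>: "set_integrable lborel S (\<lambda>x. (q x - u \<gamma> x) / \<mu>)" for \<gamma>
    using int_q int_u[of \<gamma>] by (intro set_integrable_divide set_integral_diff) auto
  show ?thesis
  proof (rule that)
    show "continuous_on UNIV \<Phi>" by (rule cont)
    show "continuous_on UNIV \<Psi>" unfolding \<Psi>_def by (intro continuous_intros cont)
    show "\<Phi> \<gamma> \<in> L1_on S" for \<gamma> using \<Phi>W by (simp add: W1p_def)
    show "\<Psi> \<gamma> \<in> L1_on S" for \<gamma> unfolding \<Psi>_eq by (rule class_on_L1_on[OF int_\<psi>])
    show "norm (class_on S q - \<Phi> \<gamma>) < e" for \<gamma> by (rule close)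
    show "norm (\<Psi> \<gamma>) \<le> e / \<mu>" for \<gamma>
      unfolding \<Psi>_def using close[of \<gamma>] mu by (simp add: divide_right_mono)
    show "\<Phi> \<gamma> \<in> W1p p S \<inter> Linf_on S" for \<gamma> by (rule \<Phi>W)
    fix \<gamma> \<phi> assume \<gamma>: "\<gamma> \<in> L1_between g1 g2 S" and \<phi>: "\<phi> \<in> W1p p S \<inter> Linf_on S"
    have \<phi>V: "(rep_L1 \<phi>, weak_grad S \<phi>) \<in> sobolev_pairs p S" by (rule sobolev_pair_of_class[OF S \<phi>])
    have \<Phi>V: "(rep_L1 (\<Phi> \<gamma>), weak_grad S (\<Phi> \<gamma>)) \<in> sobolev_pairs p S"
      by (rule sobolev_pair_of_class[OF S \<Phi>W])
    note [measurable] = V_grad(1)[OF \<phi>V] V_grad(1)[OF \<Phi>V] pflux_borel_measurable[OF p]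
    have wg: "AE x in ?N. weak_grad S (\<Phi> \<gamma>) x = G \<gamma> x"
      unfolding \<Phi>_def by (rule class_of_bounded_sobolev_pair(2)[OF S p uG bd])
    have wt: "AE x in ?N. wt \<gamma> x = rep_L1 \<gamma> x"
      using \<gamma> by (auto simp: L1_between_def AE_restrict_lborel[OF Sb] wt_def elim!: eventually_mono)
    have rep\<Psi>: "AE x in ?N. rep_L1 (\<Psi> \<gamma>) x = (q x - u \<gamma> x) / \<mu>"
      using rep_class_on[OF int_\<psi>, of \<gamma>] unfolding \<Psi>_eq AE_restrict_lborel[OF Sb] by eventually_elim simp
    have "(LINT x:S|lborel. rep_L1 \<gamma> x * ((norm (weak_grad S (\<Phi> \<gamma>) x) powr (p - 2) *\<^sub>R weak_grad S (\<Phi> \<gamma>) x) \<bullet> weak_grad S \<phi> x))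
       = (LINT x|?N. rep_L1 \<gamma> x * (pflux p (weak_grad S (\<Phi> \<gamma>) x) \<bullet> weak_grad S \<phi> x))"
      by (simp add: integral_restrict_lborel[OF Sb] pflux_def)
    also have "\<dots> = (LINT x|?N. wt \<gamma> x * (pflux p (G \<gamma> x) \<bullet> weak_grad S \<phi> x))"
    proof (rule integral_cong_AE)
      show "AE x in ?N. rep_L1 \<gamma> x * (pflux p (weak_grad S (\<Phi> \<gamma>) x) \<bullet> weak_grad S \<phi> x)
        = wt \<gamma> x * (pflux p (G \<gamma> x) \<bullet> weak_grad S \<phi> x)"
        using wg wt by eventually_elim simp
    qed measurable
    also have "\<dots> = (LINT x|?N. (q x - u \<gamma> x) / \<mu> * rep_L1 \<phi> x)"
      using EL[of \<gamma>] \<phi>V by (force simp: euler_lagrange_def)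
    also have "\<dots> = (LINT x|?N. rep_L1 (\<Psi> \<gamma>) x * rep_L1 \<phi> x)"
    proof (rule integral_cong_AE)
      show "AE x in ?N. (q x - u \<gamma> x) / \<mu> * rep_L1 \<phi> x = rep_L1 (\<Psi> \<gamma>) x * rep_L1 \<phi> x"
        using rep\<Psi> by eventually_elim simp
    qed measurable
    also have "\<dots> = (LINT x:S|lborel. rep_L1 (\<Psi> \<gamma>) x * rep_L1 \<phi> x)"
      by (simp add: integral_restrict_lborel[OF Sb])
    finally show "(LINT x:S|lborel. rep_L1 \<gamma> x *
            ((norm (weak_grad S (\<Phi> \<gamma>) x) powr (p - 2) *\<^sub>R weak_grad S (\<Phi> \<gamma>) x) \<bullet> weak_grad S \<phi> x))
          = (LINT x:S|lborel. rep_L1 (\<Psi> \<gamma>) x * rep_L1 \<phi> x)" .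
  qed
qed


section \<open>Random weights\<close>

text \<open>
  A random element is within \<open>d\<close> of the first member of the dense sequence that comes so close to
  it.  Beyond a large index, where little of its mean is left, the polynomial zero is taken instead,
  so that only finitely many solution maps occur and the images under the operator stay bounded.
\<close>

theorem Domain_plap_op_dense:
  fixes M :: "'w measure" and S :: "'a::euclidean_space set" and g :: "'w \<Rightarrow> 'a L1"
  assumes S: "open S" "bounded S" and p: "1 < p" and g12: "0 < g1" "g1 \<le> g2"
    and M: "prob_space M" and gr: "g \<in> rv_L1 M S" and g: "AE \<omega> in M. g \<omega> \<in> L1_between g1 g2 S"
  shows "rv_dense M S (Domain (plap_op M p S g))"
  unfolding rv_dense_def
proof (intro conjI ballI allI impI)
  show "Domain (plap_op M p S g) \<subseteq> rv_L1 M S" by (auto simp: plap_op_def)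
  interpret prob_space M by (rule M)
  have Sb: "S \<in> sets borel" using S by simp
  fix f :: "'w \<Rightarrow> 'a L1" and \<epsilon> :: real assume f: "f \<in> rv_L1 M S" and eps: "0 < \<epsilon>"
  have fm [measurable]: "f \<in> borel_measurable M" and f_on: "\<And>\<omega>. \<omega> \<in> space M \<Longrightarrow> f \<omega> \<in> L1_on S"
    and f_int: "integrable M (\<lambda>\<omega>. norm (f \<omega>))" using f by (auto simp: rv_L1_def)
  have gm [measurable]: "g \<in> borel_measurable M" using gr by (simp add: rv_L1_def)
  define d where "d = \<epsilon> / 4"
  have d: "0 < d" using eps by (simp add: d_def)
  have const0: "ratpoly (\<lambda>x::'a. of_rat 0)" by (rule ratpoly.const)
  define q where "q = from_nat_into {q :: 'a \<Rightarrow> real. ratpoly q}"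
  have q: "ratpoly (q i)" for i
    using from_nat_into[of "{q :: 'a \<Rightarrow> real. ratpoly q}" i] const0 by (auto simp: q_def)
  have q_onto: "\<exists>i. q i = r" if "ratpoly r" for r
    using from_nat_into_surj[OF countable_ratpoly, of r] that by (auto simp: q_def)
  obtain z where z: "q z = (\<lambda>x. of_rat 0)" using q_onto[OF const0] by blast
  have z0: "class_on S (q z) = 0" by (simp add: z class_on_def zero_L1_def)
  define solves where "solves i s \<longleftrightarrow>
      continuous_on UNIV (fst s) \<and> continuous_on UNIV (fst (snd s)) \<and>
      (\<forall>\<gamma>. fst s \<gamma> \<in> L1_on S \<and> fst (snd s) \<gamma> \<in> L1_on S \<and> norm (class_on S (q i) - fst s \<gamma>) < d \<and>
        norm (fst (snd s) \<gamma>) \<le> snd (snd s) \<and> fst s \<gamma> \<in> W1p p S \<inter> Linf_on S \<and>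
        (\<gamma> \<in> L1_between g1 g2 S \<longrightarrow> (\<forall>\<phi> \<in> W1p p S \<inter> Linf_on S.
          (LINT x:S|lborel. rep_L1 \<gamma> x *
            ((norm (weak_grad S (fst s \<gamma>) x) powr (p - 2) *\<^sub>R weak_grad S (fst s \<gamma>) x) \<bullet> weak_grad S \<phi> x))
          = (LINT x:S|lborel. rep_L1 (fst (snd s) \<gamma>) x * rep_L1 \<phi> x))))"
    for i and s :: "('a L1 \<Rightarrow> 'a L1) \<times> ('a L1 \<Rightarrow> 'a L1) \<times> real"
  have "\<exists>s. solves i s" for i
  proof (rule solution_map[OF S p g12 q[of i] d], goal_cases)
    case (1 \<Phi> \<Psi> c)
    then show ?case by (intro exI[of _ "(\<Phi>, \<Psi>, c)"]) (simp add: solves_def)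
  qed
  then have "\<forall>i. \<exists>s. solves i s" by blast
  from choice[OF this] obtain s where s: "\<And>i. solves i (s i)" by blast
  define \<Phi> where "\<Phi> i = fst (s i)" for i
  define \<Psi> where "\<Psi> i = fst (snd (s i))" for i
  define c where "c i = snd (snd (s i))" for i
  note s = s[unfolded solves_def, folded \<Phi>_def \<Psi>_def c_def]
  have \<Phi>m [measurable]: "\<Phi> i \<in> borel_measurable borel" and \<Psi>m [measurable]: "\<Psi> i \<in> borel_measurable borel" for i
    using s[of i] by (auto intro: borel_measurable_continuous_onI)
  define near where "near i \<omega> \<longleftrightarrow> f \<omega> \<in> ball (class_on S (q i)) d" for i \<omega>
  define N where "N \<omega> = (LEAST i. near i \<omega>)" for \<omega>
  have near_m [measurable]: "Measurable.pred M (near i)" for i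
  proof -
    have "f -` ball (class_on S (q i)) d \<inter> space M \<in> sets M"
      by (rule measurable_sets[OF fm]) (simp add: borel_open)
    moreover have "f -` ball (class_on S (q i)) d \<inter> space M = {\<omega> \<in> space M. near i \<omega>}"
      by (auto simp: near_def)
    ultimately show ?thesis by (simp add: pred_def)
  qed
  have N_m [measurable]: "N \<in> measurable M (count_space UNIV)" unfolding N_def by measurable
  have near_N: "near (N \<omega>) \<omega>" if "\<omega> \<in> space M" for \<omega>
  proof -
    obtain r where r: "ratpoly r" "(LINT x|lborel. indicator S x * \<bar>rep_L1 (f \<omega>) x - r x\<bar>) < d"
      using ratpoly_dense_L1[OF integrable_rep_L1 S(2) Sb d] by blast
    obtain i where i: "q i = r" using q_onto[OF r(1)] by blast
    obtain D C where D: "(r, D) \<in> sobolev_pairs p S" using ratpoly_sobolev_pair[OF S p r(1)] by blast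
    interpret gradient_pairs "restrict_space lborel S" p "sobolev_pairs p S"
      by (rule gradient_pairs_sobolev[OF S p])
    have int_r: "set_integrable lborel S r"
      using integrable_of_square[OF V_fun[OF D]] by (simp add: integrable_restrict_lborel[OF Sb])
    have "norm (f \<omega> - class_on S r) = (LINT x|lborel. \<bar>rep_L1 (f \<omega>) x - indicator S x * r x\<bar>)"
      using norm_diff_abs_L1[OF integrable_rep_L1[of "f \<omega>"], of "\<lambda>x. indicator S x * r x"] int_r
      by (simp add: abs_rep_L1 class_on_def set_integrable_def)
    also have "\<dots> = (LINT x|lborel. indicator S x * \<bar>rep_L1 (f \<omega>) x - r x\<bar>)"
    proof (rule integral_cong_AE)
      have [measurable]: "rep_L1 (f \<omega>) \<in> borel_measurable lborel" using integrable_rep_L1 by blast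
      have [measurable]: "r \<in> borel_measurable lborel"
        using continuous_real_polymonial_function[OF ratpoly_imp_real_polynomial_function[OF r(1)]]
        by (auto intro!: borel_measurable_continuous_onI continuous_at_imp_continuous_on)
      note [measurable] = Sb
      show "(\<lambda>x. \<bar>rep_L1 (f \<omega>) x - indicator S x * r x\<bar>) \<in> borel_measurable lborel"
        "(\<lambda>x. indicator S x * \<bar>rep_L1 (f \<omega>) x - r x\<bar>) \<in> borel_measurable lborel" by measurable
      show "AE x in lborel. \<bar>rep_L1 (f \<omega>) x - indicator S x * r x\<bar> = indicator S x * \<bar>rep_L1 (f \<omega>) x - r x\<bar>"
        using f_on[OF that] unfolding L1_on_def by (auto elim!: eventually_mono simp: indicator_def)
    qed
    finally have "near i \<omega>" using r(2) by (simp add: near_def i dist_norm norm_minus_commute)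
    then show ?thesis unfolding N_def by (rule LeastI)
  qed
  have "(\<lambda>n. LINT \<omega>|M. indicator {\<omega> \<in> space M. n \<le> N \<omega>} \<omega> * norm (f \<omega>)) \<longlonglongrightarrow> 0"
  proof (rule integral_tail_tendsto_zero[OF f_int])
    show "{\<omega> \<in> space M. n \<le> N \<omega>} \<in> sets M" for n by measurable
    have "\<forall>\<^sub>F n in sequentially. \<omega> \<notin> {\<omega> \<in> space M. n \<le> N \<omega>}" for \<omega>
      using eventually_gt_at_top[of "N \<omega>"] by eventually_elim simp
    then show "AE \<omega> in M. \<forall>\<^sub>F n in sequentially. \<omega> \<notin> {\<omega> \<in> space M. n \<le> N \<omega>}" by simp
  qed
  from LIMSEQ_D[OF this d] obtain n where
    n: "(LINT \<omega>|M. indicator {\<omega> \<in> space M. n \<le> N \<omega>} \<omega> * norm (f \<omega>)) < d" by fastforce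
  define j where "j \<omega> = (if N \<omega> < n then N \<omega> else z)" for \<omega>
  have j_m [measurable]: "j \<in> measurable M (count_space UNIV)" unfolding j_def by measurable
  define u where "u \<omega> = \<Phi> (j \<omega>) (g \<omega>)" for \<omega>
  define u' where "u' \<omega> = \<Psi> (j \<omega>) (g \<omega>)" for \<omega>
  have um [measurable]: "u \<in> borel_measurable M"
    unfolding u_def by (rule measurable_compose_countable[OF _ j_m]) measurable
  have u'm [measurable]: "u' \<in> borel_measurable M"
    unfolding u'_def by (rule measurable_compose_countable[OF _ j_m]) measurable
  have dist_le: "norm (f \<omega> - u \<omega>) \<le> 2 * d + indicator {\<omega> \<in> space M. n \<le> N \<omega>} \<omega> * norm (f \<omega>)"
    if \<omega>: "\<omega> \<in> space M" for \<omega>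
  proof -
    have close: "norm (class_on S (q (j \<omega>)) - u \<omega>) < d" using s by (simp add: u_def)
    have tri: "norm (f \<omega> - u \<omega>) \<le> norm (f \<omega> - class_on S (q (j \<omega>))) + norm (class_on S (q (j \<omega>)) - u \<omega>)"
      using norm_triangle_ineq[of "f \<omega> - class_on S (q (j \<omega>))" "class_on S (q (j \<omega>)) - u \<omega>"] by simp
    show ?thesis
    proof (cases "N \<omega> < n")
      case True
      have "norm (f \<omega> - class_on S (q (j \<omega>))) < d"
        using near_N[OF \<omega>] True by (simp add: near_def j_def dist_norm norm_minus_commute)
      then show ?thesis using tri close True by simp
    next
      case False
      then have "class_on S (q (j \<omega>)) = 0" by (simp add: j_def z0)
      then show ?thesis using tri close False \<omega> d by simp
    qed
  qed
  have u_rv: "u \<in> rv_L1 M S"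
    unfolding rv_L1_def
  proof (intro CollectI conjI ballI um)
    show "u \<omega> \<in> L1_on S" for \<omega> using s by (simp add: u_def)
    show "integrable M (\<lambda>\<omega>. norm (u \<omega>))"
    proof (rule Bochner_Integration.integrable_bound)
      show "integrable M (\<lambda>\<omega>. 2 * d + 2 * norm (f \<omega>))" using f_int by simp
      show "AE \<omega> in M. norm (norm (u \<omega>)) \<le> norm (2 * d + 2 * norm (f \<omega>))"
      proof (rule AE_I2)
        fix \<omega> assume \<omega>: "\<omega> \<in> space M"
        have "norm (u \<omega>) \<le> norm (f \<omega>) + norm (f \<omega> - u \<omega>)"
          using norm_triangle_ineq4[of "f \<omega>" "f \<omega> - u \<omega>"] by simp
        also have "norm (f \<omega> - u \<omega>) \<le> 2 * d + norm (f \<omega>)"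
          using dist_le[OF \<omega>] by (rule order_trans) (simp add: indicator_def)
        finally show "norm (norm (u \<omega>)) \<le> norm (2 * d + 2 * norm (f \<omega>))" using d by simp
      qed
    qed measurable
  qed
  have u'_rv: "u' \<in> rv_L1 M S"
    unfolding rv_L1_def
  proof (intro CollectI conjI ballI u'm)
    show "u' \<omega> \<in> L1_on S" for \<omega> using s by (simp add: u'_def)
    define b where "b = (\<Sum>i\<in>insert z {..<n}. \<bar>c i\<bar>)"
    show "integrable M (\<lambda>\<omega>. norm (u' \<omega>))"
    proof (rule integrable_const_bound)
      show "AE \<omega> in M. norm (norm (u' \<omega>)) \<le> b"
      proof (rule AE_I2)
        fix \<omega>
        have "norm (u' \<omega>) \<le> c (j \<omega>)" using s by (simp add: u'_def)
        also have "\<dots> \<le> \<bar>c (j \<omega>)\<bar>" by simp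
        also have "\<dots> \<le> b"
          unfolding b_def by (rule member_le_sum) (auto simp: j_def)
        finally show "norm (norm (u' \<omega>)) \<le> b" by simp
      qed
    qed measurable
  qed
  have "(u, u') \<in> plap_op M p S g"
    unfolding plap_op_def
  proof (intro CollectI case_prodI conjI u_rv u'_rv)
    show "AE \<omega> in M. u \<omega> \<in> W1p p S \<inter> Linf_on S" using s by (intro AE_I2) (simp add: u_def)
    show "AE \<omega> in M. \<forall>\<phi> \<in> W1p p S \<inter> Linf_on S.
        (LINT x:S|lborel. rep_L1 (g \<omega>) x *
            ((norm (weak_grad S (u \<omega>) x) powr (p - 2) *\<^sub>R weak_grad S (u \<omega>) x) \<bullet> weak_grad S \<phi> x))
          = (LINT x:S|lborel. rep_L1 (u' \<omega>) x * rep_L1 \<phi> x)"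
      using g by eventually_elim (unfold u_def u'_def, use s in blast)
  qed
  moreover have "rv_norm M (\<lambda>\<omega>. f \<omega> - u \<omega>) < \<epsilon>"
  proof -
    have tail: "integrable M (\<lambda>\<omega>. indicator {\<omega> \<in> space M. n \<le> N \<omega>} \<omega> * norm (f \<omega>))"
      using integrable_mult_indicator[of "{\<omega> \<in> space M. n \<le> N \<omega>}" M "\<lambda>\<omega>. norm (f \<omega>)"] f_int by simp
    have "rv_norm M (\<lambda>\<omega>. f \<omega> - u \<omega>) \<le> (LINT \<omega>|M. 2 * d + indicator {\<omega> \<in> space M. n \<le> N \<omega>} \<omega> * norm (f \<omega>))"
      unfolding rv_norm_def using tail d dist_le by (intro integral_mono') auto
    also have "\<dots> = 2 * d + (LINT \<omega>|M. indicator {\<omega> \<in> space M. n \<le> N \<omega>} \<omega> * norm (f \<omega>))"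
      using tail by (simp add: prob_space)
    finally show ?thesis using n eps by (simp add: d_def)
  qed
  ultimately show "\<exists>u\<in>Domain (plap_op M p S g). rv_norm M (\<lambda>\<omega>. f \<omega> - u \<omega>) < \<epsilon>" by blast
qed

lemma subset_rv_closure:
  assumes "B \<subseteq> rv_L1 M S \<times> rv_L1 M S"
  shows "B \<subseteq> rv_closure M S B"
proof
  fix w assume w: "w \<in> B"
  obtain f f' where ff: "w = (f, f')" by (cases w)
  have "rv_norm M (\<lambda>\<omega>. v \<omega> - v \<omega>) = 0" for v :: "'a \<Rightarrow> 'b L1" by (simp add: rv_norm_def)
  then have "\<forall>\<epsilon>>0. \<exists>(u, u')\<in>B. rv_norm M (\<lambda>\<omega>. f \<omega> - u \<omega>) < \<epsilon> \<and> rv_norm M (\<lambda>\<omega>. f' \<omega> - u' \<omega>) < \<epsilon>"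
    using w by (auto simp: ff intro!: bexI[of _ "(f, f')"])
  then show "w \<in> rv_closure M S B" using w assms by (auto simp: rv_closure_def ff)
qed

theorem lemma4p9:
  fixes M :: "'w measure" and S :: "(real ^ 'n) set" and p g1 g2 :: real
    and g :: "'w \<Rightarrow> (real ^ 'n) L1"
  assumes "CARD('n) \<ge> 2"
    and "1 < p" and "p \<noteq> 2"
    and "S \<noteq> {}" and "open S" and "bounded S" and "connected S" and "C1_domain S"
    and "0 < g1" and "g1 \<le> g2"
    and "prob_space M" and "complete_measure M"
    and "g \<in> rv_L1 M S" and "AE \<omega> in M. g \<omega> \<in> L1_between g1 g2 S"
  shows "rv_dense M S (Domain (plap_op M p S g)) \<and>
         rv_dense M S (Domain (plap_op_closure M p S g))"
proof
  show dense: "rv_dense M S (Domain (plap_op M p S g))"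
    by (rule Domain_plap_op_dense) (use assms in auto)
  have "plap_op M p S g \<subseteq> plap_op_closure M p S g"
    unfolding plap_op_closure_def by (rule subset_rv_closure) (auto simp: plap_op_def)
  then have "Domain (plap_op M p S g) \<subseteq> Domain (plap_op_closure M p S g)" by blast
  moreover have "Domain (plap_op_closure M p S g) \<subseteq> rv_L1 M S"
    by (auto simp: plap_op_closure_def rv_closure_def)
  ultimately show "rv_dense M S (Domain (plap_op_closure M p S g))"
    using dense unfolding rv_dense_def by blast
qed

end
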